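(* Let $X=X(K,A)$ be an OT manifold, and let $s>0$ and $2t>0$ be the number of real and complex embeddings of $K$ respectively. If $s$ is odd, then $\dim_{\mathbb{R}}H^2(X,\mathbb{R})=\binom{s}{2}$.
   Context: OT (Oeljeklaus–Toma) manifolds: let $K$ be a number field with $s>0$ real embeddings $\sigma_1,\dots,\sigma_s$ and $2t>0$ non-real complex embeddings $\sigma_{s+1},\dots,\sigma_{s+2t}$, with $\sigma_{s+i}=\overline{\sigma_{s+t+i}}$ for $1\le i\le t$. Let $\mathcal{O}_K$ be the ring of integers, $\mathcal{O}_K^*$ its unit group, and $\mathcal{O}_K^{*,+}$ the group of units that are positive under all real embeddings. Consider the logarithmic map $\ell:\mathcal{O}_K^*\to\mathbb{R}^{s+t}$, $a\mapsto(\ln|\sigma_1(a)|,\dots,\ln|\sigma_s(a)|,2\ln|\sigma_{s+1}(a)|,\dots,2\ln|\sigma_{s+t}(a)|)$. A subgroup $A$ of $\mathcal{O}_K^{*,+}$, $A\cong\mathbb{Z}^s$, is called admissible if the projection of $\ell(A)$ to the first $s$ coordinates is a full lattice in $\mathbb{R}^s$. Let $\mathbb{H}$ be the upper half-plane. For admissible $A$, the group $A\ltimes\mathcal{O}_K$ acts freely and properly discontinuously on $\mathbb{H}^s\times\mathbb{C}^t$, where $c\in\mathcal{O}_K$ acts by translation by $(\sigma_1(c),\dots,\sigma_{s+t}(c))$ and $a\in A$ acts by componentwise multiplication by $(\sigma_1(a),\dots,\sigma_{s+t}(a))$; the quotient $X(K,A)=(\mathbb{H}^s\times\mathbb{C}^t)/(A\ltimes\mathcal{O}_K)$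 is a compact complex manifold, called an OT manifold. *)

theory Defs
  imports
    "HOL-Analysis.Analysis"
    "HOL-Homology.Homology"
    "HOL-Algebra.Group_Action"
    "HOL-Algebra.Product_Groups"
    "Jordan_Normal_Form.VS_Connect"
begin

section \<open>Real singular cohomology\<close>

definition quotient_module :: "('r, 'm, 'c) module_scheme \<Rightarrow> 'm set \<Rightarrow> ('r, 'm set) module" where
  "quotient_module M N =
     \<lparr>carrier = a_rcosets\<^bsub>M\<^esub> N, monoid.mult = undefined, one = undefined,
      zero = N, add = (<+>\<^bsub>M\<^esub>),
      smult = (\<lambda>r S. \<Union>x\<in>S. N +>\<^bsub>M\<^esub> (r \<odot>\<^bsub>M\<^esub> x))\<rparr>"



lemma vectorspace_quotient_module:
  assumes "vectorspace R M" and "submodule R N M"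
  shows "vectorspace R (quotient_module M N)"
proof -
  interpret M: vectorspace R M by fact
  interpret S: LinearCombinations.submodule R N M by fact
  have sub: "subgroup N (add_monoid M)"
  proof
    show "inv\<^bsub>add_monoid M\<^esub> x \<in> N" if "x \<in> N" for x
      using that S.subset M.smult_minus_1[of x] S.smult_closed[of "\<ominus>\<^bsub>R\<^esub> \<one>\<^bsub>R\<^esub>" x]
      by (metis M.R.add.inv_closed M.R.one_closed a_inv_def subsetD)
  qed (use S.subset in auto)
  then have "abelian_subgroup N M"
    using M.abelian_group_axioms by (intro abelian_subgroupI3 additive_subgroup.intro)
  then interpret N: abelian_subgroup N M .
  let ?Q = "quotient_module M N"
  have carr: "carrier ?Q = (\<lambda>x. N +>\<^bsub>M\<^esub> x) ` carrier M"
    by (auto simp: quotient_module_def A_RCOSETS_def' RCOSETS_def a_r_coset_def A_RCOSETS_def)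
  have addQ: "(N +>\<^bsub>M\<^esub> x) \<oplus>\<^bsub>?Q\<^esub> (N +>\<^bsub>M\<^esub> y) = N +>\<^bsub>M\<^esub> (x \<oplus>\<^bsub>M\<^esub> y)"
    if "x \<in> carrier M" "y \<in> carrier M" for x y
    using N.a_rcos_sum[OF that] by (simp add: quotient_module_def)
  have zeroQ: "\<zero>\<^bsub>?Q\<^esub> = N +>\<^bsub>M\<^esub> \<zero>\<^bsub>M\<^esub>"
    using S.subset by (simp add: quotient_module_def)
  have grp: "abelian_group ?Q"
  proof (rule abelian_groupI)
    fix U assume "U \<in> carrier ?Q"
    then obtain x where x: "x \<in> carrier M" "U = N +>\<^bsub>M\<^esub> x" by (auto simp: carr)
    then have "(N +>\<^bsub>M\<^esub> (\<ominus>\<^bsub>M\<^esub> x)) \<oplus>\<^bsub>?Q\<^esub> U = \<zero>\<^bsub>?Q\<^esub>"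
      by (simp add: addQ zeroQ M.M.l_neg)
    with x show "\<exists>V\<in>carrier ?Q. V \<oplus>\<^bsub>?Q\<^esub> U = \<zero>\<^bsub>?Q\<^esub>" by (auto simp: carr)
  qed (auto simp: carr addQ zeroQ M.M.a_ac)
  have smultQ: "r \<odot>\<^bsub>?Q\<^esub> (N +>\<^bsub>M\<^esub> x) = N +>\<^bsub>M\<^esub> (r \<odot>\<^bsub>M\<^esub> x)"
    if r: "r \<in> carrier R" and x: "x \<in> carrier M" for r x
  proof -
    have const: "N +>\<^bsub>M\<^esub> (r \<odot>\<^bsub>M\<^esub> y) = N +>\<^bsub>M\<^esub> (r \<odot>\<^bsub>M\<^esub> x)" if y: "y \<in> N +>\<^bsub>M\<^esub> x" for y
    proof -
      obtain n where n: "n \<in> N" "y = n \<oplus>\<^bsub>M\<^esub> x"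
        using y by (auto simp: a_r_coset_def')
      have nM: "n \<in> carrier M" using n S.subset by blast
      have "r \<odot>\<^bsub>M\<^esub> y = r \<odot>\<^bsub>M\<^esub> n \<oplus>\<^bsub>M\<^esub> r \<odot>\<^bsub>M\<^esub> x"
        using n nM r x by (simp add: M.smult_r_distr)
      then have "r \<odot>\<^bsub>M\<^esub> y \<in> N +>\<^bsub>M\<^esub> (r \<odot>\<^bsub>M\<^esub> x)"
        using S.smult_closed[OF r n(1)] by (auto simp: a_r_coset_def')
      then show ?thesis
        using N.a_repr_independence'[OF _ M.smult_closed[OF r x]] by simp
    qed
    have "x \<in> N +>\<^bsub>M\<^esub> x" using x by (rule N.a_rcos_self)
    then have ne: "N +>\<^bsub>M\<^esub> x \<noteq> {}" by blast
    have "(\<Union>y \<in> N +>\<^bsub>M\<^esub> x. N +>\<^bsub>M\<^esub> (r \<odot>\<^bsub>M\<^esub> y)) = N +>\<^bsub>M\<^esub> (r \<odot>\<^bsub>M\<^esub> x)"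
      by (rule SUP_eq_const[OF ne const])
    then show ?thesis by (simp add: quotient_module_def)
  qed
  have "module R ?Q"
  proof (rule moduleI)
    show "cring R" ..
    show "abelian_group ?Q" by (rule grp)
  qed (auto simp: carr smultQ addQ M.smult_l_distr M.smult_r_distr M.smult_assoc1)
  then show ?thesis
    using M.field_axioms by (intro vectorspace.intro)
qed

text \<open>Real cochains are elements of \<open>Hom(C\<^sub>p(X), \<real>)\<close>. HOL functions being total, a cochain is
  taken to be \<open>0\<close> outside the chain group, so that the pointwise operations are the right ones.\<close>

definition singular_cochains :: "nat \<Rightarrow> 'a topology \<Rightarrow> ('a chain \<Rightarrow> real) set" where
  "singular_cochains p X =
     {f \<in> hom (chain_group p X) (add_monoid class_ring). \<forall>c. \<not> singular_chain p X c \<longrightarrow> f c = 0}"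

definition coboundary :: "nat \<Rightarrow> 'a topology \<Rightarrow> ('a chain \<Rightarrow> real) \<Rightarrow> ('a chain \<Rightarrow> real)" where
  "coboundary p X f =
     (\<lambda>c. if singular_chain (Suc p) X c then f (chain_boundary (Suc p) c) else 0)"

definition cochain_module :: "nat \<Rightarrow> 'a topology \<Rightarrow> (real, 'a chain \<Rightarrow> real) module" where
  "cochain_module p X =
     \<lparr>carrier = singular_cochains p X, monoid.mult = undefined, one = undefined,
      zero = (\<lambda>c. 0), add = (\<lambda>f g c. f c + g c), smult = (\<lambda>r f c. r * f c)\<rparr>"

definition singular_cocycles :: "nat \<Rightarrow> 'a topology \<Rightarrow> ('a chain \<Rightarrow> real) set" where
  "singular_cocycles p X = {f \<in> singular_cochains p X. coboundary p X f = (\<lambda>c. 0)}"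

fun singular_coboundaries :: "nat \<Rightarrow> 'a topology \<Rightarrow> ('a chain \<Rightarrow> real) set" where
  "singular_coboundaries 0 X = {\<lambda>c. 0}"
| "singular_coboundaries (Suc p) X = coboundary p X ` singular_cochains p X"

definition real_cohomology :: "nat \<Rightarrow> 'a topology \<Rightarrow> (real, ('a chain \<Rightarrow> real) set) module" where
  "real_cohomology p X =
     quotient_module ((cochain_module p X)\<lparr>carrier := singular_cocycles p X\<rparr>)
       (singular_coboundaries p X)"

lemma vectorspace_real_cohomology: "vectorspace class_ring (real_cohomology p X)"
proof -
  let ?C = "\<lambda>p. cochain_module p X"
  have C0: "(\<lambda>c. 0) \<in> singular_cochains p X" for p
    by (auto simp: singular_cochains_def hom_def)
  have Cadd: "(\<lambda>c. f c + g c) \<in> singular_cochains p X"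
    if "f \<in> singular_cochains p X" "g \<in> singular_cochains p X" for f g p
    using that by (auto simp: singular_cochains_def hom_def)
  have Csm: "(\<lambda>c. r * f c) \<in> singular_cochains p X" if "f \<in> singular_cochains p X" for f r p
    using that by (auto simp: singular_cochains_def hom_def algebra_simps)
  have cring: "cring (class_ring :: real ring)" ..
  have modC: "module class_ring (?C p)" for p
  proof (rule moduleI[OF cring])
    show "abelian_group (?C p)"
    proof (rule abelian_groupI)
      fix f assume "f \<in> carrier (?C p)"
      then show "\<exists>g\<in>carrier (?C p). g \<oplus>\<^bsub>?C p\<^esub> f = \<zero>\<^bsub>?C p\<^esub>"
        using Csm[of f p "-1"] by (intro bexI[of _ "\<lambda>c. -1 * f c"]) (auto simp: cochain_module_def)
    qed (use C0 Cadd in \<open>auto simp: cochain_module_def algebra_simps\<close>)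
  qed (use Csm in \<open>auto simp: cochain_module_def algebra_simps\<close>)
  have cob_add: "coboundary p X (\<lambda>c. f c + g c) = (\<lambda>c. coboundary p X f c + coboundary p X g c)"
    and cob_sm: "coboundary p X (\<lambda>c. r * f c) = (\<lambda>c. r * coboundary p X f c)"
    and cob_0: "coboundary p X (\<lambda>c. 0) = (\<lambda>c. 0)" for p f g r
    by (auto simp: coboundary_def)
  have cob_closed: "coboundary p X f \<in> singular_cochains (Suc p) X"
    if "f \<in> singular_cochains p X" for p f
    using that singular_chain_boundary[of "Suc p" X]
    by (auto simp: singular_cochains_def hom_def coboundary_def singular_chain_add chain_boundary_add)
  have cob_cob: "coboundary (Suc p) X (coboundary p X f) = (\<lambda>c. 0)"
    if "f \<in> singular_cochains p X" for p f
  proof -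
    have "singular_chain p X 0" by simp
    then have "f (0 + 0) = f 0 + f 0"
      using that unfolding singular_cochains_def hom_def by force
    then have "f 0 = 0" by simp
    then show ?thesis
      by (auto simp: coboundary_def chain_boundary_boundary_alt fun_eq_iff)
  qed
  have Z: "submodule class_ring (singular_cocycles p X) (?C p)"
    by (rule LinearCombinations.submodule.intro[OF modC])
       (auto simp: singular_cocycles_def cochain_module_def C0 Cadd Csm cob_add cob_sm cob_0)
  then have modZ: "module class_ring ((?C p)\<lparr>carrier := singular_cocycles p X\<rparr>)"
    using module.submodule_is_module[OF modC] by blast
  have "field (class_ring :: real ring)" by (rule class_field.field_axioms)
  with modZ have vsZ: "vectorspace class_ring ((?C p)\<lparr>carrier := singular_cocycles p X\<rparr>)"
    by (intro vectorspace.intro)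
  have B: "submodule class_ring (singular_coboundaries p X)
             ((?C p)\<lparr>carrier := singular_cocycles p X\<rparr>)"
  proof (cases p)
    case 0
    show ?thesis
      by (rule LinearCombinations.submodule.intro[OF modZ])
         (auto simp: 0 singular_cocycles_def cochain_module_def C0 cob_0)
  next
    case (Suc q)
    have "\<exists>h\<in>singular_cochains q X. (\<lambda>c. coboundary q X f c + coboundary q X g c) = coboundary q X h"
      if "f \<in> singular_cochains q X" "g \<in> singular_cochains q X" for f g
      using Cadd[OF that] cob_add by metis
    moreover have "\<exists>h\<in>singular_cochains q X. (\<lambda>c. r * coboundary q X f c) = coboundary q X h"
      if "f \<in> singular_cochains q X" for f r
      using Csm[OF that] cob_sm by metis
    moreover have "\<exists>h\<in>singular_cochains q X. (\<lambda>c. 0) = coboundary q X h"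
      using C0 cob_0 by metis
    ultimately show ?thesis
      by (intro LinearCombinations.submodule.intro[OF modZ])
         (auto simp: Suc singular_cocycles_def cochain_module_def cob_closed cob_cob image_iff)
  qed
  show ?thesis
    unfolding real_cohomology_def by (rule vectorspace_quotient_module[OF vsZ B])
qed


section \<open>Quotient topology\<close>

definition quotient_topology :: "'a topology \<Rightarrow> ('a \<Rightarrow> 'b) \<Rightarrow> 'b topology" where
  "quotient_topology X f =
     topology (\<lambda>U. U \<subseteq> f ` topspace X \<and> openin X {x \<in> topspace X. f x \<in> U})"

lemma openin_quotient_topology:
  "openin (quotient_topology X f) U \<longleftrightarrow>
     U \<subseteq> f ` topspace X \<and> openin X {x \<in> topspace X. f x \<in> U}"
proof -
  have "istopology (\<lambda>U. U \<subseteq> f ` topspace X \<and> openin X {x \<in> topspace X. f x \<in> U})"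
    unfolding istopology_def
  proof (intro conjI allI impI)
    fix S T assume S: "S \<subseteq> f ` topspace X \<and> openin X {x \<in> topspace X. f x \<in> S}"
      and T: "T \<subseteq> f ` topspace X \<and> openin X {x \<in> topspace X. f x \<in> T}"
    then show "S \<inter> T \<subseteq> f ` topspace X" by blast
    have "{x \<in> topspace X. f x \<in> S \<inter> T} =
        {x \<in> topspace X. f x \<in> S} \<inter> {x \<in> topspace X. f x \<in> T}" by blast
    with S T show "openin X {x \<in> topspace X. f x \<in> S \<inter> T}"
      by (simp only: openin_Int)
  next
    fix \<K> assume K: "\<forall>S\<in>\<K>. S \<subseteq> f ` topspace X \<and> openin X {x \<in> topspace X. f x \<in> S}"
    then show "\<Union> \<K> \<subseteq> f ` topspace X" by blast
    have "{x \<in> topspace X. f x \<in> \<Union>\<K>} = (\<Union>S\<in>\<K>. {x \<in> topspace X. f x \<in> S})" by blast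
    moreover have "openin X (\<Union>S\<in>\<K>. {x \<in> topspace X. f x \<in> S})"
      using K by (intro openin_Union) blast
    ultimately show "openin X {x \<in> topspace X. f x \<in> \<Union>\<K>}" by simp
  qed
  then show ?thesis unfolding quotient_topology_def by (simp only: topology_inverse')
qed

lemma topspace_quotient_topology [simp]: "topspace (quotient_topology X f) = f ` topspace X"
proof
  show "topspace (quotient_topology X f) \<subseteq> f ` topspace X"
    using openin_topspace[of "quotient_topology X f"] by (simp only: openin_quotient_topology)
  have "{x \<in> topspace X. f x \<in> f ` topspace X} = topspace X" by blast
  then show "f ` topspace X \<subseteq> topspace (quotient_topology X f)"
    by (intro openin_subset) (simp only: openin_quotient_topology openin_topspace subset_refl)
qed

lemma quotient_map_quotient_topology: "quotient_map X (quotient_topology X f) f"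
  unfolding quotient_map_def openin_quotient_topology topspace_quotient_topology by blast


section \<open>Number fields and admissible groups of units\<close>

definition number_field :: "'k::field_char_0 itself \<Rightarrow> bool" where
  "number_field _ \<longleftrightarrow> (\<exists>B. finite_dimensional_vector_space (\<lambda>(q::rat) (x::'k). of_rat q * x) B)"

text \<open>\<open>\<sigma> 0, \<dots>, \<sigma> (s - 1)\<close> are the real embeddings and \<open>\<sigma> s, \<dots>, \<sigma> (s + 2 t - 1)\<close> the non-real
  ones; indices start at \<open>0\<close> throughout.\<close>

definition enumerates_embeddings ::
    "nat \<Rightarrow> nat \<Rightarrow> (nat \<Rightarrow> 'k::field_char_0 \<Rightarrow> complex) \<Rightarrow> bool" where
  "enumerates_embeddings s t \<sigma> \<longleftrightarrow>
     bij_betw \<sigma> {..<s + 2 * t} {\<tau>. field_hom \<tau>} \<and>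
     (\<forall>i<s. range (\<sigma> i) \<subseteq> \<real>) \<and>
     (\<forall>i\<in>{s..<s + 2 * t}. \<not> range (\<sigma> i) \<subseteq> \<real>) \<and>
     (\<forall>i<t. \<forall>x. \<sigma> (s + i) x = cnj (\<sigma> (s + t + i) x))"

definition ring_of_integers :: "'k::field_char_0 set" where
  "ring_of_integers = {x. algebraic_int x}"

definition integer_units :: "'k::field_char_0 set" where
  "integer_units = {u \<in> ring_of_integers. \<exists>v\<in>ring_of_integers. u * v = 1}"

definition positive_unit_group :: "nat \<Rightarrow> (nat \<Rightarrow> 'k::field_char_0 \<Rightarrow> complex) \<Rightarrow> 'k monoid" where
  "positive_unit_group s \<sigma> =
     \<lparr>carrier = {u \<in> integer_units. \<forall>i<s. 0 < Re (\<sigma> i u)}, monoid.mult = (*), one = 1\<rparr>"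

definition log_map ::
    "nat \<Rightarrow> nat \<Rightarrow> (nat \<Rightarrow> 'k::field_char_0 \<Rightarrow> complex) \<Rightarrow> 'k \<Rightarrow> real Matrix.vec" where
  "log_map s t \<sigma> a =
     Matrix.vec (s + t) (\<lambda>i. if i < s then ln (cmod (\<sigma> i a)) else 2 * ln (cmod (\<sigma> i a)))"

text \<open>A full lattice in \<open>\<real>\<^sup>n\<close> is the \<open>\<int>\<close>-span of a basis of \<open>\<real>\<^sup>n\<close>; here the basis vectors are
  the columns of \<open>B\<close>.\<close>

definition full_lattice :: "nat \<Rightarrow> real Matrix.vec set \<Rightarrow> bool" where
  "full_lattice n L \<longleftrightarrow>
     (\<exists>B \<in> carrier_mat n n. invertible_mat B \<and>
        L = (\<lambda>z. B *\<^sub>v map_vec real_of_int z) ` carrier_vec n)"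

definition admissible ::
    "nat \<Rightarrow> nat \<Rightarrow> (nat \<Rightarrow> 'k::field_char_0 \<Rightarrow> complex) \<Rightarrow> 'k set \<Rightarrow> bool" where
  "admissible s t \<sigma> A \<longleftrightarrow>
     subgroup A (positive_unit_group s \<sigma>) \<and>
     (positive_unit_group s \<sigma>)\<lparr>carrier := A\<rparr> \<cong> product_group {..<s} (\<lambda>_. integer_group) \<and>
     full_lattice s ((\<lambda>v. vec_first v s) ` log_map s t \<sigma> ` A)"


section \<open>Oeljeklaus--Toma manifolds\<close>

text \<open>\<open>A \<ltimes> O\<^sub>K\<close>, where \<open>(a, c)\<close> stands for the affine map \<open>x \<mapsto> a x + c\<close>.\<close>

definition OT_group :: "'k::field_char_0 set \<Rightarrow> ('k \<times> 'k) monoid" where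
  "OT_group A =
     \<lparr>carrier = A \<times> ring_of_integers,
      monoid.mult = (\<lambda>(a, c) (b, d). (a * b, a * d + c)), one = (1, 0)\<rparr>"

definition OT_cover :: "nat \<Rightarrow> nat \<Rightarrow> (nat \<Rightarrow> complex) topology" where
  "OT_cover s t =
     product_topology (\<lambda>i. if i < s then top_of_set {z. 0 < Im z} else euclidean) {..<s + t}"

definition OT_action ::
    "nat \<Rightarrow> nat \<Rightarrow> (nat \<Rightarrow> 'k::field_char_0 \<Rightarrow> complex) \<Rightarrow> 'k \<times> 'k
      \<Rightarrow> (nat \<Rightarrow> complex) \<Rightarrow> (nat \<Rightarrow> complex)" where
  "OT_action s t \<sigma> = (\<lambda>(a, c). \<lambda>z\<in>topspace (OT_cover s t). \<lambda>i\<in>{..<s + t}. \<sigma> i a * z i + \<sigma> i c)"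

text \<open>Only the underlying topological space of \<open>X(K, A)\<close> is recorded: its points are the orbits.\<close>

definition OT_manifold ::
    "nat \<Rightarrow> nat \<Rightarrow> (nat \<Rightarrow> 'k::field_char_0 \<Rightarrow> complex) \<Rightarrow> 'k set
      \<Rightarrow> (nat \<Rightarrow> complex) set topology" where
  "OT_manifold s t \<sigma> A =
     quotient_topology (OT_cover s t) (Group_Action.orbit (OT_group A) (OT_action s t \<sigma>))"

end

theory Submission
  imports Defs "Jordan_Normal_Form.Char_Poly"
begin

text \<open>
  The manifold is \<open>U / \<Gamma>\<close> with \<open>U = \<H>\<^sup>s \<times> \<complex>\<^sup>t\<close> convex and \<open>\<Gamma> = A \<ltimes> O\<^sub>K\<close>. A singular \<open>2\<close>-cocycle
  on the quotient pulls back to a coboundary \<open>\<delta>v\<close> on \<open>U\<close>, and the failure of \<open>v\<close> to be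
  invariant is a group \<open>2\<close>-cocycle \<open>c\<close> of \<open>\<Gamma>\<close> (no continuity is involved, only the freeness of the
  action). Evaluating on the tori spanned by pairs of basis elements of \<open>A\<close> gives \<open>s choose 2\<close>
  functionals; cup products of the classes given by the logarithms of the imaginary parts are dual
  to them. What remains is that \<open>c\<close> is a coboundary if it is symmetric on a basis of \<open>A\<close>.

  Restricted to \<open>O\<^sub>K\<close>, the antisymmetrisation of \<open>c\<close> is a biadditive \<open>A\<close>-invariant form \<open>\<omega>\<close>. For \<open>u \<in> A\<close>
  and an integer polynomial \<open>p\<close> with \<open>p(u) = 0\<close> we get \<open>0 = \<omega>(p(u) x, y) = \<omega>(x, p(1/u) y)\<close>, so
  \<open>\<omega> = 0\<close> once \<open>p(1/u) \<noteq> 0\<close>. As \<open>s\<close> is odd, so is the degree of \<open>K\<close>, hence that of the minimal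
  polynomial of \<open>u\<close>; a reciprocal polynomial of odd degree vanishes at \<open>\<plusminus>1\<close>, so \<open>1/u\<close> is no conjugate
  of \<open>u \<noteq> 1\<close>. The central extension of \<open>O\<^sub>K\<close> by \<open>\<real>\<close> is then abelian and \<open>p(u) / p(1)\<close> is an
  \<open>A\<close>-invariant retraction of it onto \<open>\<real>\<close>, so that \<open>c\<close> comes from the free abelian group \<open>A\<close>.
\<close>

section \<open>Sums and products of algebraic integers\<close>

text \<open>The algebra follows the Hochschild-Serre filtration for \<open>A\<close> acting on
  \<open>O_K\<close>: vanishing of \<omega> removes the invariant part of H^2(\<open>O_K\<close>),
  the invariant retraction removes H^1(\<open>A\<close>, Hom(\<open>O_K\<close>, \<real>)), and
  symmetry on a basis settles H^2(\<open>A\<close>). Explicit central extensions replace the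
  spectral sequence, so each step is a formula for one cocycle. One unit \<open>u\<close> serves
  twice: p(1/u) \<noteq> 0 for the form, p(1) \<noteq> 0 for the retraction. The retraction is
  invariant because \<open>A\<close> is commutative. Real coefficients matter in both places: no
  torsion, so a multiple m z can stand in for z, and division by p(1). The degree of K is reached by
  counting embeddings: a homomorphism from a subfield to \<complex> has a number of extensions that
  does not depend on the homomorphism, so the degree of a minimal polynomial divides s + 2t. On the
  topological side cochains are arbitrary functions on simplices, so paths, fillings and orbit
  representatives may be chosen at will. The inputs are filling of cycles in U and lifting of
  simplices, unique up to \<Gamma>; the latter rests on discreteness of the logarithms of
  \<open>A\<close> and on the norm bound for \<open>O_K\<close>.\<close>

lemma algebraic_int_of_linear_system:
  fixes z :: "'k::field_char_0" and v :: "'i \<Rightarrow> 'k" and a :: "'i \<Rightarrow> 'i \<Rightarrow> int"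
  assumes "finite I" and "i0 \<in> I" "v i0 \<noteq> 0"
    and eq: "\<And>i. i \<in> I \<Longrightarrow> z * v i = (\<Sum>j\<in>I. of_int (a i j) * v j)"
  shows "algebraic_int z"
proof -
  define n where "n = card I"
  obtain h where h: "bij_betw h {..<n} I"
    using ex_bij_betw_nat_finite[OF \<open>finite I\<close>] unfolding n_def by (auto simp: atLeast0LessThan)
  define M :: "int mat" where "M = Matrix.mat n n (\<lambda>(i, j). a (h i) (h j))"
  define N :: "'k mat" where "N = map_mat of_int M"
  define w where "w = Matrix.vec n (\<lambda>i. v (h i))"
  have N: "N \<in> carrier_mat n n" and M: "M \<in> carrier_mat n n" by (auto simp: N_def M_def)
  have w: "w \<in> carrier_vec n" by (auto simp: w_def)
  obtain k where k: "k < n" "h k = i0"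
    using h assms(2) by (metis bij_betw_imp_surj_on imageE lessThan_iff)
  have "w $ k \<noteq> 0\<^sub>v n $ k" using k assms(3) by (simp add: w_def)
  then have w0: "w \<noteq> 0\<^sub>v n" by metis
  \<comment> \<open>The determinant trick: the relations make \<open>w\<close> an eigenvector of an
    integer matrix, whose characteristic polynomial is monic and integral.\<close>
  have "N *\<^sub>v w = z \<cdot>\<^sub>v w"
  proof (rule eq_vecI)
    fix i assume "i < dim_vec (z \<cdot>\<^sub>v w)"
    then have i: "i < n" by (simp add: w_def)
    then have hi: "h i \<in> I" using h by (auto simp: bij_betw_def)
    have "(N *\<^sub>v w) $ i = (\<Sum>j<n. of_int (a (h i) (h j)) * v (h j))"
      using i by (simp add: N_def M_def w_def scalar_prod_def atLeast0LessThan)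
    also have "\<dots> = (\<Sum>j\<in>I. of_int (a (h i) j) * v j)"
      by (rule sum.reindex_bij_betw[OF h])
    also have "\<dots> = z * v (h i)" using eq[OF hi] by simp
    finally show "(N *\<^sub>v w) $ i = (z \<cdot>\<^sub>v w) $ i" using i by (simp add: w_def)
  qed (simp add: N_def M_def w_def)
  with w w0 have "eigenvalue N z" using N unfolding eigenvalue_def eigenvector_def by auto
  then have "poly (char_poly N) z = 0" using eigenvalue_root_char_poly[OF N] by simp
  moreover have "char_poly N = map_poly of_int (char_poly M)"
    unfolding N_def by (rule of_int_hom.char_poly_hom[OF M])
  moreover have "lead_coeff (char_poly M) = 1" using degree_monic_char_poly[OF M] by auto
  ultimately show ?thesis unfolding algebraic_int_altdef_ipoly by auto
qed

definition int_span :: "('i \<Rightarrow> 'k::field_char_0) \<Rightarrow> 'i set \<Rightarrow> 'k set" where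
  "int_span v I = range (\<lambda>a. \<Sum>i\<in>I. of_int (a i) * v i)"

lemma int_span_0: "0 \<in> int_span v I"
  unfolding int_span_def by (rule range_eqI[of _ _ "\<lambda>_. 0"]) simp

lemma int_span_add: "x \<in> int_span v I \<Longrightarrow> y \<in> int_span v I \<Longrightarrow> x + y \<in> int_span v I"
proof -
  assume "x \<in> int_span v I" "y \<in> int_span v I"
  then obtain a b where "x = (\<Sum>i\<in>I. of_int (a i) * v i)" "y = (\<Sum>i\<in>I. of_int (b i) * v i)"
    unfolding int_span_def by blast
  then have "x + y = (\<Sum>i\<in>I. of_int (a i + b i) * v i)"
    by (simp add: sum.distrib algebra_simps)
  then show ?thesis unfolding int_span_def by fast
qed

lemma int_span_mult: "x \<in> int_span v I \<Longrightarrow> of_int m * x \<in> int_span v I"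
proof -
  assume "x \<in> int_span v I"
  then obtain a where "x = (\<Sum>i\<in>I. of_int (a i) * v i)"
    unfolding int_span_def by blast
  then have "of_int m * x = (\<Sum>i\<in>I. of_int (m * a i) * v i)"
    by (simp add: sum_distrib_left algebra_simps)
  then show ?thesis unfolding int_span_def by fast
qed

lemma int_span_sum: "(\<And>j. j \<in> J \<Longrightarrow> f j \<in> int_span v I) \<Longrightarrow> sum f J \<in> int_span v I"
  by (induction J rule: infinite_finite_induct) (auto simp: int_span_0 int_span_add)

lemma int_span_superset: "finite I \<Longrightarrow> i \<in> I \<Longrightarrow> v i \<in> int_span v I"
  unfolding int_span_def by (rule range_eqI[of _ _ "\<lambda>j. if j = i then 1 else 0"])
    (simp add: if_distrib[of of_int] if_distrib[of "\<lambda>x. x * _"] cong: if_cong)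

lemma int_span_mult_closed:
  assumes "\<And>i. i \<in> I \<Longrightarrow> z * v i \<in> int_span v I" and "x \<in> int_span v I"
  shows "z * x \<in> int_span v I"
proof -
  obtain a where "x = (\<Sum>i\<in>I. of_int (a i) * v i)"
    using assms(2) unfolding int_span_def by blast
  then have "z * x = (\<Sum>i\<in>I. of_int (a i) * (z * v i))"
    by (simp add: sum_distrib_left algebra_simps)
  also have "\<dots> \<in> int_span v I" using assms(1) by (intro int_span_sum int_span_mult)
  finally show ?thesis .
qed

lemma algebraic_int_of_int_span:
  assumes "finite I" "i0 \<in> I" "v i0 \<noteq> 0" and "\<And>i. i \<in> I \<Longrightarrow> z * v i \<in> int_span v I"
  shows "algebraic_int z"
proof -
  have "\<exists>a. \<forall>i\<in>I. z * v i = (\<Sum>j\<in>I. of_int (a i j) * v j)"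
    using assms(4) unfolding int_span_def by (intro bchoice) blast
  then obtain a where "\<forall>i\<in>I. z * v i = (\<Sum>j\<in>I. of_int (a i j) * v j)" ..
  then show ?thesis using algebraic_int_of_linear_system[of I i0 v z a] assms(1-3) by blast
qed

lemma algebraic_int_power_reduction:
  fixes x :: "'k::field_char_0"
  assumes "algebraic_int x"
  obtains m a where "m > 0" "x ^ m = (\<Sum>i<m. of_int (a i) * x ^ i)"
proof -
  obtain p where p: "poly (map_poly of_int p) x = 0" "lead_coeff p = 1"
    using assms unfolding algebraic_int_altdef_ipoly by blast
  have "degree p > 0"
  proof (rule ccontr)
    assume "\<not> ?thesis"
    then have "p = 1" using p(2) by (metis degree_eq_zeroE gr0I lead_coeff_pCons(2) one_pCons)
    then show False using p(1) by simp
  qed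
  moreover have "0 = (\<Sum>i\<le>degree p. of_int (Polynomial.coeff p i) * x ^ i)"
    using p(1) by (simp add: poly_altdef)
  then have "x ^ degree p = (\<Sum>i<degree p. of_int (- Polynomial.coeff p i) * x ^ i)"
    using p(2) by (simp add: lessThan_Suc_atMost[symmetric] sum_negf add_eq_0_iff2)
  ultimately show ?thesis by (rule that)
qed

text \<open>The products \<open>x ^ i * y ^ j\<close> with \<open>i < m\<close>,
  \<open>j < n\<close> span a finitely generated \<int>-module that is stable under \<open>x\<close>
  and under \<open>y\<close>, hence under their sum and product. It is nonzero because
  \<open>m\<close> and \<open>n\<close> are positive, so that it contains \<open>1\<close>.\<close>

lemma
  fixes x y :: "'k::field_char_0"
  assumes "algebraic_int x" "algebraic_int y"
  shows algebraic_int_add: "algebraic_int (x + y)" and algebraic_int_mult: "algebraic_int (x * y)"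
proof -
  obtain m a where m: "m > 0" "x ^ m = (\<Sum>i<m. of_int (a i) * x ^ i)"
    using algebraic_int_power_reduction[OF assms(1)] .
  obtain n b where n: "n > 0" "y ^ n = (\<Sum>i<n. of_int (b i) * y ^ i)"
    using algebraic_int_power_reduction[OF assms(2)] .
  define I where "I = {..<m} \<times> {..<n}"
  define v where "v = (\<lambda>(i, j). x ^ i * y ^ j)"
  have I: "finite I" "(0, 0) \<in> I" "v (0, 0) \<noteq> 0" using m n by (auto simp: I_def v_def)
  have mem: "x ^ i * y ^ j \<in> int_span v I" if "i < m" "j < n" for i j
    using int_span_superset[of I "(i, j)" v] I that by (auto simp: I_def v_def)
  have x: "x * v p \<in> int_span v I" if p0: "p \<in> I" for p
  proof -
    obtain i j where p: "p = (i, j)" "i < m" "j < n" using p0 by (auto simp: I_def)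
    show ?thesis
    proof (cases "Suc i = m")
      case True
      have "x * v p = x ^ m * y ^ j" using True by (auto simp: p v_def)
      also have "\<dots> = (\<Sum>i<m. of_int (a i) * (x ^ i * y ^ j))"
        unfolding m(2) by (simp add: sum_distrib_right mult.assoc)
      finally have "x * v p = (\<Sum>i<m. of_int (a i) * (x ^ i * y ^ j))" .
      then show ?thesis using p(3) mem by (auto intro!: int_span_sum int_span_mult)
    next
      case False
      then show ?thesis using mem[of "Suc i" j] p by (auto simp: v_def algebra_simps)
    qed
  qed
  have y: "y * v p \<in> int_span v I" if p0: "p \<in> I" for p
  proof -
    obtain i j where p: "p = (i, j)" "i < m" "j < n" using p0 by (auto simp: I_def)
    show ?thesis
    proof (cases "Suc j = n")
      case True
      have "y * v p = x ^ i * y ^ n" using True by (auto simp: p v_def)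
      also have "\<dots> = (\<Sum>j<n. of_int (b j) * (x ^ i * y ^ j))"
        unfolding n(2) by (simp add: sum_distrib_left mult.left_commute)
      finally have "y * v p = (\<Sum>j<n. of_int (b j) * (x ^ i * y ^ j))" .
      then show ?thesis using p(2) mem by (auto intro!: int_span_sum int_span_mult)
    next
      case False
      then show ?thesis using mem[of i "Suc j"] p by (auto simp: v_def algebra_simps)
    qed
  qed
  show "algebraic_int (x + y)"
    by (rule algebraic_int_of_int_span[where v = v, OF I]) (simp add: ring_distribs int_span_add x y)
  show "algebraic_int (x * y)"
    by (rule algebraic_int_of_int_span[where v = v, OF I]) (simp add: mult.assoc int_span_mult_closed x y)
qed

lemma algebraic_int_sum:
  fixes f :: "'i \<Rightarrow> 'k::field_char_0"
  shows "(\<And>i. i \<in> I \<Longrightarrow> algebraic_int (f i)) \<Longrightarrow> algebraic_int (sum f I)"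
  by (induction I rule: infinite_finite_induct) (auto simp: algebraic_int_add)

lemma algebraic_int_prod:
  fixes f :: "'i \<Rightarrow> 'k::field_char_0"
  shows "(\<And>i. i \<in> I \<Longrightarrow> algebraic_int (f i)) \<Longrightarrow> algebraic_int (prod f I)"
  by (induction I rule: infinite_finite_induct) (auto simp: algebraic_int_mult)

lemma algebraic_int_power:
  "algebraic_int (x :: 'k::field_char_0) \<Longrightarrow> algebraic_int (x ^ n)"
  by (induction n) (auto simp: algebraic_int_mult)

lemma algebraic_int_poly:
  fixes x :: "'k::field_char_0"
  shows "(\<And>i. algebraic_int (Polynomial.coeff p i)) \<Longrightarrow> algebraic_int x \<Longrightarrow> algebraic_int (poly p x)"
  unfolding poly_altdef
  by (intro algebraic_int_sum algebraic_int_mult algebraic_int_power) auto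

section \<open>Extensions of embeddings\<close>

text \<open>Inverses come for free in an algebraic extension of \<rat>, see
  \<open>subalg_inverse\<close>; so \<open>adjoin\<close> can consist of polynomial values alone and
  still be a field.\<close>

definition subalg :: "'k::field_char_0 set \<Rightarrow> bool" where
  "subalg L \<longleftrightarrow> \<rat> \<subseteq> L \<and> (\<forall>x\<in>L. \<forall>y\<in>L. x + y \<in> L \<and> x * y \<in> L)"

definition polys_over :: "'k::field_char_0 set \<Rightarrow> 'k poly set" where
  "polys_over L = {p. \<forall>i. Polynomial.coeff p i \<in> L}"

text \<open>A homomorphism on a subfield is encoded by a total function whose values off
  \<open>L\<close> are arbitrary; accordingly \<open>extensions\<close> compares only on
  \<open>L\<close>.\<close>

definition hom_on :: "'k::field_char_0 set \<Rightarrow> ('k \<Rightarrow> complex) \<Rightarrow> bool" where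
  "hom_on L j \<longleftrightarrow> j 1 = 1 \<and> (\<forall>x\<in>L. \<forall>y\<in>L. j (x + y) = j x + j y \<and> j (x * y) = j x * j y)"

definition extensions :: "'k::field_char_0 set \<Rightarrow> ('k \<Rightarrow> complex) \<Rightarrow> ('k \<Rightarrow> complex) set" where
  "extensions L j = {\<tau>. field_hom \<tau> \<and> (\<forall>x\<in>L. \<tau> x = j x)}"

definition adjoin :: "'k::field_char_0 set \<Rightarrow> 'k \<Rightarrow> 'k set" where
  "adjoin L b = (\<lambda>p. poly p b) ` polys_over L"

definition is_min_poly :: "'k::field_char_0 set \<Rightarrow> 'k \<Rightarrow> 'k poly \<Rightarrow> bool" where
  "is_min_poly L b m \<longleftrightarrow> m \<in> polys_over L \<and> lead_coeff m = 1 \<and> poly m b = 0 \<and>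
     (\<forall>q\<in>polys_over L. poly q b = 0 \<longrightarrow> q = 0 \<or> degree m \<le> degree q)"

lemma subalg_Rats: "subalg \<rat>" by (auto simp: subalg_def)

context
  fixes L :: "'k::field_char_0 set"
  assumes L: "subalg L"
begin

lemma subalg_of_rat: "x \<in> \<rat> \<Longrightarrow> x \<in> L" using L by (auto simp: subalg_def)

lemma subalg_0_1 [simp]: "0 \<in> L" "1 \<in> L" "-1 \<in> L" by (auto intro: subalg_of_rat)

lemma subalg_add: "x \<in> L \<Longrightarrow> y \<in> L \<Longrightarrow> x + y \<in> L"
  and subalg_mult: "x \<in> L \<Longrightarrow> y \<in> L \<Longrightarrow> x * y \<in> L"
  using L by (auto simp: subalg_def)

lemma subalg_sum: "(\<And>i. i \<in> I \<Longrightarrow> f i \<in> L) \<Longrightarrow> sum f I \<in> L"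
  by (induction I rule: infinite_finite_induct) (auto intro: subalg_add)

lemma polys_over_pCons: "pCons a p \<in> polys_over L \<longleftrightarrow> a \<in> L \<and> p \<in> polys_over L"
  unfolding polys_over_def by (auto simp: coeff_pCons split: nat.splits)

lemma polys_over_0 [simp]: "0 \<in> polys_over L" by (simp add: polys_over_def)

lemma polys_over_add: "p \<in> polys_over L \<Longrightarrow> q \<in> polys_over L \<Longrightarrow> p + q \<in> polys_over L"
  by (simp add: polys_over_def subalg_add)

lemma polys_over_mult: "p \<in> polys_over L \<Longrightarrow> q \<in> polys_over L \<Longrightarrow> p * q \<in> polys_over L"
  by (simp add: polys_over_def coeff_mult subalg_sum subalg_mult)

lemma polys_over_smult: "a \<in> L \<Longrightarrow> q \<in> polys_over L \<Longrightarrow> Polynomial.smult a q \<in> polys_over L"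
  by (simp add: polys_over_def subalg_mult)

lemma polys_over_diff: "p \<in> polys_over L \<Longrightarrow> q \<in> polys_over L \<Longrightarrow> p - q \<in> polys_over L"
  using polys_over_add[of p "Polynomial.smult (-1) q"] polys_over_smult[of "-1" q] by simp

lemma polys_over_monom: "a \<in> L \<Longrightarrow> Polynomial.monom a n \<in> polys_over L"
  by (simp add: polys_over_def)

lemma polys_over_pderiv: "p \<in> polys_over L \<Longrightarrow> pderiv p \<in> polys_over L"
  by (auto simp: polys_over_def coeff_pderiv simp del: of_nat_Suc intro!: subalg_mult subalg_of_rat[of "of_nat _"])

lemma poly_in_subalg: "p \<in> polys_over L \<Longrightarrow> x \<in> L \<Longrightarrow> poly p x \<in> L"
  by (induction p) (auto simp: polys_over_pCons intro!: subalg_add subalg_mult)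

text \<open>A rational annihilator \<open>c + x * q(x)\<close> of least degree has
  \<open>c \<noteq> 0\<close>, since otherwise \<open>q\<close> would be a smaller one; then
  \<open>- q(x) / c\<close> is the inverse and is a polynomial in \<open>x\<close>.\<close>

lemma subalg_inverse:
  assumes "algebraic x" "x \<in> L"
  shows "inverse x \<in> L"
proof (cases "x = 0")
  case False
  have "\<exists>p. p \<noteq> 0 \<and> p \<in> polys_over \<rat> \<and> poly p x = 0"
    using \<open>algebraic x\<close> unfolding algebraic_def polys_over_def using Ints_subset_Rats by blast
  then obtain p where p: "p \<noteq> 0" "p \<in> polys_over \<rat>" "poly p x = 0"
    and least: "\<And>q. q \<noteq> 0 \<and> q \<in> polys_over \<rat> \<and> poly q x = 0 \<Longrightarrow> degree p \<le> degree q"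
    using ex_has_least_nat[of "\<lambda>p. p \<noteq> 0 \<and> p \<in> polys_over \<rat> \<and> poly p x = 0" _ degree] by metis
  obtain c q where pq: "p = pCons c q" by (cases p)
  have c: "c \<in> \<rat>" and q: "q \<in> polys_over \<rat>"
    using p(2) unfolding pq polys_over_def by (force simp: coeff_pCons split: nat.splits)+
  have "c \<noteq> 0"
  proof
    assume c0: "c = 0"
    then have "q \<noteq> 0" "poly q x = 0" using p False by (auto simp: pq)
    then show False using least[of q] q c0 by (simp add: pq)
  qed
  moreover have "q \<in> polys_over L" using q subalg_of_rat by (auto simp: polys_over_def)
  then have "poly q x \<in> L" using assms(2) poly_in_subalg by blast
  moreover have "- inverse c \<in> L" using c by (intro subalg_of_rat) auto
  moreover have "c + x * poly q x = 0" using p(3) by (simp add: pq)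
  then have "inverse x = - inverse c * poly q x"
    using \<open>c \<noteq> 0\<close> False by (simp add: field_simps) (metis add.commute add_eq_0_iff)
  ultimately show ?thesis using subalg_mult by metis
qed simp

lemma subalg_adjoin: "subalg (adjoin L b)"
  unfolding subalg_def
proof (intro conjI ballI subsetI)
  fix x :: 'k assume "x \<in> \<rat>"
  then show "x \<in> adjoin L b"
    unfolding adjoin_def by (intro image_eqI[of _ _ "[:x:]"]) (auto simp: polys_over_pCons subalg_of_rat)
next
  fix x y assume "x \<in> adjoin L b" "y \<in> adjoin L b"
  then obtain p q where "p \<in> polys_over L" "x = poly p b" "q \<in> polys_over L" "y = poly q b"
    unfolding adjoin_def by blast
  then have "x + y = poly (p + q) b" "x * y = poly (p * q) b"
      "p + q \<in> polys_over L" "p * q \<in> polys_over L"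
    by (auto simp: polys_over_add polys_over_mult)
  then show "x + y \<in> adjoin L b" "x * y \<in> adjoin L b"
    unfolding adjoin_def by blast+
qed

lemma subset_adjoin: "L \<subseteq> adjoin L b"
proof
  fix x assume "x \<in> L"
  then show "x \<in> adjoin L b"
    unfolding adjoin_def by (intro image_eqI[of _ _ "[:x:]"]) (auto simp: polys_over_pCons)
qed

lemma self_in_adjoin: "b \<in> adjoin L b"
  unfolding adjoin_def by (intro image_eqI[of _ _ "[:0, 1:]"]) (auto simp: polys_over_pCons)

lemma min_poly_exists:
  assumes alg: "\<And>x::'k. algebraic x"
  shows "\<exists>m. is_min_poly L b m"
proof -
  have "\<exists>p. p \<noteq> 0 \<and> p \<in> polys_over L \<and> poly p b = 0"
    using alg[of b] subalg_of_rat Ints_subset_Rats unfolding algebraic_def polys_over_def by blast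
  then obtain p where p: "p \<noteq> 0" "p \<in> polys_over L" "poly p b = 0"
    and least: "\<And>q. q \<noteq> 0 \<and> q \<in> polys_over L \<and> poly q b = 0 \<Longrightarrow> degree p \<le> degree q"
    using ex_has_least_nat[of "\<lambda>p. p \<noteq> 0 \<and> p \<in> polys_over L \<and> poly p b = 0" _ degree] by metis
  have "inverse (lead_coeff p) \<in> L"
    using p(2) subalg_inverse[OF alg] by (auto simp: polys_over_def)
  then have "is_min_poly L b (Polynomial.smult (inverse (lead_coeff p)) p)"
    unfolding is_min_poly_def using p least by (auto simp: polys_over_smult)
  then show ?thesis ..
qed

context
  fixes j :: "'k \<Rightarrow> complex"
  assumes j: "hom_on L j"
begin

lemma hom_on_add: "x \<in> L \<Longrightarrow> y \<in> L \<Longrightarrow> j (x + y) = j x + j y"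
  and hom_on_mult: "x \<in> L \<Longrightarrow> y \<in> L \<Longrightarrow> j (x * y) = j x * j y"
  and hom_on_1 [simp]: "j 1 = 1"
  using j by (auto simp: hom_on_def)

lemma hom_on_0 [simp]: "j 0 = 0"
  using hom_on_add[of 0 0] by simp

lemma hom_on_sum: "(\<And>i. i \<in> I \<Longrightarrow> f i \<in> L) \<Longrightarrow> j (sum f I) = (\<Sum>i\<in>I. j (f i))"
  by (induction I rule: infinite_finite_induct) (auto simp: hom_on_add subalg_sum)

lemma hom_on_of_nat: "j (of_nat n) = of_nat n"
  by (induction n) (auto simp: hom_on_add subalg_of_rat)

lemma hom_on_eq_0:
  assumes "algebraic x" "x \<in> L" shows "j x = 0 \<longleftrightarrow> x = 0"
proof
  assume jx: "j x = 0"
  show "x = 0"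
  proof (rule ccontr)
    assume "x \<noteq> 0"
    then have "j (x * inverse x) = 1" by simp
    then show False using hom_on_mult[OF assms(2) subalg_inverse[OF assms]] jx by simp
  qed
qed simp

lemma map_poly_add: "p \<in> polys_over L \<Longrightarrow> q \<in> polys_over L \<Longrightarrow>
    map_poly j (p + q) = map_poly j p + map_poly j q"
  by (rule poly_eqI) (simp add: coeff_map_poly polys_over_def hom_on_add)

lemma map_poly_mult: "p \<in> polys_over L \<Longrightarrow> q \<in> polys_over L \<Longrightarrow>
    map_poly j (p * q) = map_poly j p * map_poly j q"
  by (rule poly_eqI) (simp add: coeff_map_poly polys_over_def coeff_mult hom_on_sum hom_on_mult subalg_mult)

lemma map_poly_pderiv: "p \<in> polys_over L \<Longrightarrow> map_poly j (pderiv p) = pderiv (map_poly j p)"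
  by (rule poly_eqI)
     (auto simp: coeff_map_poly polys_over_def coeff_pderiv hom_on_mult hom_on_of_nat subalg_of_rat
        simp del: of_nat_Suc)

text \<open>Division by the monic \<open>m\<close>, one leading term at a time so that all
  coefficients stay in \<open>L\<close>. Minimality leaves no nonzero remainder vanishing at
  \<open>b\<close>, so \<open>m\<close> divides \<open>g\<close>, and this survives applying
  \<open>j\<close> to the coefficients.\<close>

lemma min_poly_vanish:
  assumes m: "is_min_poly L b m" and r: "poly (map_poly j m) r = 0"
  shows "g \<in> polys_over L \<Longrightarrow> poly g b = 0 \<Longrightarrow> poly (map_poly j g) r = 0"
proof (induction "degree g" arbitrary: g rule: less_induct)
  case less
  have mL: "m \<in> polys_over L" and lc: "lead_coeff m = 1" and mb: "poly m b = 0"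
    and min: "\<And>q. q \<in> polys_over L \<Longrightarrow> poly q b = 0 \<Longrightarrow> q = 0 \<or> degree m \<le> degree q"
    using m by (auto simp: is_min_poly_def)
  show ?case
  proof (cases "g = 0")
    case False
    then have deg: "degree m \<le> degree g" using min less.prems by blast
    define h where "h = Polynomial.monom (lead_coeff g) (degree g - degree m)"
    have hL: "h \<in> polys_over L"
      using less.prems by (simp add: h_def polys_over_monom polys_over_def)
    have m0: "m \<noteq> 0" using lc by auto
    have "degree m > 0"
      using lc mb by (metis degree_eq_zeroE gr0I lead_coeff_pCons(2) one_pCons poly_1 zero_neq_one)
    have dh: "degree (h * m) = degree g"
      using deg False m0 by (simp add: h_def degree_mult_eq degree_monom_eq monom_eq_0_iff)
    have lh: "Polynomial.coeff (h * m) (degree g) = lead_coeff g"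
      using dh lc by (metis h_def lead_coeff_mult lead_coeff_monom mult.right_neutral)
    have "degree (g - h * m) < degree g"
    proof (rule degree_lessI)
      show "g - h * m \<noteq> 0 \<or> degree g > 0" using deg \<open>degree m > 0\<close> by simp
      have "Polynomial.coeff (g - h * m) k = 0" if "k \<ge> degree g" for k
        using that lh dh by (cases "k = degree g") (auto simp: coeff_eq_0)
      then show "\<forall>k\<ge>degree g. Polynomial.coeff (g - h * m) k = 0" by blast
    qed
    then have "poly (map_poly j (g - h * m)) r = 0"
      using less.prems hL mL mb by (intro less.hyps) (auto intro!: polys_over_diff polys_over_mult)
    moreover have "g = (g - h * m) + h * m" by simp
    ultimately have "poly (map_poly j g) r = poly (map_poly j (h * m)) r"
      using map_poly_add[of "g - h * m" "h * m"] less.prems hL mL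
      by (auto simp: polys_over_diff polys_over_mult)
    then show ?thesis using map_poly_mult[OF hL mL] r by simp
  qed simp
qed

text \<open>This is the map out of \<open>L[x] / (m)\<close> sending the class of \<open>x\<close>
  to \<open>r\<close>. It is defined through a chosen representative polynomial;
  \<open>min_poly_vanish\<close> shows that the choice is immaterial.\<close>

lemma extend_hom:
  assumes m: "is_min_poly L b m" and r: "poly (map_poly j m) r = 0"
  obtains j' where "hom_on (adjoin L b) j'" "\<And>g. g \<in> polys_over L \<Longrightarrow> j' (poly g b) = poly (map_poly j g) r"
proof -
  define j' where "j' y = poly (map_poly j (SOME g. g \<in> polys_over L \<and> poly g b = y)) r" for y
  have key: "j' (poly g b) = poly (map_poly j g) r" if g: "g \<in> polys_over L" for g
  proof -
    define h where "h = (SOME h. h \<in> polys_over L \<and> poly h b = poly g b)"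
    have h: "h \<in> polys_over L \<and> poly h b = poly g b"
      unfolding h_def by (rule someI) (use g in auto)
    have "poly (map_poly j (h - g)) r = 0"
      using min_poly_vanish[OF m r, of "h - g"] h g by (simp add: polys_over_diff)
    moreover have "map_poly j h = map_poly j (h - g) + map_poly j g"
      using map_poly_add[of "h - g" g] h g by (simp add: polys_over_diff)
    ultimately show ?thesis by (simp add: j'_def h_def)
  qed
  have "hom_on (adjoin L b) j'"
    unfolding hom_on_def
  proof (intro conjI ballI)
    show "j' 1 = 1" using key[of 1] by (simp add: one_pCons polys_over_pCons map_poly_pCons)
    fix x y assume "x \<in> adjoin L b" "y \<in> adjoin L b"
    then obtain p q where pq: "p \<in> polys_over L" "x = poly p b" "q \<in> polys_over L" "y = poly q b"
      unfolding adjoin_def by blast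
    then show "j' (x + y) = j' x + j' y" "j' (x * y) = j' x * j' y"
      using key[of "p + q"] key[of "p * q"] key[of p] key[of q]
      by (auto simp: polys_over_add polys_over_mult map_poly_add map_poly_mult)
  qed
  with key that show ?thesis by blast
qed

end

end

text \<open>Separability in characteristic 0. A multiple root \<open>r\<close> would give an
  extension of \<open>j\<close> with \<open>b\<close> sent to \<open>r\<close> that kills
  \<open>pderiv m\<close> at \<open>b\<close>; but that value is nonzero by minimality, and
  homomorphisms of fields are injective.\<close>

lemma min_poly_roots:
  fixes L :: "'k::field_char_0 set"
  assumes L: "subalg L" and j: "hom_on L j"
    and m: "is_min_poly L b m" and alg: "\<And>x::'k. algebraic x"
  shows "map_poly j m = (\<Prod>r | poly (map_poly j m) r = 0. [:-r, 1:])"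
    and "card {r. poly (map_poly j m) r = 0} = degree m"
proof -
  have mL: "m \<in> polys_over L" and lc: "lead_coeff m = 1" and mb: "poly m b = 0"
    and min: "\<And>q. q \<in> polys_over L \<Longrightarrow> poly q b = 0 \<Longrightarrow> q = 0 \<or> degree m \<le> degree q"
    using m by (auto simp: is_min_poly_def)
  have degj: "degree (map_poly j m) = degree m"
    by (rule map_poly_degree_eq) (simp add: lc hom_on_1[OF L j])
  then have lcj: "lead_coeff (map_poly j m) = 1" by (simp add: coeff_map_poly lc hom_on_0[OF L j] hom_on_1[OF L j])
  have "degree m > 0"
    using lc mb by (metis degree_eq_zeroE gr0I lead_coeff_pCons(2) one_pCons poly_1 zero_neq_one)
  then have "pderiv m \<noteq> 0" "degree (pderiv m) < degree m"
    by (auto simp: pderiv_eq_0_iff degree_pderiv)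
  then have mb': "poly (pderiv m) b \<noteq> 0" using min[OF polys_over_pderiv[OF L mL]] by auto
  have "rsquarefree (map_poly j m)"
    unfolding rsquarefree_roots
  proof (intro allI notI, elim conjE)
    fix r assume r: "poly (map_poly j m) r = 0" and r': "poly (pderiv (map_poly j m)) r = 0"
    obtain j' where j': "hom_on (adjoin L b) j'"
        and key: "\<And>g. g \<in> polys_over L \<Longrightarrow> j' (poly g b) = poly (map_poly j g) r"
      using extend_hom[OF L j m r] by blast
    have "j' (poly (pderiv m) b) = 0"
      using key[OF polys_over_pderiv[OF L mL]] r' by (simp add: map_poly_pderiv[OF L j mL])
    moreover have "poly (pderiv m) b \<in> adjoin L b"
      unfolding adjoin_def using polys_over_pderiv[OF L mL] by blast
    ultimately show False
      using mb' hom_on_eq_0[OF subalg_adjoin[OF L] j' alg] by simp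
  qed
  then show *: "map_poly j m = (\<Prod>r | poly (map_poly j m) r = 0. [:-r, 1:])"
    using complex_poly_decompose_rsquarefree[of "map_poly j m"] lcj by simp
  have "degree (map_poly j m) = (\<Sum>r | poly (map_poly j m) r = 0. 1)"
    by (subst *, subst degree_prod_eq_sum_degree) auto
  then show "card {r. poly (map_poly j m) r = 0} = degree m" using degj by simp
qed


text \<open>Extensions of \<open>j\<close> are sorted by the image \<open>r\<close> of
  \<open>b\<close>, a root of the transported minimal polynomial. The fibre over \<open>r\<close>
  consists of the extensions of the homomorphism on \<open>adjoin L b\<close> with \<open>b\<close>
  sent to \<open>r\<close>, so it has \<open>N\<close> elements. If \<open>N > 0\<close>, no fibre
  is empty, which realises every root as a conjugate.\<close>

lemma card_extensions_adjoin:
  fixes L :: "'k::field_char_0 set"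
  assumes L: "subalg L" and j: "hom_on L j"
    and m: "is_min_poly L b m" and alg: "\<And>x::'k. algebraic x"
    and N: "\<And>j'. hom_on (adjoin L b) j' \<Longrightarrow> finite (extensions (adjoin L b) j') \<and> card (extensions (adjoin L b) j') = N"
  shows "finite (extensions L j)" and "card (extensions L j) = degree m * N"
    and "N > 0 \<Longrightarrow> poly (map_poly j m) r = 0 \<Longrightarrow> \<exists>\<tau>\<in>extensions L j. \<tau> b = r"
proof -
  have mL: "m \<in> polys_over L" and lc: "lead_coeff m = 1" and mb: "poly m b = 0"
    using m by (auto simp: is_min_poly_def)
  define R where "R = {r. poly (map_poly j m) r = 0}"
  define E where "E r = {\<tau>\<in>extensions L j. \<tau> b = r}" for r
  have "lead_coeff (map_poly j m) = 1"
    using map_poly_degree_eq[of j m] by (simp add: lc coeff_map_poly hom_on_0[OF L j] hom_on_1[OF L j])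
  then have "map_poly j m \<noteq> 0" by auto
  then have finR: "finite R" unfolding R_def by (rule poly_roots_finite)
  have eval: "\<tau> (poly g b) = poly (map_poly j g) (\<tau> b)"
    if "\<tau> \<in> extensions L j" "g \<in> polys_over L" for \<tau> g
  proof -
    interpret idom_hom \<tau> using that by (simp add: extensions_def field_hom_def)
    have "map_poly \<tau> g = map_poly j g"
      using that by (intro poly_eqI) (auto simp: coeff_map_poly polys_over_def extensions_def hom_on_0[OF L j])
    then show ?thesis using poly_map_poly[of g b] by simp
  qed
  have E: "finite (E r) \<and> card (E r) = N" if r: "r \<in> R" for r
  proof -
    obtain j' where j': "hom_on (adjoin L b) j'"
        and key: "\<And>g. g \<in> polys_over L \<Longrightarrow> j' (poly g b) = poly (map_poly j g) r"
      using extend_hom[OF L j m] r R_def by blast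
    have "E r = extensions (adjoin L b) j'"
    proof (intro subset_antisym subsetI)
      fix \<tau> assume "\<tau> \<in> E r"
      then show "\<tau> \<in> extensions (adjoin L b) j'"
        using eval key by (auto simp: E_def extensions_def adjoin_def)
    next
      fix \<tau> assume t: "\<tau> \<in> extensions (adjoin L b) j'"
      have "\<tau> x = j x" if "x \<in> L" for x
      proof -
        have "\<tau> x = j' (poly [:x:] b)" using t that subset_adjoin[OF L] by (auto simp: extensions_def)
        also have "\<dots> = j x"
          using key[of "[:x:]"] that by (cases "x = 0") (simp_all add: polys_over_pCons[OF L] subalg_0_1[OF L] polys_over_0[OF L] hom_on_0[OF L j] map_poly_pCons)
        finally show ?thesis .
      qed
      moreover have "\<tau> b = j' (poly [:0, 1:] b)" using t self_in_adjoin[OF L] by (auto simp: extensions_def)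
      then have "\<tau> b = r" using key[of "[:0, 1:]"] by (simp add: polys_over_pCons[OF L] subalg_0_1[OF L] polys_over_0[OF L] hom_on_0[OF L j] hom_on_1[OF L j] map_poly_pCons)
      ultimately show "\<tau> \<in> E r" using t by (auto simp: E_def extensions_def)
    qed
    then show ?thesis using N[OF j'] by simp
  qed
  have "\<tau> b \<in> R" if t: "\<tau> \<in> extensions L j" for \<tau>
  proof -
    have "\<tau> 0 = j 0" using t subalg_0_1[OF L] unfolding extensions_def by blast
    then show ?thesis using eval[OF t mL] mb hom_on_0[OF L j] by (simp add: R_def)
  qed
  then have un: "extensions L j = (\<Union>r\<in>R. E r)" unfolding E_def by blast
  show "finite (extensions L j)" unfolding un using finR E by blast
  have "card (extensions L j) = (\<Sum>r\<in>R. card (E r))"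
    unfolding un by (rule card_UN_disjoint) (use finR E in \<open>auto simp: E_def\<close>)
  also have "\<dots> = degree m * N" using E min_poly_roots(2)[OF L j m alg] by (simp add: R_def)
  finally show "card (extensions L j) = degree m * N" .
  show "\<exists>\<tau>\<in>extensions L j. \<tau> b = r" if "N > 0" "poly (map_poly j m) r = 0"
  proof -
    have "E r \<noteq> {}" using E[of r] that by (force simp: R_def)
    then show ?thesis by (auto simp: E_def)
  qed
qed

text \<open>Induction up a tower of simple extensions. The second premise says that \<open>L\<close>
  and \<open>B\<close> generate the whole field, in a form that passes to \<open>adjoin L b\<close>;
  independence of \<open>j\<close> is what lets the counts multiply.\<close>

lemma card_extensions_const:
  assumes alg: "\<And>x::'k::field_char_0. algebraic x" and "finite B"
  shows "subalg L \<Longrightarrow> (\<And>M. subalg M \<Longrightarrow> L \<subseteq> M \<Longrightarrow> B \<subseteq> M \<Longrightarrow> M = (UNIV :: 'k set)) \<Longrightarrow>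
    \<exists>N>0. \<forall>j. hom_on L j \<longrightarrow> finite (extensions L j) \<and> card (extensions L j) = N"
  using \<open>finite B\<close>
proof (induction B arbitrary: L rule: finite_induct)
  case (empty L)
  then have L: "L = UNIV" by blast
  have "extensions L j = {j}" if "hom_on L j" for j
  proof -
    have "hom_on UNIV j" using that L by simp
    then have "field_hom j"
      using hom_on_0[OF empty(1) that]
      by unfold_locales (auto simp: hom_on_def)
    then show ?thesis using L by (auto simp: extensions_def)
  qed
  then show ?case by (intro exI[of _ 1]) auto
next
  case (insert b B L)
  have gen: "M = UNIV" if "subalg M" "adjoin L b \<subseteq> M" "B \<subseteq> M" for M
    using insert.prems(2)[OF that(1)] that subset_adjoin[OF insert.prems(1), of b]
      self_in_adjoin[OF insert.prems(1), of b] by blast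
  obtain N where N: "N > 0" "\<And>j. hom_on (adjoin L b) j \<Longrightarrow>
      finite (extensions (adjoin L b) j) \<and> card (extensions (adjoin L b) j) = N"
    using insert.IH[OF subalg_adjoin[OF insert.prems(1)] gen] by blast
  obtain m where m: "is_min_poly L b m"
    using min_poly_exists[OF insert.prems(1) alg] by blast
  have "degree m > 0"
    using m unfolding is_min_poly_def
    by (metis degree_eq_zeroE gr0I lead_coeff_pCons(2) one_pCons poly_1 zero_neq_one)
  then show ?case
    using card_extensions_adjoin(1,2)[OF insert.prems(1) _ m alg N(2)] N(1)
    by (intro exI[of _ "degree m * N"]) auto
qed

text \<open>There are \<open>card B + 1\<close> powers of \<open>x\<close> with exponent at most
  \<open>card B\<close>. If they are distinct they are linearly dependent over \<rat>; a repetition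
  is treated apart because the set of powers would not see it.\<close>

lemma number_field_algebraic:
  assumes "number_field TYPE('k::field_char_0)"
  shows "algebraic (x::'k)"
proof -
  obtain B where "finite_dimensional_vector_space (\<lambda>(q::rat) (x::'k). of_rat q * x) B"
    using assms unfolding number_field_def by blast
  then interpret V: finite_dimensional_vector_space "\<lambda>(q::rat) (x::'k). of_rat q * x" B .
  show ?thesis
  proof (cases "inj_on (\<lambda>i. x ^ i) {..card B}")
    case True
    define P where "P = (\<lambda>i. x ^ i) ` {..card B}"
    have "card P = Suc (card B)" unfolding P_def using True by (simp add: card_image)
    then have "V.dependent P" using V.independent_bound_general[of P] V.dim_subset_UNIV[of P]
      unfolding V.dimension_def by auto
    then obtain u where u: "\<exists>v\<in>P. u v \<noteq> 0" "(\<Sum>v\<in>P. of_rat (u v) * v) = 0"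
      using V.dependent_finite[of P] unfolding P_def by auto
    define p where "p = (\<Sum>i\<le>card B. Polynomial.monom (of_rat (u (x ^ i)) :: 'k) i)"
    have c: "Polynomial.coeff p i = (if i \<le> card B then of_rat (u (x ^ i)) else 0)" for i
      by (auto simp: p_def coeff_sum)
    have "(\<Sum>i\<le>card B. of_rat (u (x ^ i)) * x ^ i) = 0"
      using u(2) unfolding P_def by (simp add: sum.reindex[OF True])
    then have "poly p x = 0" by (simp add: p_def poly_sum poly_monom)
    moreover obtain i where "i \<le> card B" "u (x ^ i) \<noteq> 0" using u(1) by (auto simp: P_def)
    then have "Polynomial.coeff p i \<noteq> 0" using c by simp
    then have "p \<noteq> 0" by auto
    ultimately show ?thesis
      unfolding algebraic_altdef using c by (intro exI[of _ p]) auto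
  next
    case False
    then obtain i k where ik: "x ^ i = x ^ k" "i \<noteq> k" by (auto simp: inj_on_def)
    define p where "p = Polynomial.monom (1::'k) i - Polynomial.monom 1 k"
    have "poly p x = 0" using ik by (simp add: p_def poly_monom)
    moreover have "Polynomial.coeff p i = 1" using ik by (simp add: p_def)
    then have "p \<noteq> 0" by auto
    ultimately show ?thesis
      unfolding algebraic_def by (intro exI[of _ p]) (auto simp: p_def)
  qed
qed

text \<open>A basis over \<rat> is taken as the set of generators: a subalgebra containing it is a
  rational subspace, hence everything.\<close>

lemma number_field_card_extensions:
  assumes "number_field TYPE('k::field_char_0)" and L: "subalg (L :: 'k set)"
  obtains N where "N > 0" "\<And>j. hom_on L j \<Longrightarrow> finite (extensions L j) \<and> card (extensions L j) = N"
proof -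
  obtain B where "finite_dimensional_vector_space (\<lambda>(q::rat) (x::'k). of_rat q * x) B"
    using assms unfolding number_field_def by blast
  then interpret V: finite_dimensional_vector_space "\<lambda>(q::rat) (x::'k). of_rat q * x" B .
  have "M = UNIV" if M: "subalg M" and "B \<subseteq> M" for M
  proof -
    have "V.subspace M"
      using subalg_0_1[OF M] subalg_add[OF M] subalg_mult[OF M] subalg_of_rat[OF M]
      by (intro V.subspaceI) auto
    then have "V.span B \<subseteq> M" using that V.span_minimal by blast
    then show ?thesis using V.span_Basis by blast
  qed
  then have "\<exists>N>0. \<forall>j. hom_on L j \<longrightarrow> finite (extensions L j) \<and> card (extensions L j) = N"
    by (intro card_extensions_const[OF number_field_algebraic[OF assms(1)] V.finite_Basis L])
  with that show ?thesis by blast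
qed

section \<open>Embeddings on rational numbers and algebraic integers\<close>

lemma field_hom_of_int:
  assumes "field_hom (\<tau> :: 'k::field_char_0 \<Rightarrow> complex)"
  shows "\<tau> (of_int n) = of_int n"
proof -
  interpret idom_hom \<tau> using assms by (simp add: field_hom_def)
  have "\<tau> (of_nat m) = of_nat m" for m by (induction m) (auto simp: hom_add)
  then show ?thesis by (cases n rule: int_cases2) (auto simp: hom_uminus)
qed

lemma field_hom_on_Rats:
  assumes "field_hom (\<tau> :: 'k::field_char_0 \<Rightarrow> complex)" and "x \<in> \<rat>"
  shows "\<tau> x \<in> \<rat>" and "field_hom \<tau>' \<Longrightarrow> \<tau>' x = \<tau> x"
proof -
  obtain a b where ab: "b > 0" "x = of_int a / of_int b" using assms(2) by (auto elim: Rats_cases')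
  have *: "\<rho> x = of_int a / of_int b" if "field_hom \<rho>" for \<rho> :: "'k \<Rightarrow> complex"
  proof -
    interpret idom_hom \<rho> using that by (simp add: field_hom_def)
    have "x * of_int b = of_int a" using ab by simp
    then have "\<rho> x * of_int b = of_int a" by (metis hom_mult field_hom_of_int[OF that])
    then show ?thesis using ab(1) by (simp add: nonzero_eq_divide_eq)
  qed
  show "\<tau> x \<in> \<rat>" using *[OF assms(1)] by simp
  show "\<tau>' x = \<tau> x" if "field_hom \<tau>'" using *[OF assms(1)] *[OF that] by simp
qed

lemma field_hom_imp_hom_on: "field_hom \<tau> \<Longrightarrow> hom_on L \<tau>"
proof -
  assume "field_hom \<tau>"
  then interpret idom_hom \<tau> by (simp add: field_hom_def)
  show ?thesis by (simp add: hom_on_def hom_add hom_mult)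
qed

lemma extensions_Rats: "field_hom \<tau> \<Longrightarrow> extensions \<rat> \<tau> = {\<tau>'. field_hom \<tau>'}"
  using field_hom_on_Rats(2) unfolding extensions_def by blast

lemma field_hom_poly: "field_hom \<tau> \<Longrightarrow> \<tau> (poly p x) = poly (map_poly \<tau> p) (\<tau> x)"
proof -
  assume "field_hom \<tau>"
  then interpret idom_hom \<tau> by (simp add: field_hom_def)
  show ?thesis by simp
qed

lemma field_hom_algebraic_int:
  assumes "field_hom (\<tau> :: 'k::field_char_0 \<Rightarrow> complex)" "algebraic_int x"
  shows "algebraic_int (\<tau> x)"
proof -
  interpret idom_hom \<tau> using assms(1) by (simp add: field_hom_def)
  obtain p where p: "poly (map_poly of_int p) x = 0" "lead_coeff p = 1"
    using assms unfolding algebraic_int_altdef_ipoly by blast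
  have "map_poly \<tau> (map_poly of_int p) = map_poly of_int p"
    by (rule poly_eqI) (simp add: coeff_map_poly field_hom_of_int[OF assms(1)])
  then have "poly (map_poly of_int p) (\<tau> x) = 0"
    using field_hom_poly[OF assms(1), of "map_poly of_int p" x] p by simp
  with p(2) show ?thesis unfolding algebraic_int_altdef_ipoly by blast
qed

lemma clear_denominators:
  fixes p :: "'k::field_char_0 poly"
  assumes "p \<in> polys_over \<rat>"
  shows "\<exists>(c::int) q. c \<noteq> 0 \<and> Polynomial.smult (of_int c) p = map_poly of_int q"
  using assms
proof (induction p)
  case 0
  show ?case by (intro exI[of _ 1] exI[of _ 0]) simp
next
  case (pCons a p)
  then have "a \<in> \<rat>" "p \<in> polys_over \<rat>" by (auto simp: polys_over_pCons[OF subalg_Rats])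
  then obtain c q where cq: "c \<noteq> 0" "Polynomial.smult (of_int c) p = map_poly of_int q"
    using pCons.IH by blast
  obtain m n where mn: "n > 0" "a = of_int m / of_int n" using \<open>a \<in> \<rat>\<close> by (auto elim: Rats_cases')
  have "Polynomial.smult (of_int (n * c)) (pCons a p)
      = pCons (of_int (c * m)) (Polynomial.smult (of_int n) (map_poly of_int q))"
    using mn by (simp flip: cq(2))
  also have "\<dots> = map_poly of_int (pCons (c * m) (Polynomial.smult n q))"
    by (rule poly_eqI) (auto simp: coeff_map_poly coeff_pCons split: nat.splits)
  finally show ?case using cq(1) mn(1) by (intro exI[of _ "n * c"]) auto
qed

section \<open>Conjugates in a number field with enumerated embeddings\<close>

locale embeddings =
  fixes s t :: nat and \<sigma> :: "nat \<Rightarrow> 'k::field_char_0 \<Rightarrow> complex"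
  assumes nf: "number_field TYPE('k)" and s_pos: "0 < s"
    and enum: "enumerates_embeddings s t \<sigma>"
begin

lemma embedding_hom: "i < s + 2 * t \<Longrightarrow> field_hom (\<sigma> i)"
  using enum unfolding enumerates_embeddings_def bij_betw_def by blast

lemma embedding_surj: "field_hom \<tau> \<Longrightarrow> \<exists>i < s + 2 * t. \<tau> = \<sigma> i"
  using enum unfolding enumerates_embeddings_def bij_betw_def by blast

lemma card_embeddings: "card {\<tau> :: 'k \<Rightarrow> complex. field_hom \<tau>} = s + 2 * t"
  using enum bij_betw_same_card unfolding enumerates_embeddings_def by fastforce

lemma hom_\<sigma>0: "field_hom (\<sigma> 0)" using embedding_hom s_pos by simp

lemma embedding_mod_nonreal: "\<exists>k < s + t. cmod (\<sigma> i x) = cmod (\<sigma> k x)" if "i < s + 2 * t"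
proof (cases "i < s + t")
  case False
  define k where "k = i - s - t"
  have k: "k < t" "i = s + t + k" using that False by (auto simp: k_def)
  then have "\<sigma> (s + k) x = cnj (\<sigma> i x)" using enum by (simp add: enumerates_embeddings_def)
  then show ?thesis using k by (intro exI[of _ "s + k"]) auto
qed blast

lemma min_poly_root_embedding:
  assumes "is_min_poly \<rat> b m" "poly (map_poly (\<sigma> 0) m) r = 0"
  shows "\<exists>\<tau>. field_hom \<tau> \<and> \<tau> b = r"
proof -
  obtain N where N: "N > 0" "\<And>j. hom_on (adjoin \<rat> b) j \<Longrightarrow>
      finite (extensions (adjoin \<rat> b) j) \<and> card (extensions (adjoin \<rat> b) j) = N"
    using number_field_card_extensions[OF nf subalg_adjoin[OF subalg_Rats, of b]] by blast
  show ?thesis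
    using card_extensions_adjoin(3)[OF subalg_Rats field_hom_imp_hom_on[OF hom_\<sigma>0] assms(1)
      number_field_algebraic[OF nf] N(2) N(1) assms(2)] by (auto simp: extensions_def)
qed

text \<open>All \<open>s + 2 * t\<close> embeddings extend the unique homomorphism on \<rat>;
  grouping them by their restriction to the field generated by \<open>b\<close> gives
  \<open>degree m * N = s + 2 * t\<close>, so both factors are odd.\<close>

lemma min_poly_odd_degree:
  fixes b :: 'k
  assumes "is_min_poly \<rat> b m" "odd s"
  shows "odd (degree m)"
proof -
  obtain N where N: "N > 0" "\<And>j. hom_on (adjoin \<rat> b) j \<Longrightarrow>
      finite (extensions (adjoin \<rat> b) j) \<and> card (extensions (adjoin \<rat> b) j) = N"
    using number_field_card_extensions[OF nf subalg_adjoin[OF subalg_Rats, of b]] by blast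
  have "degree m * N = s + 2 * t"
    using card_extensions_adjoin(2)[OF subalg_Rats field_hom_imp_hom_on[OF hom_\<sigma>0] assms(1)
      number_field_algebraic[OF nf] N(2)] card_embeddings extensions_Rats[OF hom_\<sigma>0] by simp
  then show ?thesis using assms(2) by (metis dvd_mult2 even_add even_mult_iff dvd_triv_left)
qed

text \<open>The norm argument: the product of the conjugates of a nonzero algebraic integer is a
  nonzero rational integer, so they cannot all be smaller than 1 in modulus. The first
  \<open>s + t\<close> embeddings suffice, the remaining ones being complex conjugates. This is the
  discreteness of translations by \<open>O_K\<close>.\<close>

lemma algebraic_int_embedding_ge_1:
  assumes "algebraic_int c" "c \<noteq> 0"
  shows "\<exists>i < s + t. 1 \<le> cmod (\<sigma> i c)"
proof (rule ccontr)
  assume "\<not> ?thesis"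
  then have small': "cmod (\<sigma> k c) < 1" if "k < s + t" for k using that by force
  have small: "cmod (\<tau> c) < 1" if hom: "field_hom \<tau>" for \<tau>
  proof -
    obtain i where "i < s + 2 * t" "\<tau> = \<sigma> i" using embedding_surj[OF hom] by blast
    then show ?thesis using embedding_mod_nonreal[of i c] small' by auto
  qed
  interpret idom_hom "\<sigma> 0" using hom_\<sigma>0 by (simp add: field_hom_def)
  obtain m where m: "is_min_poly \<rat> c m"
    using min_poly_exists[OF subalg_Rats] number_field_algebraic[OF nf] by blast
  define R where "R = {r. poly (map_poly (\<sigma> 0) m) r = 0}"
  have fact: "map_poly (\<sigma> 0) m = (\<Prod>r\<in>R. [:-r, 1:])" and card: "card R = degree m"
    using min_poly_roots[OF subalg_Rats field_hom_imp_hom_on[OF hom_\<sigma>0] m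
      number_field_algebraic[OF nf]] by (auto simp: R_def)
  have "degree m > 0"
    using m unfolding is_min_poly_def
    by (metis degree_eq_zeroE gr0I lead_coeff_pCons(2) one_pCons poly_1 zero_neq_one)
  then have R: "finite R" "R \<noteq> {}" using card card_gt_0_iff[of R] by auto
  have root: "\<exists>\<tau>. field_hom \<tau> \<and> \<tau> c = r" if "r \<in> R" for r
    using min_poly_root_embedding[OF m] that by (simp add: R_def)
  \<comment> \<open>Up to sign, \<open>a\<close> is the norm of \<open>c\<close> over \<rat>, read
    off as the constant coefficient of the minimal polynomial.\<close>
  define a where "a = \<sigma> 0 (Polynomial.coeff m 0)"
  have a: "a = (\<Prod>r\<in>R. - r)"
  proof -
    have "a = poly (map_poly (\<sigma> 0) m) 0" by (simp add: a_def poly_0_coeff_0 coeff_map_poly)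
    then show ?thesis by (simp add: fact poly_prod)
  qed
  have "a \<in> \<rat>" unfolding a_def
    by (rule field_hom_on_Rats(1)[OF hom_\<sigma>0]) (use m in \<open>auto simp: is_min_poly_def polys_over_def\<close>)
  moreover have "algebraic_int a"
    unfolding a using root field_hom_algebraic_int[OF _ assms(1)]
    by (intro algebraic_int_prod) (metis algebraic_int_minus)
  ultimately have "a \<in> \<int>" using rational_algebraic_int_is_int by blast
  moreover have "cmod a < 1"
  proof -
    obtain r0 where r0: "r0 \<in> R" using R by blast
    have le: "cmod r < 1" if "r \<in> R" for r using root[OF that] small by blast
    have "cmod a = cmod r0 * (\<Prod>r\<in>R - {r0}. cmod r)"
      unfolding a using R r0 by (simp add: prod_norm[symmetric] prod.remove[OF R(1) r0] norm_mult)
    also have "\<dots> \<le> cmod r0 * 1"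
      using le by (intro mult_left_mono prod_le_1) (auto intro: less_imp_le)
    finally show ?thesis using le[OF r0] by simp
  qed
  ultimately have "a = 0" by (auto simp: Ints_def)
  then obtain r where "r \<in> R" "r = 0" using R by (auto simp: a)
  then obtain \<tau> :: "'k \<Rightarrow> complex" where "field_hom \<tau>" "\<tau> c = 0" using root[of r] by metis
  then show False
    using hom_on_eq_0[OF subalg_Rats] assms(2)
      hom_on_eq_0[of UNIV \<tau> c] field_hom_imp_hom_on[of \<tau> UNIV] number_field_algebraic[OF nf, of c]
    by (auto simp: subalg_def)
qed

text \<open>A rational polynomial of odd degree that vanishes at \<open>u\<close> and \<open>1/u\<close> and is irreducible
  is reciprocal up to sign, hence vanishes at \<open>1\<close> or \<open>-1\<close>. This is where \<open>s\<close> odd is used.\<close>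

lemma annihilating_polynomial:
  fixes u :: 'k
  assumes "odd s" "u \<noteq> 0" "u \<noteq> 1" "u \<noteq> - 1"
  obtains p :: "int poly" where "poly (map_poly of_int p) u = 0"
    "poly (map_poly of_int p) (inverse u) \<noteq> 0" "poly p 1 \<noteq> 0"
proof -
  obtain m where m: "is_min_poly \<rat> u m"
    using min_poly_exists[OF subalg_Rats] number_field_algebraic[OF nf] by blast
  then have mL: "m \<in> polys_over \<rat>" and lc: "lead_coeff m = 1" and mu: "poly m u = 0"
    and min: "\<And>q. q \<in> polys_over \<rat> \<Longrightarrow> poly q u = 0 \<Longrightarrow> q = 0 \<or> degree m \<le> degree q"
    by (auto simp: is_min_poly_def)
  have odd: "odd (degree m)" using min_poly_odd_degree[OF m assms(1)] .
  \<comment> \<open>A rational root would be the value at \<open>u\<close> of some embedding, since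
    all roots are conjugates of \<open>u\<close>; embeddings fix rationals and are injective,
    forcing \<open>u = x\<close>.\<close>
  have root: "poly m x \<noteq> 0" if x: "x \<in> \<rat>" "u \<noteq> x" for x
  proof
    assume "poly m x = 0"
    moreover interpret idom_hom "\<sigma> 0" using hom_\<sigma>0 by (simp add: field_hom_def)
    have "\<sigma> 0 (poly m x) = poly (map_poly (\<sigma> 0) m) (\<sigma> 0 x)" by (rule field_hom_poly[OF hom_\<sigma>0])
    ultimately have "poly (map_poly (\<sigma> 0) m) (\<sigma> 0 x) = 0" by simp
    then obtain \<tau> where t: "field_hom \<tau>" "\<tau> u = \<sigma> 0 x" using min_poly_root_embedding[OF m] by blast
    interpret t: idom_hom \<tau> using t by (simp add: field_hom_def)
    have "\<tau> (u - x) = 0" using t field_hom_on_Rats(2)[OF hom_\<sigma>0 x(1) t(1)] by (simp add: t.hom_minus)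
    then show False
      using hom_on_eq_0[of UNIV \<tau> "u - x"] field_hom_imp_hom_on[OF t(1)]
        number_field_algebraic[OF nf] x(2) by (auto simp: subalg_def)
  qed
  have inv: "poly m (inverse u) \<noteq> 0"
  proof
    assume "poly m (inverse u) = 0"
    then have ru: "poly (reflect_poly m) u = 0" using \<open>u \<noteq> 0\<close> by (simp add: poly_reflect_poly_nz)
    define e where "e = Polynomial.coeff m 0"
    have eL: "e \<in> \<rat>" using mL by (simp add: e_def polys_over_def)
    \<comment> \<open>The reflected polynomial has coefficient \<open>e\<close> in degree
      \<open>degree m\<close>, so subtracting \<open>e\<close> times the monic \<open>m\<close>
      lowers the degree; vanishing at \<open>u\<close>, the difference must be 0.\<close>
    define q where "q = reflect_poly m - Polynomial.smult e m"
    have "Polynomial.coeff (reflect_poly m) i \<in> \<rat>" for i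
      using mL by (auto simp: coeff_reflect_poly polys_over_def)
    then have qL: "q \<in> polys_over \<rat>"
      unfolding q_def using mL eL
      by (intro polys_over_diff[OF subalg_Rats] polys_over_smult[OF subalg_Rats]) (auto simp: polys_over_def)
    have "degree q < degree m"
    proof (rule degree_lessI)
      show "q \<noteq> 0 \<or> 0 < degree m" using odd by (auto elim: oddE)
      have "Polynomial.coeff q i = 0" if "i \<ge> degree m" for i
        using that lc by (cases "i = degree m") (auto simp: q_def coeff_reflect_poly e_def coeff_eq_0)
      then show "\<forall>i\<ge>degree m. Polynomial.coeff q i = 0" by blast
    qed
    moreover have "poly q u = 0" using ru mu by (simp add: q_def)
    ultimately have "q = 0" using min[OF qL] by auto
    then have refl: "reflect_poly m = Polynomial.smult e m" by (simp add: q_def)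
    have "Polynomial.coeff (reflect_poly m) 0 = e * e" by (simp add: refl e_def)
    then have "e * e = 1" using lc by (simp add: coeff_reflect_poly)
    then have "e = 1 \<or> e = -1" by (metis square_eq_1_iff)
    moreover have "poly m 1 = e * poly m 1"
      using poly_reflect_poly_nz[of 1 m] refl by simp
    \<comment> \<open>The sign comes from \<open>(-1) ^ degree m\<close>. Hence \<open>e = 1\<close>
      makes \<open>m\<close> vanish at -1, and \<open>e = -1\<close> makes it vanish at 1.\<close>
    moreover have "- poly m (-1) = e * poly m (-1)"
      using poly_reflect_poly_nz[of "-1" m] refl odd by simp
    ultimately show False using root[of 1] root[of "-1"] assms(3,4) by auto
  qed
  obtain c :: int and p :: "int poly" where cp: "c \<noteq> 0" "Polynomial.smult (of_int c) m = map_poly of_int p"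
    using clear_denominators[OF mL] by blast
  have eval: "poly (map_poly of_int p) x = of_int c * poly m x" for x
    by (simp flip: cp(2))
  have "of_int (poly p 1) = (of_int c * poly m 1 :: 'k)"
    using eval[of 1] by (simp add: of_int_hom.poly_map_poly_1)
  then have "poly p 1 \<noteq> 0" using root[of 1] assms(3) cp(1) by auto
  then show ?thesis using that[of p] eval mu inv cp(1) by simp
qed

end

section \<open>Two-cocycles of groups of affine maps\<close>

text \<open>The real coordinate stands first. That \<open>(0, \<one>)\<close> is a unit needs a
  normalised cocycle, so normalisation accompanies the cocycle identity throughout.\<close>

definition central_ext :: "('g, 'x) monoid_scheme \<Rightarrow> ('g \<Rightarrow> 'g \<Rightarrow> real) \<Rightarrow> (real \<times> 'g) monoid" where
  "central_ext G c =
     \<lparr>carrier = UNIV \<times> carrier G,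
      monoid.mult = (\<lambda>(r, g) (r', h). (r + r' + c g h, g \<otimes>\<^bsub>G\<^esub> h)), one = (0, \<one>\<^bsub>G\<^esub>)\<rparr>"

lemma central_ext_simps [simp]:
  "carrier (central_ext G c) = UNIV \<times> carrier G"
  "(r, g) \<otimes>\<^bsub>central_ext G c\<^esub> (r', h) = (r + r' + c g h, g \<otimes>\<^bsub>G\<^esub> h)"
  "\<one>\<^bsub>central_ext G c\<^esub> = (0, \<one>\<^bsub>G\<^esub>)"
  by (simp_all add: central_ext_def)

lemma comm_group_central_ext:
  assumes "comm_group G"
    and cocycle: "\<And>g h k. g \<in> carrier G \<Longrightarrow> h \<in> carrier G \<Longrightarrow> k \<in> carrier G \<Longrightarrow>
      c h k + c g (h \<otimes>\<^bsub>G\<^esub> k) = c g h + c (g \<otimes>\<^bsub>G\<^esub> h) k"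
    and one: "\<And>g. g \<in> carrier G \<Longrightarrow> c \<one>\<^bsub>G\<^esub> g = 0"
    and sym: "\<And>g h. g \<in> carrier G \<Longrightarrow> h \<in> carrier G \<Longrightarrow> c g h = c h g"
  shows "comm_group (central_ext G c)"
proof -
  interpret comm_group G by fact
  show ?thesis
  proof (rule comm_groupI)
    fix x assume "x \<in> carrier (central_ext G c)"
    then obtain r g where x: "x = (r, g)" "g \<in> carrier G" by auto
    then show "\<exists>y\<in>carrier (central_ext G c). y \<otimes>\<^bsub>central_ext G c\<^esub> x = \<one>\<^bsub>central_ext G c\<^esub>"
      by (intro bexI[of _ "(- r - c (inv\<^bsub>G\<^esub> g) g, inv\<^bsub>G\<^esub> g)"]) auto
  next
    fix x y z assume "x \<in> carrier (central_ext G c)" "y \<in> carrier (central_ext G c)"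
      "z \<in> carrier (central_ext G c)"
    then obtain r g r' h r'' k where "x = (r, g)" "g \<in> carrier G" "y = (r', h)" "h \<in> carrier G"
      "z = (r'', k)" "k \<in> carrier G" by auto
    then show "x \<otimes>\<^bsub>central_ext G c\<^esub> y \<otimes>\<^bsub>central_ext G c\<^esub> z = x \<otimes>\<^bsub>central_ext G c\<^esub> (y \<otimes>\<^bsub>central_ext G c\<^esub> z)"
      using cocycle[of g h k] by (simp add: m_assoc)
  qed (use one sym in \<open>auto simp: m_comm\<close>)
qed

text \<open>The value at \<open>e\<close> of the integer polynomial with coefficient list
  \<open>ns\<close> in the endomorphism \<open>U\<close>, in multiplicative notation: sums become
  products and integer multiples become powers.\<close>

fun horner :: "('g, 'x) monoid_scheme \<Rightarrow> ('g \<Rightarrow> 'g) \<Rightarrow> int list \<Rightarrow> 'g \<Rightarrow> 'g" where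
  "horner G U [] e = \<one>\<^bsub>G\<^esub>"
| "horner G U (n # ns) e = (e [^]\<^bsub>G\<^esub> n) \<otimes>\<^bsub>G\<^esub> U (horner G U ns e)"

context comm_group
begin

lemma horner_closed:
  "U \<in> hom G G \<Longrightarrow> e \<in> carrier G \<Longrightarrow> horner G U ns e \<in> carrier G"
  by (induction ns) (auto simp: hom_def)

lemma horner_mult:
  assumes U: "U \<in> hom G G" and e: "e \<in> carrier G" "f \<in> carrier G"
  shows "horner G U ns (e \<otimes> f) = horner G U ns e \<otimes> horner G U ns f"
proof (induction ns)
  case (Cons n ns)
  have "U (horner G U ns e \<otimes> horner G U ns f) = U (horner G U ns e) \<otimes> U (horner G U ns f)"
    using hom_mult[OF U] horner_closed[OF U] e by blast
  moreover have "U (horner G U ns e) \<in> carrier G" "U (horner G U ns f) \<in> carrier G"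
    using horner_closed[OF U] e U by (auto simp: hom_def)
  ultimately show ?case
    using Cons e by (simp add: int_pow_distrib m_ac)
qed simp

lemma horner_commute:
  assumes U: "U \<in> hom G G" and V: "V \<in> hom G G" and e: "e \<in> carrier G"
    and UV: "\<And>e. e \<in> carrier G \<Longrightarrow> U (V e) = V (U e)"
  shows "horner G U ns (V e) = V (horner G U ns e)"
proof (induction ns)
  case Nil
  show ?case using hom_one[OF V] by simp
next
  case (Cons n ns)
  have "U (horner G U ns e) \<in> carrier G"
    using horner_closed[OF U e] U by (auto simp: hom_def)
  then show ?case
    using Cons e UV[OF horner_closed[OF U e]] hom_mult[OF V]
    by (simp add: hom_int_pow[OF V e])
qed

end

text \<open>A normalised real 2-cocycle on the group of affine maps z -> a z + x, written as pairs
  \<open>(a, x)\<close>; hence the product \<open>(a * b, a * y + x)\<close>. The set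
  \<open>T\<close> will be the ring of integers, of which only the additive group with its action of
  \<open>A\<close> enters here.\<close>

locale affine_cocycle =
  fixes A T :: "'k::field_char_0 set" and c :: "'k \<times> 'k \<Rightarrow> 'k \<times> 'k \<Rightarrow> real"
  assumes A1: "1 \<in> A" and A0: "0 \<notin> A"
    and A_mult: "\<And>a b. a \<in> A \<Longrightarrow> b \<in> A \<Longrightarrow> a * b \<in> A"
    and A_inverse: "\<And>a. a \<in> A \<Longrightarrow> inverse a \<in> A"
    and T0: "0 \<in> T" and T_add: "\<And>x y. x \<in> T \<Longrightarrow> y \<in> T \<Longrightarrow> x + y \<in> T"
    and T_uminus: "\<And>x. x \<in> T \<Longrightarrow> - x \<in> T"
    and AT: "\<And>a x. a \<in> A \<Longrightarrow> x \<in> T \<Longrightarrow> a * x \<in> T"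
    and cocycle: "\<And>a b d x y z. a \<in> A \<Longrightarrow> b \<in> A \<Longrightarrow> d \<in> A \<Longrightarrow> x \<in> T \<Longrightarrow> y \<in> T \<Longrightarrow> z \<in> T \<Longrightarrow>
       c (b, y) (d, z) + c (a, x) (b * d, b * z + y) = c (a, x) (b, y) + c (a * b, a * y + x) (d, z)"
    and c_left: "\<And>a x. a \<in> A \<Longrightarrow> x \<in> T \<Longrightarrow> c (1, 0) (a, x) = 0"
    and c_right: "\<And>a x. a \<in> A \<Longrightarrow> x \<in> T \<Longrightarrow> c (a, x) (1, 0) = 0"
begin

lemma T_of_int_mult: "x \<in> T \<Longrightarrow> of_int n * x \<in> T"
proof -
  assume x: "x \<in> T"
  have "of_nat m * x \<in> T" for m by (induction m) (use x in \<open>auto simp: T0 T_add ring_distribs\<close>)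
  then show ?thesis using T_uminus by (cases n rule: int_cases2) auto
qed

lemma poly_of_int_pCons:
  "poly (map_poly of_int (pCons n p)) (x::'k) = of_int n + x * poly (map_poly of_int p) x"
  by (cases "n = 0 \<and> p = 0") (auto simp: map_poly_pCons)

lemma T_poly_mult: "a \<in> A \<Longrightarrow> x \<in> T \<Longrightarrow> poly (map_poly of_int p) a * x \<in> T"
proof (induction p)
  case (pCons n p)
  then have "of_int n * x \<in> T" "a * (poly (map_poly of_int p) a * x) \<in> T"
    using T_of_int_mult AT by blast+
  then have "of_int n * x + a * (poly (map_poly of_int p) a * x) \<in> T" by (rule T_add)
  then show ?case by (simp add: poly_of_int_pCons algebra_simps)
qed (simp add: T0)

definition cT :: "'k \<Rightarrow> 'k \<Rightarrow> real" where "cT x y = c (1, x) (1, y)"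

text \<open>In the central extension defined by \<open>c\<close>, conjugation by the lift of \<open>(a, 0)\<close> maps the lift of
  \<open>(1, x)\<close> to the lift of \<open>(1, a x)\<close> shifted by \<open>\<kappa> a x\<close>.\<close>

definition \<kappa> :: "'k \<Rightarrow> 'k \<Rightarrow> real" where "\<kappa> a x = c (a, 0) (1, x) - c (1, a * x) (a, 0)"

lemma cT_cocycle: "x \<in> T \<Longrightarrow> y \<in> T \<Longrightarrow> z \<in> T \<Longrightarrow> cT y z + cT x (y + z) = cT x y + cT (x + y) z"
  using cocycle[of 1 1 1 x y z] A1 by (simp add: cT_def add.commute)

text \<open>Conjugation by the lift of \<open>(a, 0)\<close> is an automorphism of the extension of
  \<open>T\<close>. The three instances of the cocycle identity move this lift past two
  translations.\<close>

lemma cT_conj: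
  assumes "a \<in> A" "x \<in> T" "y \<in> T"
  shows "cT (a * x) (a * y) + \<kappa> a x + \<kappa> a y = cT x y + \<kappa> a (x + y)"
  using cocycle[of a 1 1 0 x y] cocycle[of 1 a 1 "a * x" 0 y] cocycle[of 1 1 a "a * x" "a * y" 0]
    assms A1 T0 AT[OF assms(1)]
  unfolding cT_def \<kappa>_def by (simp add: algebra_simps)

lemma \<kappa>_0: "a \<in> A \<Longrightarrow> \<kappa> a 0 = 0"
  using c_left[of a 0] c_right[of a 0] T0 by (simp add: \<kappa>_def)

text \<open>The lift of \<open>(a * b, 0)\<close> and the product of the lifts of
  \<open>(a, 0)\<close> and \<open>(b, 0)\<close> differ by a central real number, so they conjugate
  in the same way.\<close>

lemma \<kappa>_mult:
  assumes "a \<in> A" "b \<in> A" "x \<in> T"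
  shows "\<kappa> (a * b) x = \<kappa> b x + \<kappa> a (b * x)"
  using cocycle[of a b 1 0 0 x] cocycle[of a 1 b 0 "b * x" 0] cocycle[of 1 a b "a * (b * x)" 0 0]
    assms A1 T0 AT A_mult
  unfolding \<kappa>_def by (simp add: mult.assoc)

definition \<omega> :: "'k \<Rightarrow> 'k \<Rightarrow> real" where "\<omega> x y = cT x y - cT y x"

text \<open>\<omega> is the commutator pairing of the central extension of the abelian group
  \<open>T\<close>, which is always biadditive.\<close>

lemma \<omega>_add:
  assumes "x \<in> T" "y \<in> T" "z \<in> T"
  shows "\<omega> (x + y) z = \<omega> x z + \<omega> y z"
  using cT_cocycle[of x y z] cT_cocycle[of x z y] cT_cocycle[of z x y] assms
  unfolding \<omega>_def by (simp add: add.commute)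

lemma \<omega>_swap: "\<omega> x y = - \<omega> y x" by (simp add: \<omega>_def)

lemma \<omega>_of_int:
  assumes "x \<in> T" "y \<in> T"
  shows "\<omega> (of_int n * x) y = of_int n * \<omega> x y"
proof -
  have 0: "\<omega> 0 y = 0" using \<omega>_add[of 0 0 y] assms T0 by simp
  have nat: "of_nat m * x \<in> T" for m using T_of_int_mult[of x "int m"] assms by simp
  have n: "\<omega> (of_nat m * x) y = of_nat m * \<omega> x y" for m
    by (induction m) (use assms 0 nat in \<open>auto simp: ring_distribs \<omega>_add\<close>)
  have "\<omega> (- (of_nat m * x)) y = - (of_nat m * \<omega> x y)" for m
    using \<omega>_add[of "of_nat m * x" "- (of_nat m * x)" y] 0 n[of m] nat[of m] assms T_uminus by simp
  with n show ?thesis by (cases n rule: int_cases2) auto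
qed

lemma \<omega>_conj:
  assumes "a \<in> A" "x \<in> T" "y \<in> T"
  shows "\<omega> (a * x) (a * y) = \<omega> x y"
  using cT_conj[of a x y] cT_conj[of a y x] assms unfolding \<omega>_def by (simp add: add.commute)

text \<open>Invariance makes \<open>inverse u\<close> the adjoint of \<open>u\<close> with respect
  to \<omega>; the rest is induction over the coefficients. It generalises \<open>y\<close>, because
  each step moves one factor \<open>inverse u\<close> to the second argument.\<close>

lemma \<omega>_poly:
  assumes u: "u \<in> A" and y: "y \<in> T"
  shows "x \<in> T \<Longrightarrow> \<omega> (poly (map_poly of_int p) u * x) y = \<omega> x (poly (map_poly of_int p) (inverse u) * y)"
  using y
proof (induction p arbitrary: y)
  case 0
  have "\<omega> 0 y = 0" "\<omega> x 0 = 0"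
    using \<omega>_add[of 0 0 y] \<omega>_add[of 0 0 x] \<omega>_swap[of x 0] 0 T0 by auto
  then show ?case by simp
next
  case (pCons n p)
  have u': "inverse u \<in> A" "u \<noteq> 0" using A_inverse[OF u] u A0 by auto
  let ?p = "\<lambda>v. poly (map_poly of_int p) v"
  have 1: "?p u * x \<in> T" "?p (inverse u) * (inverse u * y) \<in> T"
    using T_poly_mult AT u u' pCons.prems by blast+
  have "\<omega> (of_int n * x + u * (?p u * x)) y = of_int n * \<omega> x y + \<omega> (u * (?p u * x)) y"
    using \<omega>_add \<omega>_of_int T_of_int_mult AT u 1 pCons.prems by simp
  also have "\<omega> (u * (?p u * x)) y = \<omega> (u * (?p u * x)) (u * (inverse u * y))"
    using u' by (simp add: mult.assoc[symmetric])
  also have "\<dots> = \<omega> (?p u * x) (inverse u * y)" using \<omega>_conj u u' AT 1 pCons.prems by blast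
  also have "\<dots> = \<omega> x (?p (inverse u) * (inverse u * y))"
    using pCons.IH pCons.prems AT u' by blast
  also have "of_int n * \<omega> x y + \<dots> = \<omega> x (of_int n * y + ?p (inverse u) * (inverse u * y))"
  proof -
    have "\<omega> (of_int n * y + ?p (inverse u) * (inverse u * y)) x
        = of_int n * \<omega> y x + \<omega> (?p (inverse u) * (inverse u * y)) x"
      using \<omega>_add \<omega>_of_int T_of_int_mult 1 pCons.prems by simp
    then show ?thesis
      using \<omega>_swap[of x y] \<omega>_swap[of x "?p (inverse u) * (inverse u * y)"]
        \<omega>_swap[of x "of_int n * y + ?p (inverse u) * (inverse u * y)"] by simp
  qed
  finally show ?case by (simp add: poly_of_int_pCons algebra_simps)
qed

text \<open>The premise \<open>div\<close> is surjectivity of multiplication by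
  \<open>p(1/u)\<close> up to nonzero integer factors. That is enough, since the integer factor can
  be cancelled in \<real>.\<close>

lemma \<omega>_eq_0:
  assumes u: "u \<in> A" and p: "poly (map_poly of_int p) u = 0"
    and div: "\<And>z. z \<in> T \<Longrightarrow> \<exists>m w. m \<noteq> 0 \<and> w \<in> T \<and> of_int m * z = poly (map_poly of_int p) (inverse u) * w"
    and "x \<in> T" "y \<in> T"
  shows "\<omega> x y = 0"
proof -
  obtain m w where mw: "m \<noteq> 0" "w \<in> T" "of_int m * y = poly (map_poly of_int p) (inverse u) * w"
    using div[OF \<open>y \<in> T\<close>] by blast
  have "\<omega> 0 w = 0" using \<omega>_add[of 0 0 w] T0 mw by simp
  then have "\<omega> x (of_int m * y) = 0" using \<omega>_poly[OF u mw(2) \<open>x \<in> T\<close>, of p] p mw(3) by simp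
  then have "of_int m * \<omega> y x = 0" using \<omega>_of_int[of y x m] \<omega>_swap[of x "of_int m * y"] assms by simp
  then show ?thesis using mw(1) \<omega>_swap[of x y] by simp
qed

text \<open>Since \<open>p(u) = 0\<close>, the operator \<open>p(u)\<close> maps the abelian extension of \<open>T\<close> by \<open>\<real>\<close> into \<open>\<real>\<close>,
  on which it is multiplication by \<open>p(1)\<close>; hence \<open>p(u) / p(1)\<close> is an \<open>A\<close>-invariant retraction.\<close>

lemma invariant_splitting:
  assumes u: "u \<in> A" and p: "poly (map_poly of_int p) u = 0" and p1: "poly p 1 \<noteq> 0"
    and sym: "\<And>x y. x \<in> T \<Longrightarrow> y \<in> T \<Longrightarrow> cT x y = cT y x"
  obtains \<beta> where "\<And>x y. x \<in> T \<Longrightarrow> y \<in> T \<Longrightarrow> \<beta> x + \<beta> y = cT x y + \<beta> (x + y)"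
    "\<And>a x. a \<in> A \<Longrightarrow> x \<in> T \<Longrightarrow> \<kappa> a x + \<beta> (a * x) = \<beta> x"
proof -
  define G :: "'k monoid" where "G = \<lparr>carrier = T, monoid.mult = (+), one = 0\<rparr>"
  define E where "E = central_ext G cT"
  have cT0: "cT 0 x = 0" "cT x 0 = 0" if "x \<in> T" for x
    using that c_left[of 1 x] c_right[of 1 x] A1 by (auto simp: cT_def)
  have "comm_group G"
    unfolding G_def by (rule comm_groupI) (auto simp: T0 T_add algebra_simps intro!: bexI[OF _ T_uminus])
  then have "comm_group E"
    unfolding E_def
    by (rule comm_group_central_ext) (use cT_cocycle cT0 sym in \<open>auto simp: G_def\<close>)
  then interpret E: comm_group E .
  have carE: "carrier E = UNIV \<times> T" and multE: "(r, x) \<otimes>\<^bsub>E\<^esub> (r', y) = (r + r' + cT x y, x + y)"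
    and oneE: "\<one>\<^bsub>E\<^esub> = (0, 0)" for r r' x y
    by (auto simp: E_def G_def)
  \<comment> \<open>Conjugation by the lift of \<open>(a, 0)\<close>, as an endomorphism of the
    extension \<open>E\<close>.\<close>
  define U where "U a e = (fst e + \<kappa> a (snd e), a * snd e)" for a and e :: "real \<times> 'k"
  have U: "U a \<in> hom E E" if "a \<in> A" for a
  proof (rule homI)
    fix e f assume "e \<in> carrier E" "f \<in> carrier E"
    then obtain r x r' y where ef: "e = (r, x)" "x \<in> T" "f = (r', y)" "y \<in> T" by (auto simp: carE)
    show "U a (e \<otimes>\<^bsub>E\<^esub> f) = U a e \<otimes>\<^bsub>E\<^esub> U a f"
      using cT_conj[OF that ef(2,4)] by (simp add: U_def ef multE algebra_simps)
  qed (use that AT in \<open>auto simp: U_def carE\<close>)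
  \<comment> \<open>Conjugations commute because \<open>a * u = u * a\<close> and both orders are
    computed by \<open>\<kappa>_mult\<close>; this makes the retraction invariant under all of
    \<open>A\<close> and not only under \<open>u\<close>.\<close>
  have UU: "U u (U a e) = U a (U u e)" if "a \<in> A" "e \<in> carrier E" for a e
  proof -
    obtain r x where e: "e = (r, x)" "x \<in> T" using \<open>e \<in> carrier E\<close> by (auto simp: carE)
    show ?thesis
      using \<kappa>_mult[OF u that(1) e(2)] \<kappa>_mult[OF that(1) u e(2)]
      by (simp add: U_def e mult.commute mult.left_commute)
  qed
  define h where "h ns = horner E (U u) ns" for ns
  have h_closed: "h ns e \<in> carrier E" if "e \<in> carrier E" for ns e
    using E.horner_closed[OF U[OF u] that] by (simp add: h_def)
  have pow_nat: "snd (e [^]\<^bsub>E\<^esub> (m::nat)) = of_nat m * snd e" if "e \<in> carrier E" for e m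
  proof (induction m)
    case (Suc m)
    obtain r x r' y where "e = (r, x)" "e [^]\<^bsub>E\<^esub> m = (r', y)" by (metis surj_pair)
    then show ?case using Suc by (simp add: multE algebra_simps)
  qed (simp add: oneE)
  have inv: "snd (inv\<^bsub>E\<^esub> e) = - snd e" if "e \<in> carrier E" for e
  proof -
    obtain r x r' y where e: "e = (r, x)" "inv\<^bsub>E\<^esub> e = (r', y)" by (metis surj_pair)
    then have "x + y = 0" using E.r_inv[OF that] by (simp add: multE oneE)
    then show ?thesis using e by (simp add: eq_neg_iff_add_eq_0 add.commute)
  qed
  have pow: "snd (e [^]\<^bsub>E\<^esub> (n::int)) = of_int n * snd e" if "e \<in> carrier E" for e n
    using pow_nat[OF that] inv that
    by (cases n rule: int_cases2) (auto simp: int_pow_int E.int_pow_neg)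
  have snd_h: "snd (h ns e) = poly (map_poly of_int (Poly ns)) u * snd e" if "e \<in> carrier E" for ns e
  proof (induction ns)
    case (Cons n ns)
    obtain r x r' y where "e [^]\<^bsub>E\<^esub> n = (r, x)" "h ns e = (r', y)" by (metis surj_pair)
    then show ?case using Cons pow[OF that, of n]
      by (cases "n = 0 \<and> Poly ns = 0")
        (auto simp: h_def U_def multE map_poly_pCons algebra_simps)
  qed (simp add: h_def oneE)
  have real_nat: "(r, 0) [^]\<^bsub>E\<^esub> (m::nat) = (of_nat m * r, 0)" for r m
    by (induction m) (auto simp: oneE multE cT0 T0 algebra_simps)
  have real_inv: "inv\<^bsub>E\<^esub> (r, 0) = (- r, 0)" for r
    by (rule E.inv_equality) (auto simp: multE oneE carE cT0 T0)
  have real_int: "(r, 0) [^]\<^bsub>E\<^esub> (n::int) = (of_int n * r, 0)" for r n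
    by (cases n rule: int_cases2) (auto simp: int_pow_int E.int_pow_neg carE T0 real_nat real_inv)
  have h_real: "h ns (r, 0) = (of_int (poly (Poly ns) 1) * r, 0)" for ns r
    by (induction ns) (auto simp: h_def oneE real_int U_def multE cT0 T0 \<kappa>_0[OF u] algebra_simps)
  define ns where "ns = coeffs p"
  have ns: "Poly ns = p" by (simp add: ns_def)
  define \<rho> where "\<rho> e = fst (h ns e) / of_int (poly p 1)" for e
  have h: "h ns e = (of_int (poly p 1) * \<rho> e, 0)" if "e \<in> carrier E" for e
    using snd_h[OF that, of ns] p p1 by (simp add: prod_eq_iff \<rho>_def ns)
  have \<rho>_mult: "\<rho> (e \<otimes>\<^bsub>E\<^esub> f) = \<rho> e + \<rho> f" if "e \<in> carrier E" "f \<in> carrier E" for e f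
  proof -
    have "h ns (e \<otimes>\<^bsub>E\<^esub> f) = h ns e \<otimes>\<^bsub>E\<^esub> h ns f"
      using E.horner_mult[OF U[OF u] that] by (simp add: h_def)
    then show ?thesis using that p1 by (simp add: h multE cT0 T0 flip: distrib_left)
  qed
  have \<rho>_real: "\<rho> (r, 0) = r" for r using p1 by (simp add: \<rho>_def h_real ns)
  have \<rho>_U: "\<rho> (U a e) = \<rho> e" if "a \<in> A" "e \<in> carrier E" for a e
  proof -
    have "h ns (U a e) = U a (h ns e)"
      using E.horner_commute[OF U[OF u] U[OF that(1)] that(2)] UU[OF that(1)] by (simp add: h_def)
    moreover have "U a e \<in> carrier E" using U[OF that(1)] that(2) by (auto simp: hom_def)
    ultimately show ?thesis using that p1 by (simp add: h U_def \<kappa>_0)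
  qed
  have split: "(r, x) = (r, 0) \<otimes>\<^bsub>E\<^esub> (0, x)" if "x \<in> T" for r x using that by (simp add: multE cT0)
  have \<rho>_split: "\<rho> (r, x) = r + \<rho> (0, x)" if "x \<in> T" for r x
    by (subst split[OF that], subst \<rho>_mult) (auto simp: \<rho>_real carE T0 that)
  \<comment> \<open>\<beta> is the retraction evaluated on the set-theoretic lift x ->
    \<open>(0, x)\<close>. The two identities are its multiplicativity and its invariance under
    conjugation.\<close>
  show ?thesis
  proof (rule that[of "\<lambda>x. \<rho> (0, x)"])
    fix x y assume xy: "x \<in> T" "y \<in> T"
    then have "\<rho> (0, x) + \<rho> (0, y) = \<rho> (cT x y, x + y)"
      using \<rho>_mult[of "(0, x)" "(0, y)"] by (simp add: multE carE)
    then show "\<rho> (0, x) + \<rho> (0, y) = cT x y + \<rho> (0, x + y)"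
      using \<rho>_split[OF T_add[OF xy], of "cT x y"] by linarith
  next
    fix a x assume ax: "a \<in> A" "x \<in> T"
    then show "\<kappa> a x + \<rho> (0, a * x) = \<rho> (0, x)"
      using \<rho>_U[of a "(0, x)"] \<rho>_split[OF AT[OF ax], of "\<kappa> a x"] by (auto simp: U_def carE)
  qed
qed

text \<open>Every element factors as \<open>(1, x) (a, 0)\<close>. The translation \<open>x\<close>
  is lifted with real coordinate \<open>- \<beta> x\<close>, into the kernel of the retraction, and
  then multiplied by the lift of \<open>(a, 0)\<close>. This kernel is stable under conjugation, so
  with the new lifts only the parts in \<open>A\<close> contribute to the cocycle. The bracketed
  terms are the changes of lift.\<close>

lemma cohomologous_to_A:
  assumes "\<And>x y. x \<in> T \<Longrightarrow> y \<in> T \<Longrightarrow> \<beta> x + \<beta> y = cT x y + \<beta> (x + y)"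
    and "\<And>a x. a \<in> A \<Longrightarrow> x \<in> T \<Longrightarrow> \<kappa> a x + \<beta> (a * x) = \<beta> x"
    and "a \<in> A" "b \<in> A" "x \<in> T" "y \<in> T"
  shows "c (a, x) (b, y) = c (a, 0) (b, 0) + (c (1, a * y + x) (a * b, 0) - \<beta> (a * y + x))
    - (c (1, x) (a, 0) - \<beta> x) - (c (1, y) (b, 0) - \<beta> y)"
proof -
  have "a * y \<in> T" "a * b \<in> A" using assms(3-6) AT A_mult by blast+
  then show ?thesis
    using cocycle[of 1 a b x 0 y] cocycle[of a 1 b 0 y 0] cocycle[of 1 a b "a * y" 0 0]
      cocycle[of 1 1 "a * b" x "a * y" 0] assms(1)[of x "a * y"] assms(2)[of a y] A1 T0 assms(3-6)
    unfolding \<kappa>_def cT_def by (simp add: algebra_simps)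
qed

end

section \<open>Cocycles on the free abelian group of units\<close>

context affine_cocycle
begin

definition cA :: "'k \<Rightarrow> 'k \<Rightarrow> real" where "cA a b = c (a, 0) (b, 0)"

lemma cA_cocycle: "a \<in> A \<Longrightarrow> b \<in> A \<Longrightarrow> d \<in> A \<Longrightarrow> cA b d + cA a (b * d) = cA a b + cA (a * b) d"
  using cocycle[of a b d 0 0 0] T0 by (simp add: cA_def)

lemma A_power: "a \<in> A \<Longrightarrow> a ^ m \<in> A"
  by (induction m) (auto simp: A1 A_mult)

lemma A_power_int: "a \<in> A \<Longrightarrow> a powi m \<in> A"
  by (auto simp: power_int_def A_power A_inverse)

lemma A_prod: "(\<And>i. i \<in> I \<Longrightarrow> f i \<in> A) \<Longrightarrow> prod f I \<in> A"
  by (induction I rule: infinite_finite_induct) (auto simp: A1 A_mult)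

lemma additive_on_A:
  fixes f :: "'k \<Rightarrow> real"
  assumes f: "\<And>a b. a \<in> A \<Longrightarrow> b \<in> A \<Longrightarrow> f (a * b) = f a + f b"
  shows "a \<in> A \<Longrightarrow> f (a powi m) = of_int m * f a"
    and "(\<And>i. i \<in> I \<Longrightarrow> g i \<in> A) \<Longrightarrow> f (prod g I) = (\<Sum>i\<in>I. f (g i))"
proof -
  have f1: "f 1 = 0" using f[of 1 1] A1 by simp
  show "f (prod g I) = (\<Sum>i\<in>I. f (g i))" if "\<And>i. i \<in> I \<Longrightarrow> g i \<in> A"
    using that by (induction I rule: infinite_finite_induct) (auto simp: f1 f A_prod)
  show "f (a powi m) = of_int m * f a" if a: "a \<in> A"
  proof -
    have n: "f (a ^ k) = of_nat k * f a" for k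
      by (induction k) (use a in \<open>auto simp: f1 f A_power ring_distribs\<close>)
    have "f (a ^ k) + f (inverse (a ^ k)) = 0" for k
      using f[of "a ^ k" "inverse (a ^ k)"] a A_power A_inverse A0 f1
      by (metis power_not_zero right_inverse)
    then have "f (inverse (a ^ k)) = - (of_nat k * f a)" for k using n[of k] by (metis add_eq_0_iff)
    then show ?thesis using n by (cases m rule: int_cases2) (auto simp: power_int_minus)
  qed
qed

text \<open>The antisymmetrisation of a cocycle on an abelian group is biadditive, so vanishing on
  generators makes the extension abelian. Lifts of the generators then define a homomorphic section,
  whose real coordinate is the required \<beta>.\<close>

lemma splitting_A:
  fixes e :: "nat \<Rightarrow> 'k" and n :: "nat \<Rightarrow> 'k \<Rightarrow> int"
  assumes e: "\<And>i. i < s \<Longrightarrow> e i \<in> A"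
    and n: "\<And>i a b. i < s \<Longrightarrow> a \<in> A \<Longrightarrow> b \<in> A \<Longrightarrow> n i (a * b) = n i a + n i b"
    and gen: "\<And>a. a \<in> A \<Longrightarrow> a = (\<Prod>i<s. e i powi n i a)"
    and sym: "\<And>i j. i < s \<Longrightarrow> j < s \<Longrightarrow> cA (e i) (e j) = cA (e j) (e i)"
  obtains \<beta> where "\<And>a b. a \<in> A \<Longrightarrow> b \<in> A \<Longrightarrow> cA a b = \<beta> (a * b) - \<beta> a - \<beta> b"
proof -
  define \<theta> where "\<theta> a b = cA a b - cA b a" for a b
  have \<theta>_mult: "\<theta> (a * b) d = \<theta> a d + \<theta> b d" if "a \<in> A" "b \<in> A" "d \<in> A" for a b d
    using cA_cocycle[of a b d] cA_cocycle[of a d b] cA_cocycle[of d a b] that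
    unfolding \<theta>_def by (simp add: mult.commute)
  have \<theta>_expand: "\<theta> a d = (\<Sum>i<s. of_int (n i a) * \<theta> (e i) d)" if "a \<in> A" "d \<in> A" for a d
  proof -
    have "\<theta> a d = \<theta> (\<Prod>i<s. e i powi n i a) d" using gen[OF that(1)] by simp
    also have "\<dots> = (\<Sum>i<s. \<theta> (e i powi n i a) d)"
      by (rule additive_on_A(2)) (use \<theta>_mult that e A_power_int in auto)
    also have "\<dots> = (\<Sum>i<s. of_int (n i a) * \<theta> (e i) d)"
      using e that \<theta>_mult by (intro sum.cong refl additive_on_A(1)) auto
    finally show ?thesis .
  qed
  have swap: "\<theta> a b = - \<theta> b a" for a b by (simp add: \<theta>_def)
  have "\<theta> (e i) d = 0" if "i < s" "d \<in> A" for i d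
  proof -
    have "\<theta> d (e i) = (\<Sum>j<s. of_int (n j d) * \<theta> (e j) (e i))" using \<theta>_expand e that by blast
    also have "\<dots> = 0" using sym that by (intro sum.neutral) (auto simp: \<theta>_def)
    finally show ?thesis using swap[of "e i" d] by simp
  qed
  then have "\<theta> a d = 0" if "a \<in> A" "d \<in> A" for a d using \<theta>_expand[OF that] that by simp
  then have symA: "cA a d = cA d a" if "a \<in> A" "d \<in> A" for a d using that unfolding \<theta>_def by simp
  define G :: "'k monoid" where "G = \<lparr>carrier = A, monoid.mult = (*), one = 1\<rparr>"
  define E where "E = central_ext G cA"
  have Ainv: "inverse a * a = 1" if "a \<in> A" for a using that A0 by (metis left_inverse)
  have "comm_group G"
    unfolding G_def
  proof (rule comm_groupI, simp_all add: A1 A_mult mult_ac)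
    show "\<exists>y\<in>A. x * y = 1" if "x \<in> A" for x
      using Ainv[OF that] A_inverse[OF that] by (auto simp: mult.commute)
  qed
  then have "comm_group E"
    unfolding E_def
    by (rule comm_group_central_ext)
       (use cA_cocycle c_left T0 symA in \<open>auto simp: G_def cA_def\<close>)
  then interpret E: comm_group E .
  have carE: "carrier E = UNIV \<times> A" and multE: "(r, x) \<otimes>\<^bsub>E\<^esub> (r', y) = (r + r' + cA x y, x * y)"
    and oneE: "\<one>\<^bsub>E\<^esub> = (0, 1)" for r r' x y
    by (auto simp: E_def G_def)
  have snd_mult: "snd (x \<otimes>\<^bsub>E\<^esub> y) = snd x * snd y" for x y
    using multE[of "fst x" "snd x" "fst y" "snd y"] by simp
  have pow_nat: "snd (x [^]\<^bsub>E\<^esub> (m::nat)) = snd x ^ m" for x m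
    by (induction m) (auto simp: oneE snd_mult)
  have inv: "snd (inv\<^bsub>E\<^esub> x) = inverse (snd x)" if "x \<in> carrier E" for x
    using E.r_inv[OF that] by (metis inverse_unique oneE snd_mult snd_conv)
  have pow: "snd (x [^]\<^bsub>E\<^esub> (m::int)) = snd x powi m" if "x \<in> carrier E" for x m
    using pow_nat inv that
    by (cases m rule: int_cases2) (auto simp: int_pow_int E.int_pow_neg power_int_minus)
  \<comment> \<open>The section sends \<open>a\<close> to the product of the lifts
    \<open>(0, e i)\<close> raised to the coordinates of \<open>a\<close>; it is multiplicative
    because the coordinates are additive and \<open>E\<close> is commutative.\<close>
  define f where "f a i = (0, e i) [^]\<^bsub>E\<^esub> n i a" for a i
  define \<tau> where "\<tau> a = finprod E (f a) {..<s}" for a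
  have f_closed: "f a i \<in> carrier E" if "i < s" for a i
    unfolding f_def by (rule E.int_pow_closed) (use e[OF that] in \<open>simp add: carE\<close>)
  have "finite I \<Longrightarrow> I \<subseteq> {..<s} \<Longrightarrow> snd (finprod E (f a) I) = (\<Prod>i\<in>I. snd (f a i))" for I a
  proof (induction I rule: finite_induct)
    case (insert i I)
    then have "finprod E (f a) (insert i I) = f a i \<otimes>\<^bsub>E\<^esub> finprod E (f a) I"
      by (intro E.finprod_insert) (auto simp: f_closed)
    then show ?case using insert by (simp add: snd_mult)
  qed (simp add: oneE)
  then have "snd (\<tau> a) = (\<Prod>i<s. snd (f a i))" for a by (simp add: \<tau>_def)
  also have "(\<Prod>i<s. snd (f a i)) = (\<Prod>i<s. e i powi n i a)" for a
    using e by (intro prod.cong) (auto simp: f_def pow carE)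
  finally have snd_\<tau>: "snd (\<tau> a) = a" if "a \<in> A" for a using gen[OF that] by metis
  have \<tau>_mult: "\<tau> (a * b) = \<tau> a \<otimes>\<^bsub>E\<^esub> \<tau> b" if "a \<in> A" "b \<in> A" for a b
  proof -
    have "\<tau> a \<otimes>\<^bsub>E\<^esub> \<tau> b = finprod E (\<lambda>i. f a i \<otimes>\<^bsub>E\<^esub> f b i) {..<s}"
      unfolding \<tau>_def by (rule E.finprod_multf[symmetric]) (auto simp: f_closed)
    also have "\<dots> = \<tau> (a * b)"
      unfolding \<tau>_def
    proof (rule E.finprod_cong')
      show "f a i \<otimes>\<^bsub>E\<^esub> f b i = f (a * b) i" if "i \<in> {..<s}" for i
        using n[of i a b] e[of i] that \<open>a \<in> A\<close> \<open>b \<in> A\<close> by (simp add: f_def carE E.int_pow_mult)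
    qed (auto simp: f_closed)
    finally show ?thesis by simp
  qed
  have "cA a b = fst (\<tau> (a * b)) - fst (\<tau> a) - fst (\<tau> b)" if "a \<in> A" "b \<in> A" for a b
  proof -
    have *: "\<tau> a = (fst (\<tau> a), a)" "\<tau> b = (fst (\<tau> b), b)"
      using snd_\<tau> that by (metis prod.collapse)+
    have "fst (\<tau> (a * b)) = fst ((fst (\<tau> a), a) \<otimes>\<^bsub>E\<^esub> (fst (\<tau> b), b))"
      using \<tau>_mult[OF that] * by simp
    then show ?thesis by (simp add: multE)
  qed
  then show ?thesis by (rule that[of "\<lambda>a. fst (\<tau> a)"])
qed

theorem coboundary_if_symmetric_on_generators:
  fixes e :: "nat \<Rightarrow> 'k" and n :: "nat \<Rightarrow> 'k \<Rightarrow> int"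
  assumes e: "\<And>i. i < s \<Longrightarrow> e i \<in> A"
    and n: "\<And>i a b. i < s \<Longrightarrow> a \<in> A \<Longrightarrow> b \<in> A \<Longrightarrow> n i (a * b) = n i a + n i b"
    and gen: "\<And>a. a \<in> A \<Longrightarrow> a = (\<Prod>i<s. e i powi n i a)"
    and sym: "\<And>i j. i < s \<Longrightarrow> j < s \<Longrightarrow> c (e i, 0) (e j, 0) = c (e j, 0) (e i, 0)"
    and u: "u \<in> A" and p: "poly (map_poly of_int p) u = 0" and p1: "poly p 1 \<noteq> 0"
    and div: "\<And>z. z \<in> T \<Longrightarrow> \<exists>m w. m \<noteq> 0 \<and> w \<in> T \<and> of_int m * z = poly (map_poly of_int p) (inverse u) * w"
  obtains \<gamma> where "\<And>a b x y. a \<in> A \<Longrightarrow> b \<in> A \<Longrightarrow> x \<in> T \<Longrightarrow> y \<in> T \<Longrightarrow>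
    c (a, x) (b, y) = \<gamma> (a * b, a * y + x) - \<gamma> (a, x) - \<gamma> (b, y)"
proof -
  have "cT x y = cT y x" if "x \<in> T" "y \<in> T" for x y
    using \<omega>_eq_0[OF u p div that] by (simp add: \<omega>_def)
  then obtain \<beta> where \<beta>: "\<And>x y. x \<in> T \<Longrightarrow> y \<in> T \<Longrightarrow> \<beta> x + \<beta> y = cT x y + \<beta> (x + y)"
    "\<And>a x. a \<in> A \<Longrightarrow> x \<in> T \<Longrightarrow> \<kappa> a x + \<beta> (a * x) = \<beta> x"
    using invariant_splitting[OF u p p1] by metis
  obtain \<delta> where \<delta>: "\<And>a b. a \<in> A \<Longrightarrow> b \<in> A \<Longrightarrow> cA a b = \<delta> (a * b) - \<delta> a - \<delta> b"
    using splitting_A[of s e n, OF e n gen sym[folded cA_def]] by blast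
  have "c (a, x) (b, y) = \<delta> (a * b) - \<delta> a - \<delta> b + (c (1, a * y + x) (a * b, 0) - \<beta> (a * y + x))
    - (c (1, x) (a, 0) - \<beta> x) - (c (1, y) (b, 0) - \<beta> y)"
    if "a \<in> A" "b \<in> A" "x \<in> T" "y \<in> T" for a b x y
    using cohomologous_to_A[OF \<beta> that] \<delta>[OF that(1,2)] by (simp add: cA_def)
  then show ?thesis
    by (intro that[of "\<lambda>(a, x). \<delta> a + (c (1, x) (a, 0) - \<beta> x)"]) simp
qed

end

section \<open>Lifting singular simplices through a free action\<close>

text \<open>The condition \<open>wandering\<close> is that of a covering space action: the
  translates of \<open>W\<close> by distinct elements are disjoint. It yields freeness as well as
  local sections of the projection.\<close>

locale covering_action = group G for G :: "('g, 'm) monoid_scheme" (structure) +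
  fixes Y :: "'a topology" and act :: "'g \<Rightarrow> 'a \<Rightarrow> 'a"
  assumes act_continuous: "g \<in> carrier G \<Longrightarrow> continuous_map Y Y (act g)"
    and act_one: "y \<in> topspace Y \<Longrightarrow> act \<one> y = y"
    and act_mult: "g \<in> carrier G \<Longrightarrow> h \<in> carrier G \<Longrightarrow> y \<in> topspace Y \<Longrightarrow> act (g \<otimes> h) y = act g (act h y)"
    and wandering: "y \<in> topspace Y \<Longrightarrow>
      \<exists>W. openin Y W \<and> y \<in> W \<and> (\<forall>g\<in>carrier G. \<forall>w\<in>W. act g w \<in> W \<longrightarrow> g = \<one>)"
begin

abbreviation proj :: "'a \<Rightarrow> 'a set" where "proj \<equiv> Group_Action.orbit G act"

definition X :: "'a set topology" where "X = quotient_topology Y proj"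

lemma act_closed: "g \<in> carrier G \<Longrightarrow> y \<in> topspace Y \<Longrightarrow> act g y \<in> topspace Y"
  using continuous_map_image_subset_topspace[OF act_continuous] by blast

lemma act_inv:
  assumes "g \<in> carrier G" "y \<in> topspace Y"
  shows "act (inv g) (act g y) = y" "act g (act (inv g) y) = y"
proof -
  have "act (inv g) (act g y) = act \<one> y" "act g (act (inv g) y) = act \<one> y"
    using act_mult[of "inv g" g y] act_mult[of g "inv g" y] assms by simp_all
  then show "act (inv g) (act g y) = y" "act g (act (inv g) y) = y"
    using act_one[OF assms(2)] by simp_all
qed

lemma act_free:
  assumes "g \<in> carrier G" "y \<in> topspace Y" "act g y = y"
  shows "g = \<one>"
proof -
  obtain W where "y \<in> W" "\<forall>g\<in>carrier G. \<forall>w\<in>W. act g w \<in> W \<longrightarrow> g = \<one>"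
    using wandering[OF assms(2)] by blast
  then have "act g y \<in> W \<longrightarrow> g = \<one>" and "act g y \<in> W"
    using assms(1,3) by (blast, simp)
  then show ?thesis by blast
qed

lemma act_inj:
  assumes "g \<in> carrier G" "h \<in> carrier G" "y \<in> topspace Y" "act g y = act h y"
  shows "g = h"
proof -
  have "act (inv h \<otimes> g) y = y" using assms act_mult act_inv by simp
  then have "inv h \<otimes> g = \<one>" using act_free[of "inv h \<otimes> g" y] assms by simp
  then show ?thesis using assms by (metis inv_closed inv_equality inv_inv)
qed

lemma proj_eq_iff:
  assumes "y \<in> topspace Y" "z \<in> topspace Y"
  shows "proj y = proj z \<longleftrightarrow> (\<exists>g\<in>carrier G. z = act g y)"
proof
  assume eq: "proj y = proj z"
  have "z \<in> proj z" unfolding Group_Action.orbit_def using act_one[OF assms(2)] by force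
  then show "\<exists>g\<in>carrier G. z = act g y" using eq by (auto simp: Group_Action.orbit_def)
next
  assume "\<exists>g\<in>carrier G. z = act g y"
  then obtain g where g: "g \<in> carrier G" "z = act g y" by blast
  have "\<exists>k\<in>carrier G. act h z = act k y" if "h \<in> carrier G" for h
    using act_mult[OF that g(1) assms(1)] that g by (intro bexI[of _ "h \<otimes> g"]) auto
  moreover have "\<exists>k\<in>carrier G. act h y = act k z" if "h \<in> carrier G" for h
    using act_mult[of "h \<otimes> inv g" g y] that g assms by (intro bexI[of _ "h \<otimes> inv g"]) (auto simp: m_assoc)
  ultimately show "proj y = proj z" unfolding Group_Action.orbit_def by blast
qed

lemma proj_act: "g \<in> carrier G \<Longrightarrow> y \<in> topspace Y \<Longrightarrow> proj (act g y) = proj y"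
proof -
  assume "g \<in> carrier G" "y \<in> topspace Y"
  then have "proj y = proj (act g y)"
    by (subst proj_eq_iff) (auto intro: act_closed)
  then show ?thesis by simp
qed

lemma continuous_proj: "continuous_map Y X proj"
  unfolding X_def by (rule quotient_imp_continuous_map[OF quotient_map_quotient_topology])

lemma topspace_X: "topspace X = proj ` topspace Y"
  by (simp add: X_def)

lemma openin_act_image:
  assumes "openin Y U" "g \<in> carrier G"
  shows "openin Y (act g ` U)"
proof -
  have U: "U \<subseteq> topspace Y" using assms(1) openin_subset by blast
  have "act g ` U = {y \<in> topspace Y. act (inv g) y \<in> U}"
  proof (intro subset_antisym subsetI)
    fix y assume "y \<in> act g ` U"
    then show "y \<in> {y \<in> topspace Y. act (inv g) y \<in> U}"
      using U assms act_closed act_inv by auto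
  next
    fix y assume "y \<in> {y \<in> topspace Y. act (inv g) y \<in> U}"
    then show "y \<in> act g ` U" using act_inv(2)[OF assms(2), of y] by (metis imageI mem_Collect_eq)
  qed
  then show ?thesis
    using openin_continuous_map_preimage[OF act_continuous[OF inv_closed[OF assms(2)]] assms(1)] by simp
qed

lemma openin_proj_image:
  assumes "openin Y U"
  shows "openin X (proj ` U)"
proof -
  have U: "U \<subseteq> topspace Y" using assms openin_subset by blast
  have "{y \<in> topspace Y. proj y \<in> proj ` U} = (\<Union>g\<in>carrier G. act g ` U)"
  proof (intro subset_antisym subsetI)
    fix y assume "y \<in> {y \<in> topspace Y. proj y \<in> proj ` U}"
    then obtain u where "y \<in> topspace Y" "u \<in> U" "proj u = proj y" by auto
    then show "y \<in> (\<Union>g\<in>carrier G. act g ` U)" using proj_eq_iff[of u y] U by auto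
  next
    fix y assume "y \<in> (\<Union>g\<in>carrier G. act g ` U)"
    then obtain g u where "g \<in> carrier G" "u \<in> U" "y = act g u" by blast
    then show "y \<in> {y \<in> topspace Y. proj y \<in> proj ` U}" using U proj_act[of g u] act_closed by auto
  qed
  moreover have "openin Y (\<Union>g\<in>carrier G. act g ` U)"
    using openin_act_image[OF assms] by blast
  ultimately show ?thesis
    using U unfolding X_def openin_quotient_topology by auto
qed

text \<open>The projection is open, and it is injective on a wandering set \<open>W\<close>; its
  inverse on the image of \<open>W\<close> is therefore continuous.\<close>

lemma local_section:
  assumes "y \<in> topspace Y"
  obtains V f where "openin X V" "proj y \<in> V" "continuous_map (subtopology X V) Y f"
    "\<And>x. x \<in> V \<Longrightarrow> proj (f x) = x"
proof -
  obtain W where W: "openin Y W" "y \<in> W" "\<And>g w. g \<in> carrier G \<Longrightarrow> w \<in> W \<Longrightarrow> act g w \<in> W \<Longrightarrow> g = \<one>"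
    using wandering[OF assms] by blast
  have WY: "W \<subseteq> topspace Y" using W(1) openin_subset by blast
  have inj: "inj_on proj W"
  proof (rule inj_onI)
    fix w v assume "w \<in> W" "v \<in> W" "proj w = proj v"
    then show "w = v" using proj_eq_iff[of w v] WY W(3) act_one by (metis subsetD)
  qed
  define f where "f = inv_into W proj"
  have f: "f x \<in> W" "proj (f x) = x" if "x \<in> proj ` W" for x
    using that by (auto simp: f_def inv_into_into f_inv_into_f)
  have "continuous_map (subtopology X (proj ` W)) Y f"
    unfolding continuous_map_def
  proof (intro conjI allI impI)
    show "f \<in> topspace (subtopology X (proj ` W)) \<rightarrow> topspace Y" using f WY by auto
    fix U assume U: "openin Y U"
    have "{x \<in> topspace (subtopology X (proj ` W)). f x \<in> U} = proj ` (U \<inter> W)"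
    proof (intro subset_antisym subsetI)
      fix x assume "x \<in> {x \<in> topspace (subtopology X (proj ` W)). f x \<in> U}"
      then show "x \<in> proj ` (U \<inter> W)" using f[of x] by (auto intro!: image_eqI[of _ _ "f x"])
    next
      fix x assume "x \<in> proj ` (U \<inter> W)"
      then obtain w where "w \<in> U" "w \<in> W" "x = proj w" by blast
      then show "x \<in> {x \<in> topspace (subtopology X (proj ` W)). f x \<in> U}"
        using inj WY by (auto simp: f_def topspace_X)
    qed
    moreover have "openin (subtopology X (proj ` W)) (proj ` (U \<inter> W))"
      using openin_proj_image[of "U \<inter> W"] U W(1) by (auto simp: openin_subtopology)
    ultimately show "openin (subtopology X (proj ` W)) {x \<in> topspace (subtopology X (proj ` W)). f x \<in> U}"
      by simp
  qed
  then show ?thesis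
    using that[of "proj ` W" f] openin_proj_image[OF W(1)] W(2) f by blast
qed

text \<open>For each \<open>g\<close> the set where the second lift is \<open>g\<close> times the
  first is open. By freeness these sets are disjoint, and they cover \<open>Z\<close>, so
  connectedness leaves only one of them.\<close>

lemma lifts_differ_by_act:
  assumes Z: "connected_space Z" and l: "continuous_map Z Y l" and m: "continuous_map Z Y m"
    and eq: "\<And>z. z \<in> topspace Z \<Longrightarrow> proj (l z) = proj (m z)"
  obtains g where "g \<in> carrier G" "\<And>z. z \<in> topspace Z \<Longrightarrow> m z = act g (l z)"
proof (cases "topspace Z = {}")
  case True
  then show ?thesis using that[of \<one>] by simp
next
  case False
  have lY: "l z \<in> topspace Y" and mY: "m z \<in> topspace Y" if "z \<in> topspace Z" for z
    using l m that by (auto simp: continuous_map)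
  have ex: "\<exists>g\<in>carrier G. m z = act g (l z)" if "z \<in> topspace Z" for z
    using proj_eq_iff[OF lY[OF that] mY[OF that]] eq[OF that] by simp
  define E where "E g = {z \<in> topspace Z. m z = act g (l z)}" for g
  have openE: "openin Z (E g)" if g: "g \<in> carrier G" for g
  proof (subst openin_subopen, rule ballI)
    fix z assume z: "z \<in> E g"
    then have zZ: "z \<in> topspace Z" by (simp add: E_def)
    obtain W where W: "openin Y W" "l z \<in> W" "\<And>g w. g \<in> carrier G \<Longrightarrow> w \<in> W \<Longrightarrow> act g w \<in> W \<Longrightarrow> g = \<one>"
      using wandering[OF lY[OF zZ]] by blast
    have WY: "W \<subseteq> topspace Y" using W(1) openin_subset by blast
    \<comment> \<open>On \<open>N\<close> the first lift stays in \<open>W\<close> and the second in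
      \<open>g W\<close>, so no other group element can relate them there.\<close>
    define N where "N = {z \<in> topspace Z. l z \<in> W} \<inter> {z \<in> topspace Z. m z \<in> act g ` W}"
    have "openin Z N"
      unfolding N_def using l m W(1) openin_act_image[OF W(1) g]
      by (intro openin_Int openin_continuous_map_preimage)
    moreover have "z \<in> N" using z zZ W(2) by (auto simp: N_def E_def)
    moreover have "N \<subseteq> E g"
    proof
      fix x assume x: "x \<in> N"
      then have xZ: "x \<in> topspace Z" by (simp add: N_def)
      obtain h where h: "h \<in> carrier G" "m x = act h (l x)" using ex[OF xZ] by blast
      obtain w where w: "w \<in> W" "m x = act g w" using x by (auto simp: N_def)
      have "act (inv g \<otimes> h) (l x) = act (inv g) (act h (l x))" using g h lY[OF xZ] by (intro act_mult) auto
      also have "\<dots> = w" using act_inv(1)[OF g] w WY h by auto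
      finally have "inv g \<otimes> h = \<one>"
        using W(3)[of "inv g \<otimes> h" "l x"] x w g h by (auto simp: N_def)
      then have "h = g" using g h by (metis inv_closed inv_equality inv_inv)
      then show "x \<in> E g" using h xZ by (simp add: E_def)
    qed
    ultimately show "\<exists>T. openin Z T \<and> z \<in> T \<and> T \<subseteq> E g" by blast
  qed
  obtain z0 where z0: "z0 \<in> topspace Z" using False by blast
  obtain g where g: "g \<in> carrier G" "m z0 = act g (l z0)" using ex[OF z0] by blast
  have "topspace Z \<subseteq> E g"
  proof (rule ccontr)
    assume not: "\<not> topspace Z \<subseteq> E g"
    define F where "F = (\<Union>h\<in>carrier G - {g}. E h)"
    have "openin Z F" unfolding F_def using openE by blast
    moreover have cover: "topspace Z \<subseteq> E g \<union> F" using ex unfolding E_def F_def by blast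
    moreover have "h = g" if x: "x \<in> E g" "x \<in> E h" and h: "h \<in> carrier G" for x h
    proof (rule act_inj[OF h g(1)])
      show "l x \<in> topspace Y" using lY x(1) by (simp add: E_def)
      have "m x = act g (l x)" "m x = act h (l x)" using x by (simp_all only: E_def mem_Collect_eq)
      then show "act h (l x) = act g (l x)" by metis
    qed
    then have "E g \<inter> F = {}" by (auto simp: F_def)
    moreover have "z0 \<in> E g" using z0 g by (simp add: E_def)
    ultimately show False
      using Z openE[OF g(1)] not unfolding connected_space_def by blast
  qed
  then show ?thesis using that[OF g(1)] by (auto simp: E_def)
qed

end

section \<open>Lifting a simplex by subdividing one coordinate at a time\<close>

lemma simplex_box:
  fixes a :: "nat \<Rightarrow> real"
  assumes "openin (powertop_real UNIV) N" "a \<in> N" "\<And>j. j > p \<Longrightarrow> a j = 0"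
  shows "\<exists>d>0. \<forall>x. (\<forall>j\<le>p. \<bar>x j - a j\<bar> \<le> d) \<and> (\<forall>j>p. x j = 0) \<longrightarrow> x \<in> N"
proof -
  have "\<exists>U. (\<forall>i\<in>UNIV. openin euclideanreal (U i)) \<and> a \<in> Pi\<^sub>E UNIV U \<and> Pi\<^sub>E UNIV U \<subseteq> N"
    using assms(1,2) unfolding openin_product_topology_alt by blast
  then obtain U :: "nat \<Rightarrow> real set" where
      U: "\<And>i. open (U i)" "a \<in> Pi\<^sub>E UNIV U" "Pi\<^sub>E UNIV U \<subseteq> N"
    by (metis UNIV_I open_openin)
  have "\<exists>d>0. \<forall>y. \<bar>y - a j\<bar> \<le> d \<longrightarrow> y \<in> U j" for j
  proof -
    have "a j \<in> U j" using U(2) by (rule PiE_mem) simp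
    then obtain d :: real where "d > 0" "cball (a j) d \<subseteq> U j"
      using U(1)[of j] open_contains_cball by blast
    have "y \<in> U j" if "\<bar>y - a j\<bar> \<le> d" for y
    proof -
      have "y \<in> cball (a j) d" unfolding mem_cball dist_real_def using that by linarith
      then show ?thesis using \<open>cball (a j) d \<subseteq> U j\<close> by blast
    qed
    then show ?thesis using \<open>d > 0\<close> by blast
  qed
  then obtain D where D: "\<And>j. D j > 0" "\<And>j y. \<bar>y - a j\<bar> \<le> D j \<Longrightarrow> y \<in> U j" by metis
  \<comment> \<open>Beyond \<open>p\<close> all points in question have the same coordinates as
    \<open>a\<close>, so only finitely many of the radii \<open>D j\<close> matter and their minimum
    is positive.\<close>
  define d where "d = Min (D ` {..p})"
  have "d > 0" using D(1) by (simp add: d_def)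
  moreover have "x \<in> N" if x: "\<And>j. j \<le> p \<Longrightarrow> \<bar>x j - a j\<bar> \<le> d" "\<And>j. j > p \<Longrightarrow> x j = 0" for x
  proof -
    have "x j \<in> U j" for j
    proof (cases "j \<le> p")
      case True
      then have "d \<le> D j" by (simp add: d_def)
      then show ?thesis using x(1)[OF True] D(2)[of "x j" j] by linarith
    next
      case False
      then have "x j = a j" using x(2) assms(3) by simp
      then show ?thesis using U(2) by auto
    qed
    then show ?thesis using U(3) by auto
  qed
  ultimately show ?thesis by blast
qed

lemma connectedin_simplex_convex:
  assumes S: "S \<subseteq> standard_simplex p"
    and conv: "\<And>x y u. x \<in> S \<Longrightarrow> y \<in> S \<Longrightarrow> 0 \<le> u \<Longrightarrow> u \<le> 1 \<Longrightarrow> (\<lambda>i. (1 - u) * x i + u * y i) \<in> S"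
  shows "connectedin (powertop_real UNIV) S"
proof -
  define g where "g \<equiv> \<lambda>x y::nat\<Rightarrow>real. \<lambda>u i. (1 - u) * x i + u * y i"
  have 1: "continuous_map (subtopology euclideanreal {0..1}) (powertop_real UNIV) (g x y)" for x y
    unfolding g_def continuous_map_componentwise by (force intro: continuous_intros)
  have 2: "g x y \<in> {0..1} \<rightarrow> S" "g x y 0 = x" "g x y 1 = y" if "x \<in> S" "y \<in> S" for x y
    using that by (auto simp: conv g_def)
  have "path_connectedin (powertop_real UNIV) S"
    unfolding path_connectedin_def path_connected_space_def pathin_def
  proof (intro conjI ballI)
    fix x y assume "x \<in> topspace (subtopology (powertop_real UNIV) S)" "y \<in> topspace (subtopology (powertop_real UNIV) S)"
    then have xy: "x \<in> S" "y \<in> S" by auto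
    have "continuous_map (top_of_set {0..1}) (subtopology (powertop_real UNIV) S) (g x y)"
      using 1[of x y] 2(1)[OF xy] unfolding continuous_map_in_subtopology by (simp add: image_subset_iff_funcset)
    then show "\<exists>g::real \<Rightarrow> nat \<Rightarrow> real. continuous_map (top_of_set {0..1}) (subtopology (powertop_real UNIV) S) g \<and> g 0 = x \<and> g 1 = y"
      using 2(2,3)[OF xy] by (intro exI[of _ "g x y"]) simp
  qed simp
  then show ?thesis by (rule path_connectedin_imp_connectedin)
qed

context covering_action
begin

definition liftable :: "((nat \<Rightarrow> real) \<Rightarrow> 'a set) \<Rightarrow> (nat \<Rightarrow> real) set \<Rightarrow> bool" where
  "liftable \<sigma> S \<longleftrightarrow>
     (\<exists>l. continuous_map (subtopology (powertop_real UNIV) S) Y l \<and> (\<forall>x\<in>S. proj (l x) = \<sigma> x))"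

lemma liftable_subset:
  assumes "liftable \<sigma> S" "T \<subseteq> S"
  shows "liftable \<sigma> T"
proof -
  obtain l where l: "continuous_map (subtopology (powertop_real UNIV) S) Y l" "\<forall>x\<in>S. proj (l x) = \<sigma> x"
    using assms(1) unfolding liftable_def by metis
  show ?thesis
    unfolding liftable_def using continuous_map_from_subtopology_mono[OF l(1) assms(2)] l(2) assms(2)
    by (metis subsetD)
qed

text \<open>On the common wall \<open>x k = m\<close> the two partial lifts differ by a single group
  element, because the wall is connected. Translating one lift by it makes them agree there.\<close>

lemma liftable_glue:
  assumes A: "liftable \<sigma> {x \<in> S. x k \<le> m}" and B: "liftable \<sigma> {x \<in> S. m \<le> x k}"
    and conn: "connectedin (powertop_real UNIV) {x \<in> S. x k = (m::real)}"
  shows "liftable \<sigma> S"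
proof -
  let ?P = "powertop_real UNIV"
  obtain l where l: "continuous_map (subtopology ?P {x \<in> S. x k \<le> m}) Y l" "\<And>x. x \<in> S \<Longrightarrow> x k \<le> m \<Longrightarrow> proj (l x) = \<sigma> x"
    using A unfolding liftable_def by (metis (mono_tags, lifting) mem_Collect_eq)
  obtain r where r: "continuous_map (subtopology ?P {x \<in> S. m \<le> x k}) Y r" "\<And>x. x \<in> S \<Longrightarrow> m \<le> x k \<Longrightarrow> proj (r x) = \<sigma> x"
    using B unfolding liftable_def by (metis (mono_tags, lifting) mem_Collect_eq)
  let ?C = "{x \<in> S. x k = m}"
  have "connected_space (subtopology ?P ?C)" using conn unfolding connectedin_def by (rule conjunct2)
  moreover have "continuous_map (subtopology ?P ?C) Y l" "continuous_map (subtopology ?P ?C) Y r"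
    by (rule continuous_map_from_subtopology_mono[OF l(1)], rule Collect_mono, simp)
       (rule continuous_map_from_subtopology_mono[OF r(1)], rule Collect_mono, simp)
  moreover have "proj (r x) = proj (l x)" if "x \<in> topspace (subtopology ?P ?C)" for x
  proof -
    have "x \<in> S" "x k = m" using that by simp_all
    then show ?thesis using l(2)[of x] r(2)[of x] by simp
  qed
  ultimately obtain g where g: "g \<in> carrier G" "\<And>x. x \<in> topspace (subtopology ?P ?C) \<Longrightarrow> l x = act g (r x)"
    using lifts_differ_by_act[of "subtopology ?P ?C" r l] by blast
  define r' where "r' = act g \<circ> r"
  have r': "continuous_map (subtopology ?P {x \<in> S. m \<le> x k}) Y r'"
    unfolding r'_def by (rule continuous_map_compose[OF r(1) act_continuous[OF g(1)]])
  have r'_proj: "proj (r' x) = \<sigma> x" if "x \<in> S" "m \<le> x k" for x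
  proof -
    have "r x \<in> topspace Y" using continuous_map_image_subset_topspace[OF r(1)] that by auto
    then show ?thesis using proj_act[OF g(1)] r(2)[OF that] by (simp add: r'_def)
  qed
  have cont: "continuous_map (subtopology ?P S) Y (\<lambda>x. if x k \<le> m then l x else r' x)"
  proof (rule continuous_map_cases_le)
    show "continuous_map (subtopology ?P S) euclideanreal (\<lambda>x. x k)"
      by (intro continuous_map_from_subtopology continuous_map_product_projection) simp
    show "continuous_map (subtopology (subtopology ?P S) {x \<in> topspace (subtopology ?P S). x k \<le> m}) Y l"
      using l(1) by (simp add: subtopology_subtopology Int_def)
    show "continuous_map (subtopology (subtopology ?P S) {x \<in> topspace (subtopology ?P S). m \<le> x k}) Y r'"
      using r' by (simp add: subtopology_subtopology Int_def)
    show "l x = r' x" if "x \<in> topspace (subtopology ?P S)" "x k = m" for x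
      unfolding r'_def o_apply by (rule g(2)) (use that in simp)
  qed simp
  have proj_eq: "proj (if x k \<le> m then l x else r' x) = \<sigma> x" if "x \<in> S" for x
    using l(2)[OF that] r'_proj[OF that] by (cases "x k \<le> m") simp_all
  show ?thesis
    unfolding liftable_def
    by (rule exI[of _ "\<lambda>x. if x k \<le> m then l x else r' x"], rule conjI[OF cont], rule ballI, rule proj_eq)
qed

end

context covering_action
begin

lemma liftable_locally:
  assumes \<sigma>: "singular_simplex p X \<sigma>"
  shows "\<exists>d>0. liftable \<sigma> {x \<in> standard_simplex p. \<forall>j\<in>{0..p}. \<bar>x j - a j\<bar> \<le> d}"
proof -
  let ?P = "powertop_real UNIV"
  let ?D = "standard_simplex p"
  have cont: "continuous_map (subtopology ?P ?D) X \<sigma>" using \<sigma> by (simp add: singular_simplex_def)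
  \<comment> \<open>The coordinates of \<open>a\<close> beyond \<open>p\<close> are arbitrary; they
    are reset to 0 as \<open>simplex_box\<close> requires. If \<open>b\<close> lies off the simplex,
    a thin enough box around it misses the simplex, and the empty set is liftable.\<close>
  define b where "b j = (if j \<le> p then a j else 0)" for j
  have slab: "{x \<in> ?D. \<forall>j\<in>{0..p}. \<bar>x j - a j\<bar> \<le> d} = {x \<in> ?D. \<forall>j\<le>p. \<bar>x j - b j\<bar> \<le> d}" for d
    by (auto simp: b_def)
  have D0: "x j = 0" if "x \<in> ?D" "j > p" for x j using that by (simp add: standard_simplex_def)
  show ?thesis
  proof (cases "b \<in> ?D")
    case True
    then have "\<sigma> b \<in> topspace X" using cont by (auto simp: continuous_map)
    then obtain y where y: "y \<in> topspace Y" "\<sigma> b = proj y" by (auto simp: topspace_X)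
    obtain V f where V: "openin X V" "proj y \<in> V" "continuous_map (subtopology X V) Y f"
        "\<And>x. x \<in> V \<Longrightarrow> proj (f x) = x"
      using local_section[OF y(1)] by blast
    have "openin (subtopology ?P ?D) {x \<in> topspace (subtopology ?P ?D). \<sigma> x \<in> V}"
      by (rule openin_continuous_map_preimage[OF cont V(1)])
    then obtain N where N: "openin ?P N" "{x \<in> ?D. \<sigma> x \<in> V} = N \<inter> ?D"
      by (auto simp: openin_subtopology)
    have "b \<in> N" using N(2) True V(2) y(2) by auto
    then obtain d where d: "d > 0" "\<And>x. (\<forall>j\<le>p. \<bar>x j - b j\<bar> \<le> d) \<Longrightarrow> (\<forall>j>p. x j = 0) \<Longrightarrow> x \<in> N"
      using simplex_box[OF N(1), of b p] by (auto simp: b_def)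
    let ?S = "{x \<in> ?D. \<forall>j\<le>p. \<bar>x j - b j\<bar> \<le> d}"
    have SV: "\<sigma> x \<in> V" if "x \<in> ?S" for x
      using that d(2)[of x] D0[of x] N(2) by blast
    have "continuous_map (subtopology ?P ?S) X \<sigma>"
      by (rule continuous_map_from_subtopology_mono[OF cont]) auto
    then have "continuous_map (subtopology ?P ?S) (subtopology X V) \<sigma>"
      using SV by (auto simp: continuous_map_in_subtopology)
    then have "continuous_map (subtopology ?P ?S) Y (f \<circ> \<sigma>)"
      using V(3) by (rule continuous_map_compose)
    then have "liftable \<sigma> ?S" unfolding liftable_def using SV V(4) by (intro exI[of _ "f \<circ> \<sigma>"]) auto
    then show ?thesis unfolding slab using d(1) by blast
  next
    case False
    have "openin ?P (- ?D)"
      using closedin_standard_simplex[of p] by (simp add: closedin_def Compl_eq_Diff_UNIV)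
    then obtain d where d: "d > 0" "\<And>x. (\<forall>j\<le>p. \<bar>x j - b j\<bar> \<le> d) \<Longrightarrow> (\<forall>j>p. x j = 0) \<Longrightarrow> x \<in> - ?D"
      using simplex_box[of "- ?D" b p] False by (auto simp: b_def)
    have "{x \<in> ?D. \<forall>j\<le>p. \<bar>x j - b j\<bar> \<le> d} = {}" using d(2) D0 by blast
    moreover have "liftable \<sigma> {}" by (auto simp: liftable_def continuous_map)
    ultimately have "liftable \<sigma> {x \<in> ?D. \<forall>j\<le>p. \<bar>x j - b j\<bar> \<le> d}" by (simp only:)
    then show ?thesis unfolding slab using d(1) by blast
  qed
qed

text \<open>In the slab the coordinates from \<open>k\<close> to \<open>p\<close> are confined near
  \<open>a\<close> and the smaller ones are free. The induction step frees coordinate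
  \<open>k\<close> by bisecting its range [0, 1]: adjacent intervals are glued along a convex wall,
  with the smaller of the two thicknesses, and the induction hypothesis at \<open>a(k := r)\<close>
  covers short intervals around \<open>r\<close>.\<close>

lemma liftable_slabs:
  assumes \<sigma>: "singular_simplex p X \<sigma>"
  shows "k \<le> Suc p \<Longrightarrow>
    \<exists>d>0. liftable \<sigma> {x \<in> standard_simplex p. \<forall>j\<in>{k..p}. \<bar>x j - a j\<bar> \<le> d}"
proof (induction k arbitrary: a)
  case 0
  show ?case using liftable_locally[OF \<sigma>] .
next
  case (Suc k)
  let ?D = "standard_simplex p"
  let ?S = "\<lambda>b c d. {x \<in> ?D. b \<le> x k \<and> x k \<le> c \<and> (\<forall>j\<in>{Suc k..p}. \<bar>x j - a j\<bar> \<le> d)}"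
  have "\<exists>d>0. liftable \<sigma> (?S 0 1 d)"
  proof (rule Bolzano[of 0 1 "\<lambda>b c. \<exists>d>0. liftable \<sigma> (?S b c d)"])
    fix b m c :: real
    assume order: "b \<le> m" "m \<le> c" and "\<exists>d>0. liftable \<sigma> (?S b m d)" "\<exists>d>0. liftable \<sigma> (?S m c d)"
    then obtain d e where de: "d > 0" "liftable \<sigma> (?S b m d)" "e > 0" "liftable \<sigma> (?S m c e)" by blast
    let ?T = "?S b c (min d e)"
    have "liftable \<sigma> {x \<in> ?T. x k \<le> m}" "liftable \<sigma> {x \<in> ?T. m \<le> x k}"
      by (rule liftable_subset[OF de(2)], force) (rule liftable_subset[OF de(4)], force)
    moreover have "connectedin (powertop_real UNIV) {x \<in> ?T. x k = m}"
    proof (rule connectedin_simplex_convex[of _ p])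
      fix x y and u :: real assume u: "0 \<le> u" "u \<le> 1" and x: "x \<in> {x \<in> ?T. x k = m}" and y: "y \<in> {x \<in> ?T. x k = m}"
      have "\<bar>(1 - u) * x j + u * y j - a j\<bar> \<le> min d e" if "j \<in> {Suc k..p}" for j
      proof -
        have "\<bar>x j - a j\<bar> \<le> min d e" "\<bar>y j - a j\<bar> \<le> min d e" using x y that by auto
        then have "(1 - u) * \<bar>x j - a j\<bar> + u * \<bar>y j - a j\<bar> \<le> min d e"
          using u by (intro convex_bound_le) auto
        moreover have "(1 - u) * x j + u * y j - a j = (1 - u) * (x j - a j) + u * (y j - a j)"
          by (simp add: algebra_simps)
        ultimately show ?thesis
          using u abs_triangle_ineq[of "(1 - u) * (x j - a j)" "u * (y j - a j)"] by (simp add: abs_mult)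
      qed
      moreover have "(1 - u) * m + u * m = m" by (simp add: algebra_simps)
      ultimately show "(\<lambda>i. (1 - u) * x i + u * y i) \<in> {x \<in> ?T. x k = m}"
        using x y u convex_standard_simplex[of x p y u] order by auto
    qed auto
    ultimately have "liftable \<sigma> ?T" by (rule liftable_glue)
    moreover have "min d e > 0" using de by simp
    ultimately show "\<exists>d>0. liftable \<sigma> (?S b c d)" by blast
  next
    fix r :: real
    obtain d where d: "d > 0" "liftable \<sigma> {x \<in> ?D. \<forall>j\<in>{k..p}. \<bar>x j - (a(k := r)) j\<bar> \<le> d}"
      using Suc.IH[of "a(k := r)"] Suc.prems by auto
    have "liftable \<sigma> (?S b c d)" if "b \<le> r" "r \<le> c" "c - b < d" for b c
    proof (rule liftable_subset[OF d(2)])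
      have "\<bar>x j - (a(k := r)) j\<bar> \<le> d" if x: "x \<in> ?S b c d" and j: "j \<in> {k..p}" for x j
      proof (cases "j = k")
        case True
        then show ?thesis using x \<open>b \<le> r\<close> \<open>r \<le> c\<close> \<open>c - b < d\<close> by auto
      qed (use x j in auto)
      then show "?S b c d \<subseteq> {x \<in> ?D. \<forall>j\<in>{k..p}. \<bar>x j - (a(k := r)) j\<bar> \<le> d}" by blast
    qed
    then show "\<exists>d>0. \<forall>b c. b \<le> r \<and> r \<le> c \<and> c - b < d \<longrightarrow> (\<exists>d>0. liftable \<sigma> (?S b c d))"
      using d(1) by blast
  qed simp
  then obtain d where "d > 0" "liftable \<sigma> (?S 0 1 d)" by blast
  moreover have "{x \<in> ?D. \<forall>j\<in>{Suc k..p}. \<bar>x j - a j\<bar> \<le> d} \<subseteq> ?S 0 1 d"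
    by (auto simp: standard_simplex_def)
  ultimately show ?case using liftable_subset by blast
qed

theorem simplex_lift:
  assumes "singular_simplex p X \<sigma>"
  obtains \<tau> where "singular_simplex p Y \<tau>" "simplex_map p proj \<tau> = \<sigma>"
proof -
  \<comment> \<open>At \<open>k = Suc p\<close> no coordinate is confined any more.\<close>
  have "liftable \<sigma> (standard_simplex p)" using liftable_slabs[OF assms, of "Suc p"] by auto
  then obtain l where l: "continuous_map (subtopology (powertop_real UNIV) (standard_simplex p)) Y l"
      "\<And>x. x \<in> standard_simplex p \<Longrightarrow> proj (l x) = \<sigma> x"
    unfolding liftable_def by metis
  define \<tau> where "\<tau> = restrict l (standard_simplex p)"
  have "singular_simplex p Y \<tau>"
    unfolding singular_simplex_def \<tau>_def
    using continuous_map_eq[OF l(1)] by auto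
  moreover have "simplex_map p proj \<tau> = \<sigma>"
    using assms l(2) unfolding simplex_map_def \<tau>_def singular_simplex_def
    by (auto simp: fun_eq_iff extensional_def)
  ultimately show ?thesis by (rule that)
qed

theorem simplex_lift_unique:
  assumes "singular_simplex p Y \<tau>" "singular_simplex p Y \<tau>'"
    and "simplex_map p proj \<tau> = simplex_map p proj \<tau>'"
  obtains g where "g \<in> carrier G" "\<tau>' = simplex_map p (act g) \<tau>"
proof -
  let ?Z = "subtopology (powertop_real UNIV) (standard_simplex p)"
  have "proj (\<tau> x) = proj (\<tau>' x)" if "x \<in> standard_simplex p" for x
    using fun_cong[OF assms(3), of x] that by (simp add: simplex_map_def)
  then obtain g where g: "g \<in> carrier G" "\<And>x. x \<in> standard_simplex p \<Longrightarrow> \<tau>' x = act g (\<tau> x)"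
    using lifts_differ_by_act[of ?Z \<tau> \<tau>'] assms(1,2) connectedin_standard_simplex[of p]
    unfolding singular_simplex_def connectedin_def by (auto simp: topspace_standard_simplex)
  then have "\<tau>' = simplex_map p (act g) \<tau>"
    using assms(2) unfolding simplex_map_def singular_simplex_def by (auto simp: fun_eq_iff extensional_def)
  with g that show ?thesis by blast
qed

end

section \<open>Cochains as functions on simplices\<close>

definition pairing :: "('b \<Rightarrow> real) \<Rightarrow> ('b \<Rightarrow>\<^sub>0 int) \<Rightarrow> real" where
  "pairing v c = (\<Sum>\<sigma>\<in>Poly_Mapping.keys c. of_int (Poly_Mapping.lookup c \<sigma>) * v \<sigma>)"

lemma pairing_superset:
  assumes "finite S" "Poly_Mapping.keys c \<subseteq> S"
  shows "pairing v c = (\<Sum>\<sigma>\<in>S. of_int (Poly_Mapping.lookup c \<sigma>) * v \<sigma>)"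
  unfolding pairing_def by (rule sum.mono_neutral_left) (use assms in \<open>auto simp: in_keys_iff\<close>)

lemma pairing_add: "pairing v (c + d) = pairing v c + pairing v d"
  using pairing_superset[of "Poly_Mapping.keys c \<union> Poly_Mapping.keys d" "c + d" v]
    pairing_superset[of "Poly_Mapping.keys c \<union> Poly_Mapping.keys d" c v]
    pairing_superset[of "Poly_Mapping.keys c \<union> Poly_Mapping.keys d" d v] keys_add[of c d]
  by (simp add: lookup_add sum.distrib ring_distribs)

lemma pairing_0 [simp]: "pairing v 0 = 0" by (simp add: pairing_def)

lemma pairing_minus: "pairing v (- c) = - pairing v c"
  using pairing_add[of v c "- c"] by simp

lemma pairing_diff: "pairing v (c - d) = pairing v c - pairing v d"
  using pairing_add[of v c "- d"] by (simp add: pairing_minus)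

lemma pairing_of [simp]: "pairing v (frag_of \<sigma>) = v \<sigma>"
  by (simp add: pairing_def)

lemma pairing_cmul: "pairing v (frag_cmul n c) = of_int n * pairing v c"
  by (subst pairing_superset[of "Poly_Mapping.keys c"])
     (auto simp: pairing_def sum_distrib_left mult.assoc intro: keys_cmul[THEN subsetD])

lemma pairing_sum: "finite I \<Longrightarrow> pairing v (sum f I) = (\<Sum>i\<in>I. pairing v (f i))"
  by (induction I rule: finite_induct) (auto simp: pairing_add)

lemma pairing_cong:
  assumes "\<And>\<sigma>. \<sigma> \<in> Poly_Mapping.keys c \<Longrightarrow> v \<sigma> = w \<sigma>"
  shows "pairing v c = pairing w c"
  using assms by (simp add: pairing_def)

lemma pairing_diff_left: "pairing (\<lambda>\<sigma>. v \<sigma> - w \<sigma>) c = pairing v c - pairing w c"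
  by (simp add: pairing_def sum_subtractf ring_distribs)

lemma pairing_cmul_left: "pairing (\<lambda>\<sigma>. a * v \<sigma>) c = a * pairing v c"
  by (simp add: pairing_def sum_distrib_left mult.left_commute)

lemma pairing_frag_extend: "pairing v (frag_extend f c) = pairing (\<lambda>\<sigma>. pairing v (f \<sigma>)) c"
  unfolding frag_extend_def by (simp add: pairing_sum pairing_cmul) (simp add: pairing_def)

lemma pairing_chain_map: "pairing v (chain_map p h c) = pairing (\<lambda>\<sigma>. v (simplex_map p h \<sigma>)) c"
  by (simp add: chain_map_def pairing_frag_extend)

text \<open>The counterpart of \<open>coboundary\<close> for functions on simplices, free of the
  convention that cochains vanish off the chain group; \<open>coboundary_frag_of\<close> relates the
  two.\<close>

definition cobound :: "nat \<Rightarrow> (((nat \<Rightarrow> real) \<Rightarrow> 'a) \<Rightarrow> real) \<Rightarrow> ((nat \<Rightarrow> real) \<Rightarrow> 'a) \<Rightarrow> real" where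
  "cobound p v \<sigma> = (\<Sum>k\<le>Suc p. (-1) ^ k * v (singular_face (Suc p) k \<sigma>))"

lemma pairing_chain_boundary: "pairing v (chain_boundary (Suc p) c) = pairing (cobound p v) c"
proof -
  have "pairing v (\<Sum>k\<le>Suc p. frag_cmul ((-1) ^ k) (frag_of (singular_face (Suc p) k \<sigma>))) = cobound p v \<sigma>" for \<sigma>
    unfolding cobound_def by (subst pairing_sum) (auto simp: pairing_cmul)
  then show ?thesis by (simp add: chain_boundary_def pairing_frag_extend del: sum.atMost_Suc)
qed

lemma singular_cochain_add:
  assumes "f \<in> singular_cochains p X" "singular_chain p X c" "singular_chain p X d"
  shows "f (c + d) = f c + f d"
  using assms unfolding singular_cochains_def hom_def by auto

lemma singular_cochain_eq_pairing:
  assumes f: "f \<in> singular_cochains p X" and "singular_chain p X c"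
  shows "f c = pairing (\<lambda>\<sigma>. f (frag_of \<sigma>)) c"
proof -
  have "singular_chain p X c \<and> f c = pairing (\<lambda>\<sigma>. f (frag_of \<sigma>)) c"
    using assms(2)[unfolded singular_chain_def]
  proof (induction c rule: frag_induction)
    case zero
    show ?case using singular_cochain_add[OF f, of 0 0] by simp
  next
    case (diff a b)
    then have "f (a - b) + f b = f a"
      using singular_cochain_add[OF f, of "a - b" b] by (simp add: singular_chain_diff)
    then show ?case using diff by (simp add: pairing_diff singular_chain_diff)
  qed (simp add: singular_chain_of)
  then show ?thesis ..
qed

definition cochain_of :: "nat \<Rightarrow> 'a topology \<Rightarrow> (((nat \<Rightarrow> real) \<Rightarrow> 'a) \<Rightarrow> real) \<Rightarrow> 'a chain \<Rightarrow> real" where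
  "cochain_of p X v c = (if singular_chain p X c then pairing v c else 0)"

lemma cochain_of_in_cochains: "cochain_of p X v \<in> singular_cochains p X"
  unfolding singular_cochains_def hom_def
  by (auto simp: cochain_of_def singular_chain_add pairing_add)

lemma singular_cochain_eqI:
  assumes "f \<in> singular_cochains p X" "g \<in> singular_cochains p X"
    and "\<And>\<sigma>. singular_simplex p X \<sigma> \<Longrightarrow> f (frag_of \<sigma>) = g (frag_of \<sigma>)"
  shows "f = g"
proof
  fix c
  show "f c = g c"
  proof (cases "singular_chain p X c")
    case True
    then have "pairing (\<lambda>\<sigma>. f (frag_of \<sigma>)) c = pairing (\<lambda>\<sigma>. g (frag_of \<sigma>)) c"
      using assms(3) by (intro pairing_cong) (auto simp: singular_chain_def)
    then show ?thesis using singular_cochain_eq_pairing assms(1,2) True by metis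
  next
    case False
    then show ?thesis using assms(1,2) by (simp add: singular_cochains_def)
  qed
qed

lemma coboundary_in_cochains:
  assumes f: "f \<in> singular_cochains p X"
  shows "coboundary p X f \<in> singular_cochains (Suc p) X"
proof -
  have "coboundary p X f (c + d) = coboundary p X f c + coboundary p X f d"
    if "singular_chain (Suc p) X c" "singular_chain (Suc p) X d" for c d
    using that singular_cochain_add[OF f singular_chain_boundary_alt[OF that(1)] singular_chain_boundary_alt[OF that(2)]]
    by (simp add: coboundary_def singular_chain_add chain_boundary_add)
  then show ?thesis unfolding singular_cochains_def hom_def by (auto simp: coboundary_def)
qed

lemma coboundary_frag_of:
  assumes f: "f \<in> singular_cochains p X" and "singular_simplex (Suc p) X \<sigma>"
  shows "coboundary p X f (frag_of \<sigma>) = cobound p (\<lambda>\<tau>. f (frag_of \<tau>)) \<sigma>"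
proof -
  have c: "singular_chain (Suc p) X (frag_of \<sigma>)" using assms by (simp add: singular_chain_of)
  then have "coboundary p X f (frag_of \<sigma>) = f (chain_boundary (Suc p) (frag_of \<sigma>))"
    by (simp add: coboundary_def)
  also have "\<dots> = pairing (\<lambda>\<tau>. f (frag_of \<tau>)) (chain_boundary (Suc p) (frag_of \<sigma>))"
    by (rule singular_cochain_eq_pairing[OF f]) (rule singular_chain_boundary_alt[OF c])
  finally show ?thesis by (simp add: pairing_chain_boundary)
qed

lemma singular_face_simplex_map_commute:
  "1 \<le> p \<Longrightarrow> k \<le> p \<Longrightarrow> singular_face p k (simplex_map p h \<sigma>) = simplex_map (p - Suc 0) h (singular_face p k \<sigma>)"
  by (fastforce simp: singular_face_def simplex_map_def simplical_face_in_standard_simplex)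

lemma cobound_simplex_map:
  "cobound p v (simplex_map (Suc p) h \<sigma>) = cobound p (\<lambda>\<tau>. v (simplex_map p h \<tau>)) \<sigma>"
  unfolding cobound_def by (rule sum.cong) (simp_all add: singular_face_simplex_map_commute)

definition vertex :: "nat \<Rightarrow> ((nat \<Rightarrow> real) \<Rightarrow> 'a) \<Rightarrow> 'a" where
  "vertex i \<sigma> = \<sigma> (\<lambda>j. if j = i then 1 else 0)"

definition point_simplex :: "'a \<Rightarrow> (nat \<Rightarrow> real) \<Rightarrow> 'a" where
  "point_simplex x = restrict (\<lambda>_. x) (standard_simplex 0)"

lemma vertex_singular_face:
  assumes "i \<le> p"
  shows "vertex i (singular_face (Suc p) k \<sigma>) = vertex (if i < k then i else Suc i) \<sigma>"
proof -
  have "simplical_face k (\<lambda>j. if j = i then 1 else 0 :: real) = (\<lambda>j. if j = (if i < k then i else Suc i) then 1 else 0)"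
    by (auto simp: simplical_face_def fun_eq_iff)
  then show ?thesis using assms by (simp add: vertex_def singular_face_def)
qed

lemma vertex_simplex_map: "i \<le> p \<Longrightarrow> vertex i (simplex_map p h \<sigma>) = h (vertex i \<sigma>)"
  by (simp add: vertex_def simplex_map_def)

lemma vertex_in_space: "singular_simplex p X \<sigma> \<Longrightarrow> i \<le> p \<Longrightarrow> vertex i \<sigma> \<in> topspace X"
  unfolding vertex_def singular_simplex_def by (auto simp: continuous_map_def)

lemma singular_face_1:
  assumes "k \<le> Suc 0"
  shows "singular_face (Suc 0) k \<sigma> = point_simplex (vertex (if k = 0 then Suc 0 else 0) \<sigma>)"
proof -
  have "simplical_face k (\<lambda>j. if j = 0 then 1 else 0 :: real) = (\<lambda>j. if j = (if k = 0 then Suc 0 else 0) then 1 else 0)"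
    using assms by (auto simp: simplical_face_def fun_eq_iff)
  then show ?thesis by (intro ext) (simp add: singular_face_def point_simplex_def vertex_def standard_simplex_0 restrict_def)
qed

lemma simplex_map_point: "simplex_map 0 h (point_simplex x) = point_simplex (h x)"
  by (auto simp: simplex_map_def point_simplex_def fun_eq_iff)

lemma chain_boundary_1: "chain_boundary 1 (frag_of \<sigma>) = frag_of (point_simplex (vertex 1 \<sigma>)) - frag_of (point_simplex (vertex 0 \<sigma>))"
  by (simp add: chain_boundary_of singular_face_1)

text \<open>The identity is homotopic to a constant map, so the cycle is homologous to its image
  under that map; the image lives on a single point, where cycles of positive degree bound.\<close>

lemma contractible_cycle_is_boundary:
  assumes Y: "contractible_space Y" and "1 \<le> p" and z: "singular_chain p Y z" "chain_boundary p z = 0"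
  obtains w where "singular_chain (Suc p) Y w" "chain_boundary (Suc p) w = z"
proof -
  obtain a where a: "homotopic_with (\<lambda>x. True) Y Y (\<lambda>x. x) (\<lambda>x. a)"
    using Y unfolding contractible_space_def id_def by blast
  have cyc: "singular_relcycle p Y {} z" using z by (simp add: singular_cycle)
  have "homologous_rel p Y {} (chain_map p (\<lambda>x. x) z) (chain_map p (\<lambda>x. a) z)"
    by (rule homotopic_imp_homologous_rel_chain_maps[OF _ cyc]) (use a in auto)
  moreover have "chain_map p (\<lambda>x. x) z = z" using chain_map_ident[OF z(1), unfolded id_def] .
  moreover have "singular_relboundary p Y {} (chain_map p (\<lambda>x. a) z)"
  proof (cases "a \<in> topspace Y")
    case True
    have "continuous_map Y (subtopology Y {a}) (\<lambda>x. a)"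
      using True by (auto simp: continuous_map_in_subtopology)
    then have "singular_relcycle p (subtopology Y {a}) {} (chain_map p (\<lambda>x. a) z)"
      by (rule singular_relcycle_chain_map[OF cyc]) auto
    then have "singular_relboundary p (subtopology Y {a}) {} (chain_map p (\<lambda>x. a) z)"
      using singular_boundary_eq_cycle_singleton[of "subtopology Y {a}" a p] True \<open>1 \<le> p\<close> by auto
    then show ?thesis using singular_boundary_mono[where p = p and X = Y and T = "{a}" and S = UNIV] by auto
  next
    \<comment> \<open>A constant map can take its value outside \<open>Y\<close> only if
      \<open>Y\<close> is empty, and then the cycle is 0.\<close>
    case False
    then have "topspace Y = {}"
      using homotopic_with_imp_continuous_maps[OF a] by (auto simp: continuous_map_def)
    then have "z = 0" using z(1) by (simp add: singular_chain_empty)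
    then show ?thesis by simp
  qed
  ultimately have "singular_relboundary p Y {} z"
    unfolding homologous_rel_def using singular_relboundary_add[of p Y "{}" "z - chain_map p (\<lambda>x. a) z" "chain_map p (\<lambda>x. a) z"]
    by simp
  then show ?thesis using that by (auto simp: singular_boundary)
qed

lemma path_connected_simplex:
  assumes "path_connected_space Y" "x \<in> topspace Y" "y \<in> topspace Y"
  obtains \<sigma> where "singular_simplex 1 Y \<sigma>" "vertex 0 \<sigma> = x" "vertex 1 \<sigma> = y"
proof -
  obtain g where g: "pathin Y g" "g 0 = x" "g 1 = y"
    using assms unfolding path_connected_space_def by blast
  define \<sigma> where "\<sigma> = restrict (\<lambda>u. g (u 1)) (standard_simplex 1)"
  have "continuous_map (subtopology (powertop_real UNIV) (standard_simplex 1)) (top_of_set {0..1}) (\<lambda>u. u 1)"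
    unfolding continuous_map_in_subtopology
    by (intro conjI continuous_map_from_subtopology continuous_map_product_projection)
       (auto simp: standard_simplex_def)
  then have "continuous_map (subtopology (powertop_real UNIV) (standard_simplex 1)) Y (g \<circ> (\<lambda>u. u 1))"
    using g(1) unfolding pathin_def by (rule continuous_map_compose)
  then have "singular_simplex 1 Y \<sigma>"
    unfolding singular_simplex_def \<sigma>_def using continuous_map_eq by fastforce
  then show ?thesis
    by (rule that) (use g in \<open>simp_all add: vertex_def \<sigma>_def del: One_nat_def\<close>)
qed

section \<open>Second cohomology of a quotient of a contractible space\<close>

text \<open>Degrees are written with \<open>Suc\<close> so that rules stated for
  \<open>Suc p\<close> match them directly.\<close>

abbreviation (input) d1 :: nat where "d1 \<equiv> Suc 0"
abbreviation (input) d2 :: nat where "d2 \<equiv> Suc (Suc 0)"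
abbreviation (input) d3 :: nat where "d3 \<equiv> Suc (Suc (Suc 0))"
abbreviation (input) pt :: "'a \<Rightarrow> 'a chain" where "pt x \<equiv> frag_of (point_simplex x)"

lemma chain_boundary_1': "chain_boundary d1 (frag_of \<sigma>) = pt (vertex d1 \<sigma>) - pt (vertex 0 \<sigma>)"
  using chain_boundary_1 by simp

lemma chain_boundary_2: "chain_boundary d2 (frag_of \<tau>)
   = frag_of (singular_face d2 0 \<tau>) - frag_of (singular_face d2 d1 \<tau>) + frag_of (singular_face d2 d2 \<tau>)"
  by (simp add: chain_boundary_of)

lemma cobound_1: "cobound d1 v \<tau> = v (singular_face d2 0 \<tau>) - v (singular_face d2 d1 \<tau>) + v (singular_face d2 d2 \<tau>)"
  by (simp add: cobound_def)

locale contractible_covering_action = covering_action G Y act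
  for G :: "('g, 'm) monoid_scheme" (structure) and Y :: "'a topology" and act +
  fixes y0 :: 'a
  assumes contractible: "contractible_space Y" and y0: "y0 \<in> topspace Y"
begin

abbreviation ac :: "nat \<Rightarrow> 'g \<Rightarrow> 'a chain \<Rightarrow> 'a chain" where "ac p g \<equiv> chain_map p (act g)"

lemma chain_act: "g \<in> carrier G \<Longrightarrow> singular_chain p Y c \<Longrightarrow> singular_chain p Y (ac p g c)"
  using singular_chain_chain_map act_continuous by blast

lemma chain_act_mult:
  assumes "g \<in> carrier G" "h \<in> carrier G" "singular_chain p Y c"
  shows "ac p (g \<otimes> h) c = ac p g (ac p h c)"
proof -
  have "ac p (g \<otimes> h) c = chain_map p (act g \<circ> act h) c"
    by (rule chain_map_eq[OF assms(3)]) (use assms act_mult in simp)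
  then show ?thesis by (simp add: chain_map_compose)
qed

lemma chain_act_one: "singular_chain p Y c \<Longrightarrow> ac p \<one> c = c"
  using chain_map_id_gen act_one by blast

lemma boundary_act: "singular_chain (Suc p) Y c \<Longrightarrow> chain_boundary (Suc p) (ac (Suc p) g c) = ac p g (chain_boundary (Suc p) c)"
  using chain_boundary_chain_map by force

lemma ac_pt: "ac 0 g (pt x) = pt (act g x)"
  by (simp add: simplex_map_point)

text \<open>An arbitrary 1-chain from the base point to \<open>x\<close>, chosen without any
  equivariance. Only its boundary is ever used; in particular \<open>path y0\<close> is a cycle but
  may be nonzero.\<close>

definition path :: "'a \<Rightarrow> 'a chain" where
  "path x = (SOME c. singular_chain d1 Y c \<and> chain_boundary d1 c = pt x - pt y0)"

lemma path:
  assumes "x \<in> topspace Y"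
  shows "singular_chain d1 Y (path x)" "chain_boundary d1 (path x) = pt x - pt y0"
proof -
  obtain \<sigma> where \<sigma>: "singular_simplex 1 Y \<sigma>" "vertex 0 \<sigma> = y0" "vertex 1 \<sigma> = x"
    using path_connected_simplex[OF contractible_imp_path_connected_space[OF contractible] y0 assms] .
  then have "singular_chain d1 Y (frag_of \<sigma>) \<and> chain_boundary d1 (frag_of \<sigma>) = pt x - pt y0"
    by (simp add: singular_chain_of chain_boundary_1')
  then have "singular_chain d1 Y (path x) \<and> chain_boundary d1 (path x) = pt x - pt y0"
    unfolding path_def by (rule someI)
  then show "singular_chain d1 Y (path x)" "chain_boundary d1 (path x) = pt x - pt y0" by auto
qed

definition filling :: "'a chain \<Rightarrow> 'a chain" where
  "filling z = (SOME w. singular_chain d2 Y w \<and> chain_boundary d2 w = z)"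

lemma filling:
  assumes "singular_chain d1 Y z" "chain_boundary d1 z = 0"
  shows "singular_chain d2 Y (filling z)" "chain_boundary d2 (filling z) = z"
proof -
  obtain w where "singular_chain d2 Y w" "chain_boundary d2 w = z"
    using contractible_cycle_is_boundary[OF contractible _ assms] by auto
  then have "singular_chain d2 Y w \<and> chain_boundary d2 w = z" by blast
  then have "singular_chain d2 Y (filling z) \<and> chain_boundary d2 (filling z) = z"
    unfolding filling_def by (rule someI)
  then show "singular_chain d2 Y (filling z)" "chain_boundary d2 (filling z) = z" by auto
qed

text \<open>For commuting \<open>g\<close> and \<open>h\<close> this \<open>2\<close>-chain projects to the torus spanned by the loops of \<open>g\<close>
  and \<open>h\<close>.\<close>

definition torus :: "'g \<Rightarrow> 'g \<Rightarrow> 'a chain" where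
  "torus g h = filling ((ac d1 g (path (act h y0)) - path (act h y0)) - (ac d1 h (path (act g y0)) - path (act g y0)))"

text \<open>The prescribed boundary is a cycle because commuting \<open>g\<close> and
  \<open>h\<close> give the two translated paths the same end point.\<close>

lemma torus:
  assumes "g \<in> carrier G" "h \<in> carrier G" "g \<otimes> h = h \<otimes> g"
  shows "singular_chain d2 Y (torus g h)"
    and "chain_boundary d2 (torus g h) =
      (ac d1 g (path (act h y0)) - path (act h y0)) - (ac d1 h (path (act g y0)) - path (act g y0))"
proof -
  let ?z = "(ac d1 g (path (act h y0)) - path (act h y0)) - (ac d1 h (path (act g y0)) - path (act g y0))"
  have Y: "act g y0 \<in> topspace Y" "act h y0 \<in> topspace Y" using assms act_closed y0 by auto
  have "act g (act h y0) = act h (act g y0)"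
    using act_mult[of g h y0] act_mult[of h g y0] assms y0 by simp
  then have "chain_boundary d1 ?z = 0"
    using assms Y by (simp add: chain_boundary_diff boundary_act path chain_map_diff ac_pt del: chain_map_of)
  moreover have "singular_chain d1 Y ?z"
    using assms Y by (intro singular_chain_diff chain_act path)
  ultimately show "singular_chain d2 Y (torus g h)" "chain_boundary d2 (torus g h) = ?z"
    unfolding torus_def by (rule filling[rotated])+
qed

definition pullback :: "('a set chain \<Rightarrow> real) \<Rightarrow> nat \<Rightarrow> ((nat \<Rightarrow> real) \<Rightarrow> 'a) \<Rightarrow> real" where
  "pullback f p \<tau> = f (frag_of (simplex_map p proj \<tau>))"

lemma simplex_map_proj_act:
  assumes "g \<in> carrier G" "singular_simplex p Y \<tau>"
  shows "simplex_map p proj (simplex_map p (act g) \<tau>) = simplex_map p proj \<tau>"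
proof -
  have "simplex_map p proj (simplex_map p (act g) \<tau>) = simplex_map p (proj \<circ> act g) \<tau>"
    by (simp add: simplex_map_compose)
  also have "\<dots> = simplex_map p proj \<tau>"
    by (rule simplex_map_eq[OF assms(2)]) (use proj_act assms in simp)
  finally show ?thesis .
qed

lemma pullback_act:
  assumes "g \<in> carrier G" "singular_chain p Y c"
  shows "pairing (pullback f p) (ac p g c) = pairing (pullback f p) c"
  unfolding pairing_chain_map
  by (rule pairing_cong) (use assms in \<open>auto simp: pullback_def simplex_map_proj_act singular_chain_def subset_iff\<close>)

lemma simplex_proj: "singular_simplex p Y \<tau> \<Longrightarrow> singular_simplex p X (simplex_map p proj \<tau>)"
  using singular_simplex_simplex_map continuous_proj by blast

lemma cobound_pullback:
  assumes "f \<in> singular_cochains p X" "singular_simplex (Suc p) Y \<tau>"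
  shows "cobound p (pullback f p) \<tau> = coboundary p X f (frag_of (simplex_map (Suc p) proj \<tau>))"
  using coboundary_frag_of[OF assms(1) simplex_proj[OF assms(2)]]
  by (simp add: cobound_simplex_map pullback_def[abs_def])

text \<open>The boundary of the torus chain consists of differences of a chain and its translate,
  and a pulled back 1-cochain is invariant under the group.\<close>

lemma torus_coboundary:
  assumes "f \<in> singular_cochains d1 X" "g \<in> carrier G" "h \<in> carrier G" "g \<otimes> h = h \<otimes> g"
  shows "pairing (pullback (coboundary d1 X f) d2) (torus g h) = 0"
proof -
  have Y: "act g y0 \<in> topspace Y" "act h y0 \<in> topspace Y" using assms act_closed y0 by auto
  have "pairing (pullback (coboundary d1 X f) d2) (torus g h) = pairing (cobound d1 (pullback f d1)) (torus g h)"
    by (rule pairing_cong)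
       (use torus(1)[OF assms(2-)] cobound_pullback[OF assms(1)] in \<open>auto simp: pullback_def singular_chain_def subset_iff\<close>)
  also have "\<dots> = pairing (pullback f d1) (chain_boundary d2 (torus g h))"
    by (simp add: pairing_chain_boundary)
  also have "\<dots> = 0"
    by (simp add: torus(2)[OF assms(2-)] pairing_diff pullback_act assms path Y)
  finally show ?thesis .
qed

section \<open>The group cocycle attached to a singular 2-cocycle\<close>

context
  fixes f assumes f: "f \<in> singular_cocycles d2 X"
begin

lemma f_cochain: "f \<in> singular_cochains d2 X" and f_closed: "coboundary d2 X f = (\<lambda>c. 0)"
  using f by (auto simp: singular_cocycles_def)

abbreviation F where "F \<equiv> pullback f d2"

lemma F_boundary: "singular_chain d3 Y w \<Longrightarrow> pairing F (chain_boundary d3 w) = 0"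
proof -
  assume "singular_chain d3 Y w"
  then have "pairing (cobound d2 F) w = pairing (\<lambda>_. 0) w"
    using cobound_pullback[OF f_cochain] f_closed by (intro pairing_cong) (auto simp: singular_chain_def)
  also have "\<dots> = 0" by (simp add: pairing_def)
  finally show ?thesis by (simp add: pairing_chain_boundary)
qed

lemma F_cycle: "singular_chain d2 Y z \<Longrightarrow> chain_boundary d2 z = 0 \<Longrightarrow> pairing F z = 0"
  using contractible_cycle_is_boundary[OF contractible, of d2 z] F_boundary by auto

definition cyc :: "((nat \<Rightarrow> real) \<Rightarrow> 'a) \<Rightarrow> 'a chain" where
  "cyc \<sigma> = frag_of \<sigma> - path (vertex d1 \<sigma>) + path (vertex 0 \<sigma>)"

text \<open>A primitive of the pulled back cocycle: each edge is closed up through the base point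
  and filled. The choice of filling is immaterial by \<open>F_cycle\<close>.\<close>

definition prim :: "((nat \<Rightarrow> real) \<Rightarrow> 'a) \<Rightarrow> real" where
  "prim \<sigma> = pairing F (filling (cyc \<sigma>))"

lemma cyc:
  assumes "singular_simplex d1 Y \<sigma>"
  shows "singular_chain d1 Y (cyc \<sigma>)" "chain_boundary d1 (cyc \<sigma>) = 0"
proof -
  have v: "vertex 0 \<sigma> \<in> topspace Y" "vertex d1 \<sigma> \<in> topspace Y"
    using vertex_in_space[OF assms] by auto
  then show "singular_chain d1 Y (cyc \<sigma>)"
    unfolding cyc_def using assms by (intro singular_chain_add singular_chain_diff path) (auto simp: singular_chain_of)
  show "chain_boundary d1 (cyc \<sigma>) = 0"
    unfolding cyc_def using v by (simp add: chain_boundary_add chain_boundary_diff chain_boundary_1' path)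
qed

text \<open>The fillings of the three closed-up faces, taken with signs, and the simplex itself have
  the same boundary, because the auxiliary paths cancel at each vertex; on the resulting 2-cycle
  \<open>F\<close> vanishes.\<close>

lemma cobound_prim:
  assumes \<tau>: "singular_simplex d2 Y \<tau>"
  shows "cobound d1 prim \<tau> = F \<tau>"
proof -
  have face: "singular_simplex d1 Y (singular_face d2 k \<tau>)" if "k \<le> d2" for k
    using singular_simplex_singular_face[OF \<tau> _ that] by simp
  let ?w = "\<lambda>k. filling (cyc (singular_face d2 k \<tau>))"
  have w: "singular_chain d2 Y (?w k)" "chain_boundary d2 (?w k) = cyc (singular_face d2 k \<tau>)" if "k \<le> d2" for k
    using filling cyc[OF face[OF that]] by auto
  let ?Z = "?w 0 - ?w d1 + ?w d2 - frag_of \<tau>"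
  have "singular_chain d2 Y ?Z"
    using w \<tau> by (intro singular_chain_add singular_chain_diff) (auto simp: singular_chain_of)
  moreover have "chain_boundary d2 ?Z = 0"
    unfolding chain_boundary_add chain_boundary_diff w(2)[OF le0] w(2)[OF le_SucI[OF order_refl]] w(2)[OF order_refl] chain_boundary_2
    by (simp add: cyc_def vertex_singular_face)
  ultimately have "pairing F ?Z = 0" by (rule F_cycle)
  then show ?thesis by (simp add: cobound_1 prim_def pairing_diff pairing_add)
qed

lemma prim_boundary: "singular_chain d2 Y u \<Longrightarrow> pairing prim (chain_boundary d2 u) = pairing F u"
  unfolding pairing_chain_boundary by (rule pairing_cong) (auto simp: singular_chain_def subset_iff cobound_prim)

lemma prim_cycle_act:
  assumes "singular_chain d1 Y z" "chain_boundary d1 z = 0" "g \<in> carrier G"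
  shows "pairing prim (ac d1 g z) = pairing prim z"
proof -
  note u = filling[OF assms(1,2)]
  have "pairing prim (ac d1 g z) = pairing prim (chain_boundary d2 (ac d2 g (filling z)))"
    using boundary_act[OF u(1)] u(2) by simp
  also have "\<dots> = pairing F (filling z)"
    using prim_boundary[OF chain_act[OF assms(3) u(1)]] pullback_act[OF assms(3) u(1)] by simp
  also have "\<dots> = pairing prim z" using prim_boundary[OF u(1)] u(2) by simp
  finally show ?thesis .
qed

text \<open>Translating \<open>prim\<close> by \<open>g\<close> changes it by a closed cochain,
  hence by the coboundary of a function of the end points. This is that function; it vanishes at
  \<open>y0\<close>.\<close>

definition defect :: "'g \<Rightarrow> 'a \<Rightarrow> real" where
  "defect g x = pairing prim (ac d1 g (path x)) - pairing prim (path x)"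

lemma prim_act:
  assumes z: "singular_chain d1 Y z" "chain_boundary d1 z = pt x - pt y" and g: "g \<in> carrier G"
    and x: "x \<in> topspace Y" "y \<in> topspace Y"
  shows "pairing prim (ac d1 g z) - pairing prim z = defect g x - defect g y"
proof -
  have "pairing prim (ac d1 g (z - path x + path y)) = pairing prim (z - path x + path y)"
    using z g x by (intro prim_cycle_act singular_chain_add singular_chain_diff)
      (auto simp: path chain_boundary_add chain_boundary_diff)
  then show ?thesis by (simp add: chain_map_add chain_map_diff pairing_add pairing_diff defect_def)
qed

lemma defect_y0: "g \<in> carrier G \<Longrightarrow> defect g y0 = 0"
  using prim_cycle_act[OF path(1)[OF y0]] path(2)[OF y0] by (simp add: defect_def)

lemma defect_one: "x \<in> topspace Y \<Longrightarrow> defect \<one> x = 0"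
  by (simp add: defect_def chain_act_one path)

text \<open>A crossed homomorphism with values in functions on \<open>Y\<close>, except for the
  constant \<open>defect g (act h y0)\<close>; this constant is, up to sign, the group 2-cocycle of
  \<open>f\<close>.\<close>

lemma defect_mult:
  assumes "g \<in> carrier G" "h \<in> carrier G" "x \<in> topspace Y"
  shows "defect (g \<otimes> h) x = defect g (act h x) - defect g (act h y0) + defect h x"
proof -
  have "chain_boundary d1 (ac d1 h (path x)) = pt (act h x) - pt (act h y0)"
    using assms by (simp add: boundary_act path chain_map_diff ac_pt del: chain_map_of)
  then have "pairing prim (ac d1 g (ac d1 h (path x))) - pairing prim (ac d1 h (path x))
      = defect g (act h x) - defect g (act h y0)"
    using assms y0 by (intro prim_act) (auto simp: chain_act path act_closed)
  then show ?thesis using assms by (simp add: defect_def chain_act_mult path)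
qed

text \<open>Evaluation on a torus is thus, up to sign, the antisymmetrised group cocycle, which
  links the topological functionals to symmetry on generators.\<close>

lemma pairing_torus:
  assumes "g \<in> carrier G" "h \<in> carrier G" "g \<otimes> h = h \<otimes> g"
  shows "pairing F (torus g h) = defect g (act h y0) - defect h (act g y0)"
proof -
  have "pairing F (torus g h) = pairing prim (chain_boundary d2 (torus g h))"
    using prim_boundary[OF torus(1)[OF assms]] by simp
  then show ?thesis by (simp add: torus(2)[OF assms] pairing_diff defect_def)
qed

text \<open>If the group cocycle of \<open>f\<close> is trivial, \<open>defect\<close> can be corrected to a crossed homomorphism; since
  the action is free, it is the coboundary of a function \<open>m\<close> on \<open>Y\<close>, and \<open>prim - \<delta>m\<close> is
  invariant, hence descends to \<open>X\<close>.\<close>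

lemma cocycle_is_coboundary:
  assumes \<gamma>: "\<And>g h. g \<in> carrier G \<Longrightarrow> h \<in> carrier G \<Longrightarrow> - defect g (act h y0) = \<gamma> (g \<otimes> h) - \<gamma> g - \<gamma> h"
  shows "f \<in> coboundary d1 X ` singular_cochains d1 X"
proof -
  define k' where "k' g x = defect g x - \<gamma> g" for g x
  have k': "k' (g \<otimes> h) x = k' g (act h x) + k' h x" if "g \<in> carrier G" "h \<in> carrier G" "x \<in> topspace Y" for g h x
    using defect_mult[OF that] \<gamma>[OF that(1,2)] by (simp add: k'_def)
  \<comment> \<open>A representative of the orbit; the defining predicate mentions only
    \<open>proj x\<close>, so \<open>r\<close> is constant on orbits.\<close>
  define r where "r x = (SOME y. y \<in> topspace Y \<and> proj y = proj x)" for x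
  have r: "r x \<in> topspace Y" "proj (r x) = proj x" if "x \<in> topspace Y" for x
    using someI[of "\<lambda>y. y \<in> topspace Y \<and> proj y = proj x" x] that unfolding r_def by auto
  define d where "d x = (SOME g. g \<in> carrier G \<and> x = act g (r x))" for x
  have d: "d x \<in> carrier G" "x = act (d x) (r x)" if x: "x \<in> topspace Y" for x
  proof -
    obtain g where "g \<in> carrier G \<and> x = act g (r x)"
      using proj_eq_iff[of "r x" x] r[OF x] x by metis
    then have "d x \<in> carrier G \<and> x = act (d x) (r x)" unfolding d_def by (rule someI)
    then show "d x \<in> carrier G" "x = act (d x) (r x)" by auto
  qed
  \<comment> \<open>The crossed homomorphism rule dictates how \<open>m\<close> changes along an
    orbit; freeness makes the element \<open>d x\<close> leading from the representative to
    \<open>x\<close> unique.\<close>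
  define m where "m x = k' (d x) (r x)" for x
  have m: "m (act g x) = k' g x + m x" if g: "g \<in> carrier G" and x: "x \<in> topspace Y" for g x
  proof -
    have "r (act g x) = r x" unfolding r_def using proj_act[OF g x] by simp
    moreover have "d (act g x) = g \<otimes> d x"
    proof (rule act_inj[of _ _ "r x"])
      have "act (d (act g x)) (r (act g x)) = act g x" using d(2)[OF act_closed[OF g x]] by simp
      also have "\<dots> = act g (act (d x) (r x))" using d(2)[OF x] by simp
      also have "\<dots> = act (g \<otimes> d x) (r x)" using act_mult d(1)[OF x] r(1)[OF x] g by simp
      finally show "act (d (act g x)) (r x) = act (g \<otimes> d x) (r x)" using \<open>r (act g x) = r x\<close> by simp
    qed (use d r g x act_closed in auto)
    ultimately show ?thesis using k'[OF g d(1)[OF x] r(1)[OF x]] d(2)[OF x] by (simp add: m_def)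
  qed
  define q where "q \<sigma> = prim \<sigma> - (m (vertex d1 \<sigma>) - m (vertex 0 \<sigma>))" for \<sigma>
  have q_act: "q (simplex_map d1 (act g) \<sigma>) = q \<sigma>" if g: "g \<in> carrier G" and \<sigma>: "singular_simplex d1 Y \<sigma>" for g \<sigma>
  proof -
    have v: "vertex 0 \<sigma> \<in> topspace Y" "vertex d1 \<sigma> \<in> topspace Y" using vertex_in_space[OF \<sigma>] by auto
    have "prim (simplex_map d1 (act g) \<sigma>) - prim \<sigma> = defect g (vertex d1 \<sigma>) - defect g (vertex 0 \<sigma>)"
      using prim_act[of "frag_of \<sigma>" "vertex d1 \<sigma>" "vertex 0 \<sigma>" g] v g \<sigma>
      by (simp add: singular_chain_of chain_boundary_1')
    then show ?thesis using m[OF g v(1)] m[OF g v(2)] by (simp add: q_def vertex_simplex_map k'_def)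
  qed
  \<comment> \<open>The lift of an edge is arbitrary: two lifts are translates of each other, and
    \<open>q\<close> is invariant.\<close>
  define lift where "lift \<rho> = (SOME \<tau>. singular_simplex d1 Y \<tau> \<and> simplex_map d1 proj \<tau> = \<rho>)" for \<rho>
  define u where "u = cochain_of d1 X (\<lambda>\<rho>. q (lift \<rho>))"
  have u: "u \<in> singular_cochains d1 X" unfolding u_def by (rule cochain_of_in_cochains)
  have u_proj: "u (frag_of (simplex_map d1 proj \<sigma>)) = q \<sigma>" if \<sigma>: "singular_simplex d1 Y \<sigma>" for \<sigma>
  proof -
    have "singular_simplex d1 Y (lift (simplex_map d1 proj \<sigma>)) \<and>
        simplex_map d1 proj (lift (simplex_map d1 proj \<sigma>)) = simplex_map d1 proj \<sigma>"
      unfolding lift_def by (rule someI[of _ \<sigma>]) (use \<sigma> in simp)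
    then obtain g where "g \<in> carrier G" "lift (simplex_map d1 proj \<sigma>) = simplex_map d1 (act g) \<sigma>"
      using simplex_lift_unique[OF \<sigma>, of "lift (simplex_map d1 proj \<sigma>)"] by metis
    then show ?thesis
      using q_act \<sigma> simplex_proj[OF \<sigma>] by (simp add: u_def cochain_of_def singular_chain_of)
  qed
  have "coboundary d1 X u = f"
  proof (rule singular_cochain_eqI[OF coboundary_in_cochains[OF u] f_cochain])
    fix \<rho> assume "singular_simplex d2 X \<rho>"
    then obtain \<tau> where \<tau>: "singular_simplex d2 Y \<tau>" "simplex_map d2 proj \<tau> = \<rho>" by (rule simplex_lift)
    have face: "singular_simplex d1 Y (singular_face d2 i \<tau>)" if "i \<le> d2" for i
      using singular_simplex_singular_face[OF \<tau>(1) _ that] by simp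
    have "coboundary d1 X u (frag_of \<rho>) = cobound d1 (pullback u d1) \<tau>"
      using cobound_pullback[OF u \<tau>(1)] \<tau>(2) by simp
    also have "\<dots> = cobound d1 q \<tau>"
      using u_proj face by (simp add: cobound_1 pullback_def)
    also have "\<dots> = cobound d1 prim \<tau>" by (simp add: cobound_1 q_def vertex_singular_face)
    also have "\<dots> = f (frag_of \<rho>)" using cobound_prim[OF \<tau>(1)] \<tau>(2) by (simp add: pullback_def)
    finally show "coboundary d1 X u (frag_of \<rho>) = f (frag_of \<rho>)" .
  qed
  then show ?thesis using u by blast
qed

end

end

section \<open>Dimension of cohomology from a dual system of functionals\<close>

lemma singular_cochains_linear:
  assumes "f \<in> singular_cochains p X" "g \<in> singular_cochains p X"
  shows "(\<lambda>c. f c + g c) \<in> singular_cochains p X" "(\<lambda>c. r * f c) \<in> singular_cochains p X"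
  using assms by (auto simp: singular_cochains_def hom_def algebra_simps)

lemma coboundary_linear:
  "coboundary p X (\<lambda>c. f c + g c) = (\<lambda>c. coboundary p X f c + coboundary p X g c)"
  "coboundary p X (\<lambda>c. r * f c) = (\<lambda>c. r * coboundary p X f c)"
  by (auto simp: coboundary_def)

lemma singular_cocycles_linear:
  assumes "f \<in> singular_cocycles p X" "g \<in> singular_cocycles p X"
  shows "(\<lambda>c. f c + g c) \<in> singular_cocycles p X" "(\<lambda>c. r * f c) \<in> singular_cocycles p X"
  using assms by (auto simp: singular_cocycles_def singular_cochains_linear coboundary_linear)

lemma zero_cochain: "(\<lambda>c. 0) \<in> singular_cochains p X"
  by (auto simp: singular_cochains_def hom_def)

lemma zero_cocycle: "(\<lambda>c. 0) \<in> singular_cocycles p X"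
  by (auto simp: singular_cocycles_def zero_cochain coboundary_def)

lemma singular_coboundaries_linear:
  assumes "f \<in> singular_coboundaries p X" "g \<in> singular_coboundaries p X"
  shows "(\<lambda>c. f c + g c) \<in> singular_coboundaries p X" "(\<lambda>c. r * f c) \<in> singular_coboundaries p X"
proof -
  show "(\<lambda>c. f c + g c) \<in> singular_coboundaries p X"
  proof (cases p)
    case (Suc q)
    then obtain a b where "a \<in> singular_cochains q X" "f = coboundary q X a"
      "b \<in> singular_cochains q X" "g = coboundary q X b" using assms by auto
    then show ?thesis
      using Suc singular_cochains_linear(1)[of a q X b] coboundary_linear(1)[of q X a b]
      by (auto intro!: image_eqI[of _ _ "\<lambda>c. a c + b c"])
  qed (use assms in auto)
  show "(\<lambda>c. r * f c) \<in> singular_coboundaries p X"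
  proof (cases p)
    case (Suc q)
    then obtain a where "a \<in> singular_cochains q X" "f = coboundary q X a" using assms by auto
    then show ?thesis
      using Suc singular_cochains_linear(2)[of a q X a r] coboundary_linear(2)[of q X r a]
      by (auto intro!: image_eqI[of _ _ "\<lambda>c. r * a c"])
  qed (use assms in auto)
qed

lemma zero_coboundary: "(\<lambda>c. 0) \<in> singular_coboundaries p X"
proof (cases p)
  case (Suc q)
  have "coboundary q X (\<lambda>c. 0) = (\<lambda>c. 0)" by (auto simp: coboundary_def)
  then show ?thesis using Suc zero_cochain[of q X] by (force intro: image_eqI[of _ _ "\<lambda>c. 0"])
qed simp

text \<open>Linear functionals that vanish on coboundaries and jointly detect exactness embed the
  cohomology into \<real>\<open>^N\<close>; a dual family of cocycles makes this onto. The proof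
  uses the inverse map, from coordinate vectors to classes.\<close>

theorem real_cohomology_dim:
  fixes \<phi> :: "nat \<Rightarrow> 'a chain \<Rightarrow> real" and \<Phi> :: "nat \<Rightarrow> ('a chain \<Rightarrow> real) \<Rightarrow> real"
  assumes \<phi>: "\<And>i. i < N \<Longrightarrow> \<phi> i \<in> singular_cocycles p X"
    and \<Phi>_add: "\<And>i f g. i < N \<Longrightarrow> \<Phi> i (\<lambda>c. f c + g c) = \<Phi> i f + \<Phi> i g"
    and \<Phi>_scale: "\<And>i r f. i < N \<Longrightarrow> \<Phi> i (\<lambda>c. r * f c) = r * \<Phi> i f"
    and dual: "\<And>i j. i < N \<Longrightarrow> j < N \<Longrightarrow> \<Phi> i (\<phi> j) = (if i = j then 1 else 0)"
    and bound: "\<And>i f. i < N \<Longrightarrow> f \<in> singular_coboundaries p X \<Longrightarrow> \<Phi> i f = 0"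
    and exact: "\<And>f. f \<in> singular_cocycles p X \<Longrightarrow> (\<And>i. i < N \<Longrightarrow> \<Phi> i f = 0) \<Longrightarrow> f \<in> singular_coboundaries p X"
  shows "vectorspace.fin_dim class_ring (real_cohomology p X) \<and>
         vectorspace.dim class_ring (real_cohomology p X) = N"
proof -
  let ?Z = "singular_cocycles p X" and ?B = "singular_coboundaries p X"
  define M where "M = (cochain_module p X)\<lparr>carrier := ?Z\<rparr>"
  have addM: "add M = (\<lambda>f g c. f c + g c)" and smultM: "smult M = (\<lambda>r f c. r * f c)"
    by (simp_all add: M_def cochain_module_def)
  let ?H = "real_cohomology p X"
  define cos where "cos x = (\<lambda>b c. b c + x c) ` ?B" for x :: "'a chain \<Rightarrow> real"
  have cos: "?B +>\<^bsub>M\<^esub> x = cos x" for x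
    unfolding a_r_coset_def' cos_def addM by auto
  have H: "?H = quotient_module M ?B" by (simp add: real_cohomology_def M_def)
  have carH: "carrier ?H = cos ` ?Z"
    unfolding H quotient_module_def A_RCOSETS_def' cos by (auto simp: M_def)
  have self: "x \<in> cos x" for x
    unfolding cos_def by (rule image_eqI[OF _ zero_coboundary]) simp
  have cos_eq: "cos x = cos y \<longleftrightarrow> (\<lambda>c. x c - y c) \<in> ?B" for x y
  proof
    assume "cos x = cos y"
    then obtain b where "b \<in> ?B" "x = (\<lambda>c. b c + y c)" using self[of x] by (auto simp: cos_def)
    then show "(\<lambda>c. x c - y c) \<in> ?B" by simp
  next
    assume xy: "(\<lambda>c. x c - y c) \<in> ?B"
    have *: "cos x \<subseteq> cos y" if "(\<lambda>c. x c - y c) \<in> ?B" for x y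
    proof
      fix z assume "z \<in> cos x"
      then obtain b where b: "b \<in> ?B" "z = (\<lambda>c. b c + x c)" by (auto simp: cos_def)
      have "z = (\<lambda>c. (b c + (x c - y c)) + y c)" using b by auto
      moreover have "(\<lambda>c. b c + (x c - y c)) \<in> ?B" by (rule singular_coboundaries_linear(1)[OF b(1) that])
      ultimately show "z \<in> cos y" unfolding cos_def by (intro image_eqI)
    qed
    have "(\<lambda>c. y c - x c) \<in> ?B"
      using singular_coboundaries_linear(2)[OF xy xy, of "-1"] by simp
    then show "cos x = cos y" using *[OF xy] * by blast
  qed
  have addH: "cos x \<oplus>\<^bsub>?H\<^esub> cos y = cos (\<lambda>c. x c + y c)" for x y
  proof -
    have "cos x \<oplus>\<^bsub>?H\<^esub> cos y = (\<Union>h\<in>cos x. \<Union>k\<in>cos y. {\<lambda>c. h c + k c})"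
      by (simp add: H quotient_module_def set_add_def' addM)
    also have "\<dots> = cos (\<lambda>c. x c + y c)"
    proof (intro subset_antisym subsetI)
      fix z assume "z \<in> (\<Union>h\<in>cos x. \<Union>k\<in>cos y. {\<lambda>c. h c + k c})"
      then obtain a b where ab: "a \<in> ?B" "b \<in> ?B" "z = (\<lambda>c. (a c + x c) + (b c + y c))"
        by (auto simp: cos_def)
      then have "z = (\<lambda>c. (a c + b c) + (x c + y c))" by auto
      then show "z \<in> cos (\<lambda>c. x c + y c)"
        unfolding cos_def using singular_coboundaries_linear(1)[OF ab(1,2)] by (intro image_eqI)
    next
      fix z assume "z \<in> cos (\<lambda>c. x c + y c)"
      then obtain b where b: "b \<in> ?B" "z = (\<lambda>c. b c + (x c + y c))" by (auto simp: cos_def)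
      then have "(\<lambda>c. b c + x c) \<in> cos x" "z = (\<lambda>c. (b c + x c) + y c)" by (auto simp: cos_def)
      then show "z \<in> (\<Union>h\<in>cos x. \<Union>k\<in>cos y. {\<lambda>c. h c + k c})" using self[of y] by blast
    qed
    finally show ?thesis .
  qed
  have smultH: "r \<odot>\<^bsub>?H\<^esub> cos x = cos (\<lambda>c. r * x c)" for r x
  proof -
    have "r \<odot>\<^bsub>?H\<^esub> cos x = (\<Union>y\<in>cos x. cos (\<lambda>c. r * y c))"
      by (simp add: H quotient_module_def smultM cos)
    also have "\<dots> = cos (\<lambda>c. r * x c)"
    proof (rule SUP_eq_const)
      fix y assume "y \<in> cos x"
      then obtain b where b: "b \<in> ?B" "y = (\<lambda>c. b c + x c)" by (auto simp: cos_def)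
      have "(\<lambda>c. r * y c - r * x c) = (\<lambda>c. r * b c)" using b by (auto simp: algebra_simps)
      then show "cos (\<lambda>c. r * y c) = cos (\<lambda>c. r * x c)"
        unfolding cos_eq using singular_coboundaries_linear(2)[OF b(1) b(1)] by simp
    qed (use self in blast)
    finally show ?thesis .
  qed
  define comb where "comb v = (\<lambda>c. \<Sum>i<N. v $ i * \<phi> i c)" for v :: "real Matrix.vec"
  have cocycle_sum: "(\<lambda>c. \<Sum>i\<in>I. a i * \<phi> i c) \<in> ?Z" if "I \<subseteq> {..<N}" for I and a :: "nat \<Rightarrow> real"
  proof -
    have "finite I" using that finite_subset by blast
    then show ?thesis using that
    proof (induction I rule: finite_induct)
      case (insert i I)
      then show ?case
        using singular_cocycles_linear(1)[OF singular_cocycles_linear(2)[OF \<phi> \<phi>, of i i "a i"], of "\<lambda>c. \<Sum>i\<in>I. a i * \<phi> i c"]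
        by simp
    qed (simp add: zero_cocycle)
  qed
  then have comb: "comb v \<in> ?Z" for v by (simp add: comb_def)
  have \<Phi>_sum: "\<Phi> j (\<lambda>c. \<Sum>i\<in>I. a i * \<phi> i c) = (\<Sum>i\<in>I. a i * \<Phi> j (\<phi> i))"
    if "j < N" "finite I" for j I and a :: "nat \<Rightarrow> real"
    using that(2)
  proof (induction I rule: finite_induct)
    case empty
    show ?case using \<Phi>_scale[OF that(1), of 0 "\<lambda>_. 0"] by simp
  next
    case (insert i I)
    then show ?case
      using \<Phi>_add[OF that(1), of "\<lambda>c. a i * \<phi> i c" "\<lambda>c. \<Sum>i\<in>I. a i * \<phi> i c"] \<Phi>_scale[OF that(1)] by simp
  qed
  have \<Phi>_comb: "\<Phi> j (comb v) = v $ j" if "j < N" for j v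
  proof -
    have "\<Phi> j (comb v) = (\<Sum>i<N. v $ i * \<Phi> j (\<phi> i))"
      unfolding comb_def using that by (simp add: \<Phi>_sum)
    also have "\<dots> = (\<Sum>i<N. if j = i then v $ i else 0)"
      by (rule sum.cong) (use that dual in auto)
    finally show ?thesis using that by simp
  qed
  have \<Phi>_diff: "\<Phi> j (\<lambda>c. f c - g c) = \<Phi> j f - \<Phi> j g" if "j < N" for j f g
    using \<Phi>_add[OF that, of f "\<lambda>c. -1 * g c"] \<Phi>_scale[OF that, of "-1" g] by simp
  define T where "T v = cos (comb v)" for v
  let ?V = "module_vec TYPE(real) N"
  interpret V: vec_space "TYPE(real)" N .
  have "linear_map class_ring ?V ?H T"
  proof (intro linear_map.intro mod_hom.intro mod_hom_axioms.intro)
    show vs: "vectorspace class_ring ?V" by (rule vec_vs)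
    show vH: "vectorspace class_ring ?H" by (rule vectorspace_real_cohomology)
    show "module class_ring ?V" using vs by (simp add: vectorspace_def)
    show "module class_ring ?H" using vH by (simp add: vectorspace_def)
    have "comb (v + w) = (\<lambda>c. comb v c + comb w c)" if "v \<in> carrier_vec N" "w \<in> carrier_vec N" for v w
    proof
      fix c
      have "(\<Sum>i<N. (v + w) $ i * \<phi> i c) = (\<Sum>i<N. v $ i * \<phi> i c + w $ i * \<phi> i c)"
        by (rule sum.cong) (use that in \<open>simp_all add: distrib_right\<close>)
      then show "comb (v + w) c = comb v c + comb w c" by (simp add: comb_def sum.distrib)
    qed
    moreover have "comb (r \<cdot>\<^sub>v v) = (\<lambda>c. r * comb v c)" if "v \<in> carrier_vec N" for v r
    proof
      fix c
      have "(\<Sum>i<N. (r \<cdot>\<^sub>v v) $ i * \<phi> i c) = (\<Sum>i<N. r * (v $ i * \<phi> i c))"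
        by (rule sum.cong) (use that in simp_all)
      then show "comb (r \<cdot>\<^sub>v v) c = r * comb v c" by (simp add: comb_def sum_distrib_left)
    qed
    ultimately show "T \<in> module_hom class_ring ?V ?H"
      unfolding module_hom_def T_def using comb
      by (auto simp: carH addH smultH module_vec_simps)
  qed
  then interpret lm: linear_map class_ring ?V ?H T .
  have inj: "inj_on T (carrier ?V)"
  proof (rule inj_onI)
    fix v w assume vw: "v \<in> carrier ?V" "w \<in> carrier ?V" "T v = T w"
    then have "(\<lambda>c. comb v c - comb w c) \<in> ?B" by (simp add: T_def cos_eq)
    then have "v $ j = w $ j" if "j < N" for j
      using bound[OF that, of "\<lambda>c. comb v c - comb w c"] \<Phi>_diff[OF that, of "comb v" "comb w"]
        \<Phi>_comb[OF that] by simp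
    then show "v = w" using vw by (intro eq_vecI) (auto simp: module_vec_simps)
  qed
  have surj: "T ` carrier ?V = carrier ?H"
  proof (intro subset_antisym subsetI)
    fix z assume "z \<in> T ` carrier ?V"
    then show "z \<in> carrier ?H" using comb by (auto simp: T_def carH)
  next
    fix z assume "z \<in> carrier ?H"
    then obtain f where f: "f \<in> ?Z" "z = cos f" by (auto simp: carH)
    \<comment> \<open>With the values of the functionals as coefficients, \<open>f\<close> and the
      combination have equal functionals, so their difference is exact.\<close>
    define v where "v = Matrix.vec N (\<lambda>i. \<Phi> i f)"
    have "(\<lambda>c. -1 * comb v c) \<in> ?Z" by (rule singular_cocycles_linear(2)[OF comb comb])
    then have "(\<lambda>c. f c - comb v c) \<in> ?Z" using singular_cocycles_linear(1)[OF f(1)] by fastforce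
    then have "(\<lambda>c. f c - comb v c) \<in> ?B"
      by (rule exact) (simp add: \<Phi>_diff \<Phi>_comb v_def)
    then have "z = T v" using f by (simp add: T_def cos_eq)
    then show "z \<in> T ` carrier ?V" by (auto simp: v_def module_vec_simps)
  qed
  show ?thesis
    using lm.surj_fin_dim[OF V.fin_dim surj] lm.dim_eq[OF V.fin_dim inj surj] V.dim_is_n by simp
qed

section \<open>Second Betti number from commuting elements and equivariant logarithms\<close>

lemma card_pairs: "card {(i, j). i < j \<and> j < (s::nat)} = s choose 2"
proof -
  have "{(i, j). i < j \<and> j < s} = prod.swap ` (SIGMA j:{..<s}. {..<j})" by force
  then have "card {(i, j). i < j \<and> j < s} = (\<Sum>j<s. j)" by (simp add: card_image)
  also have "\<dots> = s choose 2" by (induction s) (auto simp: numeral_2_eq_2)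
  finally show ?thesis .
qed

text \<open>Here \<open>e\<close> is the basis of \<open>A\<close> lifted to the group,
  \<open>L\<close> supplies real functions that shift by the homomorphisms \<open>n\<close> dual to
  \<open>e\<close>, and \<open>cocycle_trivial\<close> is the algebraic theorem on cocycles,
  isolated as an assumption.\<close>

locale classifying_action = contractible_covering_action G Y act y0
  for G :: "('g, 'm) monoid_scheme" (structure) and Y :: "'a topology" and act y0 +
  fixes s :: nat and e :: "nat \<Rightarrow> 'g" and L :: "nat \<Rightarrow> 'a \<Rightarrow> real" and n :: "nat \<Rightarrow> 'g \<Rightarrow> real"
  assumes e_closed: "i < s \<Longrightarrow> e i \<in> carrier G"
    and e_comm: "i < s \<Longrightarrow> j < s \<Longrightarrow> e i \<otimes> e j = e j \<otimes> e i"
    and L_act: "i < s \<Longrightarrow> g \<in> carrier G \<Longrightarrow> y \<in> topspace Y \<Longrightarrow> L i (act g y) = L i y + n i g"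
    and n_e: "i < s \<Longrightarrow> j < s \<Longrightarrow> n i (e j) = (if i = j then 1 else 0)"
    and cocycle_trivial: "(\<And>g h l. g \<in> carrier G \<Longrightarrow> h \<in> carrier G \<Longrightarrow> l \<in> carrier G \<Longrightarrow>
          c h l + c g (h \<otimes> l) = c g h + c (g \<otimes> h) l) \<Longrightarrow>
        (\<And>g. g \<in> carrier G \<Longrightarrow> c \<one> g = 0) \<Longrightarrow> (\<And>g. g \<in> carrier G \<Longrightarrow> c g \<one> = 0) \<Longrightarrow>
        (\<And>i j. i < s \<Longrightarrow> j < s \<Longrightarrow> c (e i) (e j) = c (e j) (e i)) \<Longrightarrow>
        \<exists>\<gamma>. \<forall>g\<in>carrier G. \<forall>h\<in>carrier G. c g h = (\<gamma> (g \<otimes> h) - \<gamma> g - \<gamma> h :: real)"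
begin

text \<open>Vanishing on the tori is symmetry of the group cocycle on the elements
  \<open>e i\<close>; triviality of that cocycle then makes \<open>f\<close> exact.\<close>

lemma cocycle_zero_on_tori_is_coboundary:
  assumes f: "f \<in> singular_cocycles d2 X"
    and tori: "\<And>i j. i < j \<Longrightarrow> j < s \<Longrightarrow> pairing (pullback f d2) (torus (e i) (e j)) = 0"
  shows "f \<in> singular_coboundaries d2 X"
proof -
  define c where "c g h = - defect f g (act h y0)" for g h
  have sym: "c (e i) (e j) = c (e j) (e i)" if "i < j" "j < s" for i j
    using pairing_torus[OF f e_closed e_closed e_comm, of i j] tori[OF that] that by (simp add: c_def)
  have "\<exists>\<gamma>. \<forall>g\<in>carrier G. \<forall>h\<in>carrier G. c g h = \<gamma> (g \<otimes> h) - \<gamma> g - \<gamma> h"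
  proof (rule cocycle_trivial)
    fix g h l assume ghl: "g \<in> carrier G" "h \<in> carrier G" "l \<in> carrier G"
    then show "c h l + c g (h \<otimes> l) = c g h + c (g \<otimes> h) l"
      using defect_mult[OF f ghl(1,2), of "act l y0"] act_mult[OF ghl(2,3) y0] act_closed[OF ghl(3) y0]
      by (simp add: c_def)
  next
    fix i j assume "i < s" "j < s"
    then show "c (e i) (e j) = c (e j) (e i)" using sym[of i j] sym[of j i] by (metis linorder_neqE_nat)
  qed (use defect_one[OF f] defect_y0[OF f] act_one[OF y0] act_closed y0 in \<open>auto simp: c_def\<close>)
  then obtain \<gamma> where "\<forall>g\<in>carrier G. \<forall>h\<in>carrier G. c g h = \<gamma> (g \<otimes> h) - \<gamma> g - \<gamma> h" by blast
  then show ?thesis using cocycle_is_coboundary[OF f, of \<gamma>] by (simp add: c_def)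
qed

text \<open>The Alexander-Whitney cup product of the coboundaries of \<open>L i\<close> and
  \<open>L j\<close>: front edge times back edge. Only differences of \<open>L\<close> occur, so it
  is invariant and descends to the quotient.\<close>

definition quad :: "nat \<Rightarrow> nat \<Rightarrow> ((nat \<Rightarrow> real) \<Rightarrow> 'a) \<Rightarrow> real" where
  "quad i j \<tau> = (L i (vertex d1 \<tau>) - L i (vertex 0 \<tau>)) * (L j (vertex d2 \<tau>) - L j (vertex d1 \<tau>))"

definition cup :: "nat \<Rightarrow> nat \<Rightarrow> 'a set chain \<Rightarrow> real" where
  "cup i j = cochain_of d2 X (\<lambda>\<rho>. quad i j (SOME \<tau>. singular_simplex d2 Y \<tau> \<and> simplex_map d2 proj \<tau> = \<rho>))"

lemma pullback_cup:
  assumes \<tau>: "singular_simplex d2 Y \<tau>" and ij: "i < s" "j < s"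
  shows "pullback (cup i j) d2 \<tau> = quad i j \<tau>"
proof -
  define \<tau>' where "\<tau>' = (SOME \<tau>'. singular_simplex d2 Y \<tau>' \<and> simplex_map d2 proj \<tau>' = simplex_map d2 proj \<tau>)"
  have \<tau>': "singular_simplex d2 Y \<tau>' \<and> simplex_map d2 proj \<tau>' = simplex_map d2 proj \<tau>"
    unfolding \<tau>'_def by (rule someI[of _ \<tau>]) (use \<tau> in simp)
  then obtain g where g: "g \<in> carrier G" "\<tau>' = simplex_map d2 (act g) \<tau>"
    using simplex_lift_unique[OF \<tau>, of \<tau>'] by metis
  have v: "vertex 0 \<tau> \<in> topspace Y" "vertex d1 \<tau> \<in> topspace Y" "vertex d2 \<tau> \<in> topspace Y"
    using vertex_in_space[OF \<tau>] by auto
  have "quad i j \<tau>' = quad i j \<tau>"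
    unfolding g(2) quad_def using L_act[OF _ g(1)] ij v by (simp add: vertex_simplex_map)
  then show ?thesis
    using simplex_proj[OF \<tau>] by (simp add: pullback_def cup_def cochain_of_def singular_chain_of \<tau>'_def)
qed

lemma cup_cocycle:
  assumes ij: "i < s" "j < s"
  shows "cup i j \<in> singular_cocycles d2 X"
proof -
  have c: "cup i j \<in> singular_cochains d2 X" unfolding cup_def by (rule cochain_of_in_cochains)
  have "coboundary d2 X (cup i j) = (\<lambda>c. 0)"
  proof (rule singular_cochain_eqI[OF coboundary_in_cochains[OF c] zero_cochain])
    fix \<rho> assume "singular_simplex d3 X \<rho>"
    then obtain \<tau> where \<tau>: "singular_simplex d3 Y \<tau>" "simplex_map d3 proj \<tau> = \<rho>" by (rule simplex_lift)
    have face: "singular_simplex d2 Y (singular_face d3 i \<tau>)" if "i \<le> d3" for i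
      using singular_simplex_singular_face[OF \<tau>(1) _ that] by simp
    have "coboundary d2 X (cup i j) (frag_of \<rho>) = cobound d2 (pullback (cup i j) d2) \<tau>"
      using cobound_pullback[OF c \<tau>(1)] \<tau>(2) by simp
    also have "\<dots> = cobound d2 (quad i j) \<tau>"
      unfolding cobound_def by (rule sum.cong) (use pullback_cup[OF face ij] in auto)
    also have "\<dots> = 0"
      by (simp add: cobound_def quad_def vertex_singular_face) (simp add: algebra_simps)
    finally show "coboundary d2 X (cup i j) (frag_of \<rho>) = 0" .
  qed
  with c show ?thesis by (simp add: singular_cocycles_def)
qed

text \<open>On \<open>Y\<close> the cup product is the coboundary of \<open>v\<close>, the product
  of \<open>L i\<close> with the coboundary \<open>w\<close> of \<open>L j\<close>. This
  \<open>v\<close> is not invariant: translation by \<open>g\<close> adds \<open>n i g\<close> times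
  \<open>w\<close>, and these contributions on the boundary of the torus make up the
  determinant.\<close>

lemma pairing_cup_torus:
  assumes ij: "i < s" "j < s" and gh: "g \<in> carrier G" "h \<in> carrier G" "g \<otimes> h = h \<otimes> g"
  shows "pairing (pullback (cup i j) d2) (torus g h) = n i g * n j h - n i h * n j g"
proof -
  have Y: "act g y0 \<in> topspace Y" "act h y0 \<in> topspace Y" using gh act_closed y0 by auto
  define v where "v \<sigma> = L i (vertex 0 \<sigma>) * (L j (vertex d1 \<sigma>) - L j (vertex 0 \<sigma>))" for \<sigma> :: "(nat \<Rightarrow> real) \<Rightarrow> 'a"
  define w where "w \<sigma> = L j (vertex d1 \<sigma>) - L j (vertex 0 \<sigma>)" for \<sigma> :: "(nat \<Rightarrow> real) \<Rightarrow> 'a"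
  have "w = cobound 0 (\<lambda>\<sigma>. L j (vertex 0 \<sigma>))"
    by (auto simp: w_def cobound_def vertex_singular_face fun_eq_iff)
  then have w: "pairing w z = L j x - L j y" if "chain_boundary d1 z = pt x - pt y" for z x y
    using pairing_chain_boundary[of "\<lambda>\<sigma>. L j (vertex 0 \<sigma>)" 0 z] that
    by (simp add: pairing_diff) (simp add: vertex_def point_simplex_def)
  have v: "pairing v (ac d1 g z) - pairing v z = n i g * pairing w z"
    if g: "g \<in> carrier G" and z: "singular_chain d1 Y z" for g z
  proof -
    have "pairing v (ac d1 g z) - pairing v z = pairing (\<lambda>\<sigma>. v (simplex_map d1 (act g) \<sigma>) - v \<sigma>) z"
      by (simp add: pairing_chain_map pairing_diff_left)
    also have "\<dots> = pairing (\<lambda>\<sigma>. n i g * w \<sigma>) z"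
    proof (rule pairing_cong)
      fix \<sigma> assume "\<sigma> \<in> Poly_Mapping.keys z"
      then have "singular_simplex d1 Y \<sigma>" using z by (auto simp: singular_chain_def)
      then have "vertex 0 \<sigma> \<in> topspace Y" "vertex d1 \<sigma> \<in> topspace Y" using vertex_in_space by auto
      then show "v (simplex_map d1 (act g) \<sigma>) - v \<sigma> = n i g * w \<sigma>"
        using L_act[OF _ g] ij by (simp add: v_def w_def vertex_simplex_map algebra_simps)
    qed
    finally show ?thesis by (simp add: pairing_cmul_left)
  qed
  have "pairing (pullback (cup i j) d2) (torus g h) = pairing (cobound d1 v) (torus g h)"
  proof (rule pairing_cong)
    fix \<tau> assume "\<tau> \<in> Poly_Mapping.keys (torus g h)"
    then have "singular_simplex d2 Y \<tau>" using torus(1)[OF gh] by (auto simp: singular_chain_def)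
    then have "pullback (cup i j) d2 \<tau> = quad i j \<tau>" using pullback_cup ij by blast
    then show "pullback (cup i j) d2 \<tau> = cobound d1 v \<tau>"
      by (simp add: quad_def cobound_1 v_def vertex_singular_face algebra_simps)
  qed
  also have "\<dots> = pairing v (chain_boundary d2 (torus g h))" by (simp add: pairing_chain_boundary)
  also have "\<dots> = n i g * (L j (act h y0) - L j y0) - n i h * (L j (act g y0) - L j y0)"
    using v gh path Y w by (simp add: torus(2)[OF gh] pairing_diff)
  also have "\<dots> = n i g * n j h - n i h * n j g" using L_act ij gh y0 by simp
  finally show ?thesis .
qed

theorem cohomology_dim:
  "vectorspace.fin_dim class_ring (real_cohomology 2 X) \<and>
   vectorspace.dim class_ring (real_cohomology 2 X) = s choose 2"
proof -
  define I where "I = {(i, j). i < j \<and> j < s}"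
  have "I \<subseteq> {..<s} \<times> {..<s}" by (auto simp: I_def)
  then have "finite I" using finite_subset by blast
  then obtain b where b: "bij_betw b {..<s choose 2} I"
    using ex_bij_betw_nat_finite[of I] card_pairs[of s] by (auto simp: I_def atLeast0LessThan)
  define \<phi> where "\<phi> m = (case b m of (i, j) \<Rightarrow> cup i j)" for m
  define \<Phi> where "\<Phi> m f = (case b m of (i, j) \<Rightarrow> pairing (pullback f d2) (torus (e i) (e j)))" for m f
  have bI: "fst (b m) < snd (b m)" "snd (b m) < s" "fst (b m) < s" if "m < s choose 2" for m
  proof -
    have "b m \<in> I" using bij_betwE[OF b] that by simp
    then show "fst (b m) < snd (b m)" "snd (b m) < s" "fst (b m) < s"
      by (auto simp: I_def case_prod_unfold)
  qed
  have two: "2 = d2" by simp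
  show ?thesis
    unfolding two
  proof (rule real_cohomology_dim[of "s choose 2" \<phi> d2 X \<Phi>, unfolded two])
    show "\<phi> m \<in> singular_cocycles d2 X" if "m < s choose d2" for m
      using that bI[of m] cup_cocycle by (simp add: \<phi>_def case_prod_unfold two[symmetric])
    show "\<Phi> m (\<lambda>c. f c + g c) = \<Phi> m f + \<Phi> m g" for m f g
      by (simp add: \<Phi>_def case_prod_unfold pullback_def pairing_def sum.distrib distrib_left)
    show "\<Phi> m (\<lambda>c. r * f c) = r * \<Phi> m f" for m r f
      by (simp add: \<Phi>_def case_prod_unfold pullback_def pairing_def sum_distrib_left mult.left_commute)
    show "\<Phi> m (\<phi> l) = (if m = l then 1 else 0)" if ml: "m < s choose d2" "l < s choose d2" for m l
    proof -
      note M = bI[OF ml(1)[folded two]] and L = bI[OF ml(2)[folded two]]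
      have "\<Phi> m (\<phi> l) = n (fst (b l)) (e (fst (b m))) * n (snd (b l)) (e (snd (b m)))
          - n (fst (b l)) (e (snd (b m))) * n (snd (b l)) (e (fst (b m)))"
        using pairing_cup_torus[OF L(3,2) e_closed[OF M(3)] e_closed[OF M(2)] e_comm[OF M(3,2)]]
        by (simp add: \<Phi>_def \<phi>_def case_prod_unfold)
      \<comment> \<open>The second product vanishes: it would need the index pairs to be equal after
        swapping one of them, while both are increasing.\<close>
      also have "\<dots> = (if b m = b l then 1 else 0)"
        using n_e M L by (auto simp: prod_eq_iff)
      finally show ?thesis
        using b ml by (auto simp: bij_betw_def inj_on_def two[symmetric])
    qed
    show "\<Phi> m f = 0" if m: "m < s choose d2" and fB: "f \<in> singular_coboundaries d2 X" for m f
    proof -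
      note M = bI[OF m[folded two]]
      obtain a where "a \<in> singular_cochains d1 X" "f = coboundary d1 X a" using fB by auto
      then show ?thesis
        using torus_coboundary[OF _ e_closed[OF M(3)] e_closed[OF M(2)] e_comm[OF M(3,2)]]
        by (simp add: \<Phi>_def case_prod_unfold)
    qed
    show "f \<in> singular_coboundaries d2 X"
      if f: "f \<in> singular_cocycles d2 X" and 0: "\<And>m. m < s choose d2 \<Longrightarrow> \<Phi> m f = 0" for f
    proof (rule cocycle_zero_on_tori_is_coboundary[OF f])
      fix i j assume "i < j" "j < s"
      then have "(i, j) \<in> I" by (simp add: I_def)
      then obtain m where "m < s choose 2" "b m = (i, j)"
        using b by (metis bij_betw_imp_surj_on imageE lessThan_iff)
      then show "pairing (pullback f d2) (torus (e i) (e j)) = 0" using 0[of m] by (simp add: \<Phi>_def two[symmetric])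
    qed
  qed
qed

end

section \<open>Oeljeklaus--Toma groups\<close>

text \<open>The constant term \<open>c\<close> of a monic integer polynomial of least degree killing
  \<beta> is nonzero, and \<open>c\<close> is \<beta> times an algebraic integer; so \<beta> divides
  \<open>c * z\<close>.\<close>

lemma algebraic_int_divides_integer_multiple:
  fixes \<beta> z :: "'k::field_char_0"
  assumes "algebraic_int \<beta>" "\<beta> \<noteq> 0" "algebraic_int z"
  shows "\<exists>m w. m \<noteq> 0 \<and> algebraic_int w \<and> of_int m * z = \<beta> * w"
proof -
  let ?P = "\<lambda>p. poly (map_poly of_int p) \<beta> = 0 \<and> lead_coeff (p::int poly) = 1"
  obtain p where p: "?P p" and least: "\<And>q. ?P q \<Longrightarrow> degree p \<le> degree q"
    using assms(1) ex_has_least_nat[of ?P _ degree] unfolding algebraic_int_altdef_ipoly by metis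
  obtain c q where pq: "p = pCons c q" by (cases p)
  have "q \<noteq> 0"
  proof
    assume "q = 0"
    then have "p = 1" using p pq by (simp add: one_pCons)
    then show False using p by simp
  qed
  have eval: "of_int c + \<beta> * poly (map_poly of_int q) \<beta> = 0"
    using p pq \<open>q \<noteq> 0\<close> by (simp add: map_poly_pCons)
  have "c \<noteq> 0"
  proof
    assume "c = 0"
    then have "?P q" using eval p pq \<open>\<beta> \<noteq> 0\<close> \<open>q \<noteq> 0\<close> by simp
    then show False using least[of q] pq \<open>q \<noteq> 0\<close> by simp
  qed
  moreover have "algebraic_int (- poly (map_poly of_int q) \<beta> * z)"
    using assms by (intro algebraic_int_mult algebraic_int_minus algebraic_int_poly) (auto simp: coeff_map_poly)
  moreover have "of_int c * z = \<beta> * (- poly (map_poly of_int q) \<beta> * z)"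
  proof -
    have "of_int c = - (\<beta> * poly (map_poly of_int q) \<beta>)" using eval by (simp add: add_eq_0_iff)
    then show ?thesis by simp
  qed
  ultimately show ?thesis by blast
qed

text \<open>\<open>D\<close> is the inverse of the lattice basis matrix \<open>B\<close>, so its
  rows are the coordinate functionals dual to the columns of \<open>B\<close>; \<open>e j\<close> is
  an element of \<open>A\<close> above column \<open>j\<close>. The last conclusion is injectivity
  of \<open>D\<close>.\<close>

lemma full_lattice_coordinates:
  assumes "full_lattice s ((\<lambda>a. Matrix.vec s (l a)) ` A)"
  obtains e D where "\<And>j. j < s \<Longrightarrow> e j \<in> A"
    "\<And>a i. a \<in> A \<Longrightarrow> i < s \<Longrightarrow> (\<Sum>j<s. D i j * l a j) \<in> \<int>"
    "\<And>i k. i < s \<Longrightarrow> k < s \<Longrightarrow> (\<Sum>j<s. D i j * l (e k) j) = (if i = k then 1 else 0 :: real)"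
    "\<And>x j. (\<And>i. i < s \<Longrightarrow> (\<Sum>j<s. D i j * x j) = 0) \<Longrightarrow> j < s \<Longrightarrow> x j = 0"
proof -
  obtain B where B: "B \<in> carrier_mat s s" "invertible_mat B"
    and L: "(\<lambda>a. Matrix.vec s (l a)) ` A = (\<lambda>z. B *\<^sub>v map_vec real_of_int z) ` carrier_vec s"
    using assms unfolding full_lattice_def by auto
  obtain D where D: "B * D = 1\<^sub>m s" "D * B = 1\<^sub>m (dim_row D)"
    using B unfolding invertible_mat_def inverts_mat_def by auto
  have dimD: "D \<in> carrier_mat s s"
  proof
    show "dim_col D = s" using arg_cong[OF D(1), of dim_col] by simp
    show "dim_row D = s" using arg_cong[OF D(2), of dim_col] B by simp
  qed
  then have DB: "D * B = 1\<^sub>m s" using D by simp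
  have Dx: "(\<Sum>j<s. D $$ (i, j) * x j) = (D *\<^sub>v Matrix.vec s x) $ i" if "i < s" for i x
    using dimD that by (simp add: scalar_prod_def atLeast0LessThan)
  have "\<exists>a\<in>A. Matrix.vec s (l a) = B *\<^sub>v unit_vec s j" if "j < s" for j
  proof -
    have "map_vec real_of_int (unit_vec s j) = unit_vec s j" by (rule eq_vecI) (auto simp: unit_vec_def)
    then have "B *\<^sub>v unit_vec s j \<in> (\<lambda>z. B *\<^sub>v map_vec real_of_int z) ` carrier_vec s"
      by (intro image_eqI[of _ _ "unit_vec s j"]) auto
    then show ?thesis unfolding L[symmetric] by auto
  qed
  then obtain e where e: "\<And>j. j < s \<Longrightarrow> e j \<in> A" "\<And>j. j < s \<Longrightarrow> Matrix.vec s (l (e j)) = B *\<^sub>v unit_vec s j"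
    by metis
  show ?thesis
  proof (rule that[of e "\<lambda>i j. D $$ (i, j)"])
    show "e j \<in> A" if "j < s" for j using e that by blast
    show "(\<Sum>j<s. D $$ (i, j) * l a j) \<in> \<int>" if a: "a \<in> A" and i: "i < s" for a i
    proof -
      have "Matrix.vec s (l a) \<in> (\<lambda>z. B *\<^sub>v map_vec real_of_int z) ` carrier_vec s"
        using a unfolding L[symmetric] by blast
      then obtain z where z: "z \<in> carrier_vec s" "Matrix.vec s (l a) = B *\<^sub>v map_vec real_of_int z" by auto
      have "D *\<^sub>v Matrix.vec s (l a) = (D * B) *\<^sub>v map_vec real_of_int z"
        unfolding z(2) using dimD B z(1) by (subst assoc_mult_mat_vec) auto
      then have "D *\<^sub>v Matrix.vec s (l a) = map_vec real_of_int z" using DB z(1) by simp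
      then show ?thesis using Dx[OF i] z(1) i by simp
    qed
    show "(\<Sum>j<s. D $$ (i, j) * l (e k) j) = (if i = k then 1 else 0)" if ik: "i < s" "k < s" for i k
    proof -
      have "D *\<^sub>v Matrix.vec s (l (e k)) = (D * B) *\<^sub>v unit_vec s k"
        unfolding e(2)[OF ik(2)] using dimD B by (subst assoc_mult_mat_vec) auto
      then have "D *\<^sub>v Matrix.vec s (l (e k)) = unit_vec s k" using DB by simp
      then show ?thesis using Dx[OF ik(1)] ik by (auto simp: unit_vec_def)
    qed
    show "x j = 0" if 0: "\<And>i. i < s \<Longrightarrow> (\<Sum>j<s. D $$ (i, j) * x j) = 0" and j: "j < s" for x j
    proof -
      have "D *\<^sub>v Matrix.vec s x = 0\<^sub>v s"
        using Dx 0 dimD by (intro eq_vecI) auto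
      moreover have "B *\<^sub>v (D *\<^sub>v Matrix.vec s x) = (B * D) *\<^sub>v Matrix.vec s x"
        using B dimD by (subst assoc_mult_mat_vec) auto
      moreover have "B *\<^sub>v 0\<^sub>v s = 0\<^sub>v s" using B by (intro eq_vecI) auto
      ultimately have "Matrix.vec s x = 0\<^sub>v s" using D(1) by simp
      then have "Matrix.vec s x $ j = 0\<^sub>v s $ j" by simp
      then show ?thesis using j by simp
    qed
  qed
qed

locale OT = embeddings s t \<sigma> for s t :: nat and \<sigma> :: "nat \<Rightarrow> 'k::field_char_0 \<Rightarrow> complex" +
  fixes A :: "'k set"
  assumes odd_s: "odd s" and adm: "admissible s t \<sigma> A"
begin

abbreviation \<O> where "\<O> \<equiv> ring_of_integers :: 'k set"
abbreviation U where "U \<equiv> topspace (OT_cover s t)"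

lemma O_closed: "0 \<in> \<O>" "1 \<in> \<O>" "x \<in> \<O> \<Longrightarrow> y \<in> \<O> \<Longrightarrow> x + y \<in> \<O>" "x \<in> \<O> \<Longrightarrow> y \<in> \<O> \<Longrightarrow> x * y \<in> \<O>" "x \<in> \<O> \<Longrightarrow> - x \<in> \<O>"
  by (auto simp: ring_of_integers_def algebraic_int_add algebraic_int_mult)

lemma \<sigma>_add: "i < s + t \<Longrightarrow> \<sigma> i (x + y) = \<sigma> i x + \<sigma> i y"
  and \<sigma>_mult: "i < s + t \<Longrightarrow> \<sigma> i (x * y) = \<sigma> i x * \<sigma> i y"
  and \<sigma>_0: "i < s + t \<Longrightarrow> \<sigma> i 0 = 0" and \<sigma>_1: "i < s + t \<Longrightarrow> \<sigma> i 1 = 1"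
  and \<sigma>_eq_0: "i < s + t \<Longrightarrow> \<sigma> i x = 0 \<longleftrightarrow> x = 0"
proof -
  assume "i < s + t"
  then have h: "field_hom (\<sigma> i)" using embedding_hom by simp
  then interpret idom_hom "\<sigma> i" by (simp add: field_hom_def)
  show "\<sigma> i (x + y) = \<sigma> i x + \<sigma> i y" "\<sigma> i (x * y) = \<sigma> i x * \<sigma> i y" "\<sigma> i 0 = 0" "\<sigma> i 1 = 1"
    by (simp_all add: hom_add hom_mult)
  show "\<sigma> i x = 0 \<longleftrightarrow> x = 0"
    using hom_on_eq_0[of UNIV "\<sigma> i" x] field_hom_imp_hom_on[OF h] number_field_algebraic[OF nf]
    by (simp add: subalg_def)
qed

lemma \<sigma>_real: "i < s \<Longrightarrow> \<sigma> i x = of_real (Re (\<sigma> i x))"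
  using enum unfolding enumerates_embeddings_def by (metis Reals_cases Re_complex_of_real range_subsetD)

lemma A_sub: "subgroup A (positive_unit_group s \<sigma>)"
  using adm by (simp add: admissible_def)

lemma A_O: "a \<in> A \<Longrightarrow> a \<in> \<O>" and A_pos: "a \<in> A \<Longrightarrow> i < s \<Longrightarrow> 0 < Re (\<sigma> i a)"
  using subgroup.subset[OF A_sub] by (auto simp: positive_unit_group_def integer_units_def)

lemma A_1: "1 \<in> A" and A_mult: "a \<in> A \<Longrightarrow> b \<in> A \<Longrightarrow> a * b \<in> A"
  using subgroup.one_closed[OF A_sub] subgroup.m_closed[OF A_sub, of a b] by (auto simp: positive_unit_group_def)

lemma A_0: "0 \<notin> A" using A_pos[of 0 0] s_pos \<sigma>_0[of 0] by auto

text \<open>The closure supplied by \<open>subgroup\<close> concerns the inverse of the unit group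
  as a monoid; it has to be identified with the inverse in the field, and positivity of the latter
  follows from the product being 1.\<close>

lemma A_inverse: assumes "a \<in> A" shows "inverse a \<in> A"
proof -
  let ?P = "positive_unit_group s \<sigma>"
  have a: "a \<in> carrier ?P" using subgroup.subset[OF A_sub] assms by blast
  then obtain v where v: "v \<in> \<O>" "a * v = 1" by (auto simp: positive_unit_group_def integer_units_def)
  have inv: "inverse a = v" using v(2) by (rule inverse_unique)
  have "0 < Re (\<sigma> i v)" if "i < s" for i
  proof -
    have "\<sigma> i a * \<sigma> i v = 1" using v(2) \<sigma>_mult[of i a v] \<sigma>_1[of i] that by simp
    then have "of_real (Re (\<sigma> i a) * Re (\<sigma> i v)) = (1 :: complex)"
      using \<sigma>_real[OF that] by (metis of_real_mult)
    then have "Re (\<sigma> i a) * Re (\<sigma> i v) = 1" by (metis of_real_eq_1_iff)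
    then show ?thesis
      using A_pos[OF assms that] zero_less_mult_pos[of "Re (\<sigma> i a)" "Re (\<sigma> i v)"] by simp
  qed
  then have vP: "v \<in> carrier ?P"
    using v A_O[OF assms] by (auto simp: positive_unit_group_def integer_units_def mult.commute)
  have "inv\<^bsub>?P\<^esub> a = v"
    unfolding m_inv_def
  proof (rule the_equality)
    show "v \<in> carrier ?P \<and> a \<otimes>\<^bsub>?P\<^esub> v = \<one>\<^bsub>?P\<^esub> \<and> v \<otimes>\<^bsub>?P\<^esub> a = \<one>\<^bsub>?P\<^esub>"
      using vP v by (simp add: positive_unit_group_def mult.commute)
    show "y = v" if "y \<in> carrier ?P \<and> a \<otimes>\<^bsub>?P\<^esub> y = \<one>\<^bsub>?P\<^esub> \<and> y \<otimes>\<^bsub>?P\<^esub> a = \<one>\<^bsub>?P\<^esub>" for y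
      using that inverse_unique[of a y] inv by (simp add: positive_unit_group_def)
  qed
  then show ?thesis using subgroup.m_inv_closed[OF A_sub assms] inv by simp
qed

definition lg :: "'k \<Rightarrow> nat \<Rightarrow> real" where "lg a i = ln (Re (\<sigma> i a))"

lemma lg_mult: "a \<in> A \<Longrightarrow> b \<in> A \<Longrightarrow> i < s \<Longrightarrow> lg (a * b) i = lg a i + lg b i"
proof -
  assume ab: "a \<in> A" "b \<in> A" "i < s"
  have "Re (\<sigma> i (a * b)) = Re (\<sigma> i a) * Re (\<sigma> i b)"
    using \<sigma>_mult[of i a b] \<sigma>_real[of i a] \<sigma>_real[of i b] ab(3)
    by (metis Re_complex_of_real of_real_mult trans_less_add1)
  then show ?thesis using A_pos[OF ab(1,3)] A_pos[OF ab(2,3)] by (simp add: lg_def ln_mult)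
qed

text \<open>A single real embedding is already injective, so one vanishing logarithm of a positive
  unit forces the unit to be 1.\<close>

lemma lg_eq_0: "a \<in> A \<Longrightarrow> lg a 0 = 0 \<Longrightarrow> a = 1"
proof -
  assume a: "a \<in> A" "lg a 0 = 0"
  then have "Re (\<sigma> 0 a) = 1" using A_pos[of a 0] s_pos by (simp add: lg_def)
  then have "\<sigma> 0 a = 1" using \<sigma>_real[of 0 a] s_pos by simp
  then have "\<sigma> 0 (a + (-1)) = 0"
    using \<sigma>_add[of 0 a "-1"] \<sigma>_add[of 0 1 "-1"] \<sigma>_1[of 0] \<sigma>_0[of 0] s_pos by simp
  then show ?thesis using \<sigma>_eq_0[of 0 "a + (-1)"] s_pos by simp
qed

lemma full_lattice_lg: "full_lattice s ((\<lambda>a. Matrix.vec s (lg a)) ` A)"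
proof -
  have "vec_first (log_map s t \<sigma> a) s = Matrix.vec s (lg a)" if "a \<in> A" for a
  proof (rule eq_vecI)
    fix i assume i: "i < dim_vec (Matrix.vec s (lg a))"
    then have "cmod (\<sigma> i a) = Re (\<sigma> i a)"
      using \<sigma>_real[of i a] A_pos[OF that, of i] by (metis abs_of_pos dim_vec norm_of_real)
    then show "vec_first (log_map s t \<sigma> a) s $ i = Matrix.vec s (lg a) $ i"
      using i by (simp add: vec_first_def log_map_def lg_def)
  qed (simp add: vec_first_def)
  then have "(\<lambda>v. vec_first v s) ` log_map s t \<sigma> ` A = (\<lambda>a. Matrix.vec s (lg a)) ` A"
    by (force simp: image_image)
  then show ?thesis using adm by (simp add: admissible_def)
qed

end

section \<open>Integral coordinates on the group of units\<close>

locale OT_basis = OT s t \<sigma> A for s t :: nat and \<sigma> :: "nat \<Rightarrow> 'k::field_char_0 \<Rightarrow> complex" and A +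
  fixes e :: "nat \<Rightarrow> 'k" and D :: "nat \<Rightarrow> nat \<Rightarrow> real"
  assumes e_A: "j < s \<Longrightarrow> e j \<in> A"
    and D_Ints: "a \<in> A \<Longrightarrow> i < s \<Longrightarrow> (\<Sum>j<s. D i j * lg a j) \<in> \<int>"
    and D_e: "i < s \<Longrightarrow> k < s \<Longrightarrow> (\<Sum>j<s. D i j * lg (e k) j) = (if i = k then 1 else 0)"
    and D_inj: "(\<And>i. i < s \<Longrightarrow> (\<Sum>j<s. D i j * x j) = 0) \<Longrightarrow> j < s \<Longrightarrow> x j = 0"
begin

definition n :: "nat \<Rightarrow> 'k \<Rightarrow> real" where "n i a = (\<Sum>j<s. D i j * lg a j)"

lemma n_Ints: "a \<in> A \<Longrightarrow> i < s \<Longrightarrow> n i a \<in> \<int>"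
  and n_e: "i < s \<Longrightarrow> k < s \<Longrightarrow> n i (e k) = (if i = k then 1 else 0)"
  unfolding n_def by (fact D_Ints, fact D_e)

lemma n_mult: "a \<in> A \<Longrightarrow> b \<in> A \<Longrightarrow> n i (a * b) = n i a + n i b"
  by (simp add: n_def lg_mult distrib_left sum.distrib)

lemma n_one: "n i 1 = 0" using n_mult[of 1 1 i] A_1 by simp

lemma n_inj: assumes "a \<in> A" "\<And>i. i < s \<Longrightarrow> n i a = 0" shows "a = 1"
  using lg_eq_0[OF assms(1)] D_inj[of "lg a" 0] assms(2) s_pos by (simp add: n_def)

lemma lg_discrete:
  obtains \<epsilon> where "\<epsilon> > 0" "\<And>a. a \<in> A \<Longrightarrow> (\<And>i. i < s \<Longrightarrow> \<bar>lg a i\<bar> < \<epsilon>) \<Longrightarrow> a = 1"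
proof -
  \<comment> \<open>\<open>M\<close> exceeds every row sum of absolute values of \<open>D\<close>,
    so logarithms below \<open>1 / M\<close> give integral coordinates of modulus below 1, that is
    0.\<close>
  define M where "M = 1 + (\<Sum>i<s. \<Sum>j<s. \<bar>D i j\<bar>)"
  have M: "M > 0" unfolding M_def by (simp add: sum_nonneg add_pos_nonneg)
  have "a = 1" if a: "a \<in> A" and small: "\<And>i. i < s \<Longrightarrow> \<bar>lg a i\<bar> < 1 / M" for a
  proof (rule n_inj[OF a])
    fix i assume i: "i < s"
    have "\<bar>n i a\<bar> \<le> (\<Sum>j<s. \<bar>D i j\<bar> * \<bar>lg a j\<bar>)"
      unfolding n_def by (rule order_trans[OF sum_abs]) (simp add: abs_mult)
    also have "\<dots> \<le> (\<Sum>j<s. \<bar>D i j\<bar> * (1 / M))"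
      using small by (intro sum_mono mult_left_mono) (auto intro: less_imp_le)
    also have "\<dots> = (\<Sum>j<s. \<bar>D i j\<bar>) / M" by (simp add: sum_divide_distrib)
    also have "\<dots> < 1"
    proof -
      have "(\<Sum>j<s. \<bar>D i j\<bar>) \<le> (\<Sum>i<s. \<Sum>j<s. \<bar>D i j\<bar>)"
        by (rule member_le_sum) (use i in \<open>auto simp: sum_nonneg\<close>)
      then show ?thesis using M by (simp add: M_def)
    qed
    finally show "n i a = 0" using n_Ints[OF a i] Ints_nonzero_abs_less1 by blast
  qed
  then show ?thesis using that[of "1 / M"] M by simp
qed

text \<open>The product has the same coordinates as \<open>a\<close>, and the coordinates are
  injective on \<open>A\<close>. The floor only turns a real number known to be integral into an
  integer.\<close>

lemma A_generated:
  assumes "a \<in> A" shows "a = (\<Prod>i<s. e i powi \<lfloor>n i a\<rfloor>)"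
proof -
  have pw: "b ^ m \<in> A" if "b \<in> A" for b and m :: nat by (induction m) (use that in \<open>auto simp: A_1 A_mult\<close>)
  have pwi: "b powi m \<in> A" if "b \<in> A" for b m using pw[OF that] pw[OF A_inverse[OF that]] by (auto simp: power_int_def)
  have prd: "prod g I \<in> A" if "\<And>i. i \<in> I \<Longrightarrow> g i \<in> A" for g and I :: "nat set"
    using that by (induction I rule: infinite_finite_induct) (auto simp: A_1 A_mult)
  have n_prd: "n k (prod g I) = (\<Sum>i\<in>I. n k (g i))" if "\<And>i. i \<in> I \<Longrightarrow> g i \<in> A" for g k and I :: "nat set"
    using that by (induction I rule: infinite_finite_induct) (auto simp: n_one n_mult prd)
  have n_pw: "n k (b ^ m) = real m * n k b" if "b \<in> A" for b k m
    by (induction m) (use that in \<open>auto simp: n_one n_mult pw algebra_simps\<close>)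
  have n_inv: "n k (inverse b) = - n k b" if "b \<in> A" for b k
    using n_mult[OF that A_inverse[OF that], of k] that A_0 n_one[of k] by (metis add_eq_0_iff right_inverse)
  have n_pwi: "n k (b powi m) = of_int m * n k b" if "b \<in> A" for b k m
    by (cases m rule: int_cases2) (use that in \<open>auto simp: power_int_minus n_inv n_pw pw\<close>)
  define b where "b = (\<Prod>i<s. e i powi \<lfloor>n i a\<rfloor>)"
  have b: "b \<in> A" unfolding b_def using pwi e_A by (intro prd) auto
  have nb: "n k b = n k a" if k: "k < s" for k
  proof -
    have "n k b = (\<Sum>i<s. n k (e i powi \<lfloor>n i a\<rfloor>))" unfolding b_def using pwi e_A by (intro n_prd) auto
    also have "\<dots> = (\<Sum>i<s. if k = i then of_int \<lfloor>n i a\<rfloor> else 0)"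
      using n_e[OF k] e_A by (intro sum.cong) (auto simp: n_pwi)
    also have "\<dots> = of_int \<lfloor>n k a\<rfloor>" using k by simp
    finally show ?thesis using n_Ints[OF assms k] by (auto elim: Ints_cases)
  qed
  have "a * inverse b = 1"
    using nb n_mult[OF assms A_inverse[OF b]] n_inv[OF b] by (intro n_inj A_mult A_inverse assms b) auto
  then have "a = b" using b A_0 by (metis inverse_inverse_eq inverse_unique mult.commute)
  then show ?thesis by (simp add: b_def)
qed

end

section \<open>Geometry of the action on the cover\<close>

context OT
begin

definition S :: "nat \<Rightarrow> complex set" where "S k = (if k < s then {z. 0 < Im z} else UNIV)"

lemma OT_cover_eq: "OT_cover s t = product_topology (\<lambda>k. top_of_set (S k)) {..<s + t}"
  unfolding OT_cover_def S_def by (rule arg_cong2[where f = product_topology]) (auto simp: fun_eq_iff)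

lemma U_eq: "U = Pi\<^sub>E {..<s + t} S"
  by (simp add: OT_cover_eq topspace_product_topology o_def)

lemma U_Im: "w \<in> U \<Longrightarrow> k < s \<Longrightarrow> 0 < Im (w k)"
  unfolding U_eq S_def by (auto dest!: PiE_mem[of _ _ _ k])

abbreviation act where "act \<equiv> OT_action s t \<sigma>"
abbreviation \<Gamma> where "\<Gamma> \<equiv> OT_group A"

lemma carrier_\<Gamma>: "carrier \<Gamma> = A \<times> \<O>" and mult_\<Gamma>: "(a, c) \<otimes>\<^bsub>\<Gamma>\<^esub> (b, d) = (a * b, a * d + c)"
  and one_\<Gamma>: "\<one>\<^bsub>\<Gamma>\<^esub> = (1, 0)"
  by (simp_all add: OT_group_def)

lemma act_eq: "w \<in> U \<Longrightarrow> act (a, c) w = (\<lambda>i\<in>{..<s + t}. \<sigma> i a * w i + \<sigma> i c)"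
  by (simp add: OT_action_def)

text \<open>Real embeddings have real values, so the translation part leaves imaginary parts alone
  and \<open>a\<close> scales them.\<close>

lemma Im_act: "w \<in> U \<Longrightarrow> k < s \<Longrightarrow> Im (act (a, c) w k) = Re (\<sigma> k a) * Im (w k)"
  using \<sigma>_real[of k a] \<sigma>_real[of k c] by (simp add: act_eq) (metis Im_complex_of_real mult_zero_left add_0_right)

lemma act_U: "a \<in> A \<Longrightarrow> w \<in> U \<Longrightarrow> act (a, c) w \<in> U"
proof -
  assume a: "a \<in> A" and w: "w \<in> U"
  show "act (a, c) w \<in> U"
    unfolding U_eq
  proof (rule PiE_I)
    fix k assume "k \<in> {..<s + t}"
    then show "act (a, c) w k \<in> S k"
      using Im_act[OF w, of k a c] A_pos[OF a, of k] U_Im[OF w, of k] by (simp add: S_def)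
  next
    fix k assume "k \<notin> {..<s + t}"
    then show "act (a, c) w k = undefined" by (simp add: act_eq[OF w])
  qed
qed

lemma group_\<Gamma>: "group \<Gamma>"
proof (rule groupI)
  fix g assume "g \<in> carrier \<Gamma>"
  then obtain a c where g: "g = (a, c)" "a \<in> A" "c \<in> \<O>" by (auto simp: carrier_\<Gamma>)
  then have "(inverse a, - (inverse a * c)) \<in> carrier \<Gamma>" "inverse a * a = 1"
    using A_inverse A_O O_closed A_0 by (auto simp: carrier_\<Gamma>) (metis left_inverse)
  then show "\<exists>h\<in>carrier \<Gamma>. h \<otimes>\<^bsub>\<Gamma>\<^esub> g = \<one>\<^bsub>\<Gamma>\<^esub>"
    by (intro bexI[of _ "(inverse a, - (inverse a * c))"]) (simp_all add: g mult_\<Gamma> one_\<Gamma>)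
qed (use A_1 A_mult A_O O_closed in \<open>auto simp: carrier_\<Gamma> mult_\<Gamma> one_\<Gamma> algebra_simps\<close>)

lemma act_continuous:
  assumes "a \<in> A"
  shows "continuous_map (OT_cover s t) (OT_cover s t) (act (a, c))"
proof -
  have "continuous_map (OT_cover s t) (top_of_set (S k)) (\<lambda>w. act (a, c) w k)" if k: "k < s + t" for k
  proof -
    have 1: "continuous_map (OT_cover s t) (top_of_set (S k)) (\<lambda>w. w k)"
      unfolding OT_cover_eq by (rule continuous_map_product_projection) (use k in simp)
    have eq: "act (a, c) w k = \<sigma> k a * w k + \<sigma> k c" if "w \<in> U" for w using that k by (simp add: act_eq)
    have "continuous_map (OT_cover s t) euclidean (\<lambda>w. w k)"
      using 1 by (simp add: continuous_map_in_subtopology)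
    moreover have "continuous_map euclidean euclidean (\<lambda>z. \<sigma> k a * z + \<sigma> k c)"
      by (simp add: continuous_intros)
    ultimately have "continuous_map (OT_cover s t) euclidean ((\<lambda>z. \<sigma> k a * z + \<sigma> k c) \<circ> (\<lambda>w. w k))"
      by (rule continuous_map_compose)
    then have "continuous_map (OT_cover s t) euclidean (\<lambda>w. act (a, c) w k)"
      by (rule continuous_map_eq) (simp add: eq)
    moreover have "act (a, c) w k \<in> S k" if "w \<in> U" for w
      using act_U[OF assms that, of c] k unfolding U_eq by auto
    ultimately show ?thesis by (auto simp: continuous_map_in_subtopology)
  qed
  moreover have "act (a, c) w \<in> extensional {..<s + t}" if "w \<in> U" for w
    using act_U[OF assms that, of c] unfolding U_eq by (auto simp: PiE_iff)
  ultimately have "continuous_map (OT_cover s t) (product_topology (\<lambda>k. top_of_set (S k)) {..<s + t}) (act (a, c))"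
    unfolding continuous_map_componentwise by auto
  then show ?thesis by (simp add: OT_cover_eq)
qed

text \<open>Imaginary parts detect \<open>a\<close>: if \<open>W\<close> meets its translate, every
  logarithm of \<open>a\<close> is below \<epsilon>, so \<open>a = 1\<close>. What remains is a
  translation by \<open>c\<close> of length below 1 in all \<open>s + t\<close> coordinates, which
  the norm bound excludes unless \<open>c = 0\<close>.\<close>

lemma wandering_neighbourhood:
  assumes y: "y \<in> U" and \<epsilon>: "\<epsilon> > 0" "\<And>a. a \<in> A \<Longrightarrow> (\<And>i. i < s \<Longrightarrow> \<bar>lg a i\<bar> < \<epsilon>) \<Longrightarrow> a = 1"
  shows "\<exists>W. openin (OT_cover s t) W \<and> y \<in> W \<and> (\<forall>g\<in>carrier \<Gamma>. \<forall>w\<in>W. act g w \<in> W \<longrightarrow> g = \<one>\<^bsub>\<Gamma>\<^esub>)"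
proof -
  have "\<exists>r>0. \<forall>z\<in>ball (y k) r. \<bar>ln (Im z) - ln (Im (y k))\<bar> < \<epsilon> / 2" if "k < s" for k
  proof -
    have "isCont (\<lambda>z. ln (Im z)) (y k)" using U_Im[OF y that] by (intro continuous_intros) auto
    moreover have "\<epsilon> / 2 > 0" using \<epsilon>(1) by simp
    ultimately obtain d where "d > 0" "\<And>z. dist z (y k) < d \<Longrightarrow> dist (ln (Im z)) (ln (Im (y k))) < \<epsilon> / 2"
      unfolding continuous_at_eps_delta by metis
    then show ?thesis by (intro exI[of _ d]) (simp add: dist_real_def dist_commute)
  qed
  then obtain r where r: "\<And>k. k < s \<Longrightarrow> r k > 0"
      "\<And>k z. k < s \<Longrightarrow> z \<in> ball (y k) (r k) \<Longrightarrow> \<bar>ln (Im z) - ln (Im (y k))\<bar> < \<epsilon> / 2"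
    by metis
  \<comment> \<open>Radius 1/2 keeps two points of \<open>W\<close> at distance below 1 in each
    coordinate; the bound \<open>r k\<close> controls the logarithm of the imaginary part up to
    \<epsilon>/2.\<close>
  define V where "V k = S k \<inter> ball (y k) (if k < s then min (r k) (1/2) else 1/2)" for k
  define W where "W = Pi\<^sub>E {..<s + t} V"
  have WU: "W \<subseteq> U" unfolding W_def U_eq by (rule PiE_mono) (auto simp: V_def)
  have Wlg: "\<bar>ln (Im (w k)) - ln (Im (y k))\<bar> < \<epsilon> / 2" if "w \<in> W" "k < s" for w k
  proof -
    have "w k \<in> V k" using PiE_mem[of w "{..<s + t}" V k] that unfolding W_def by simp
    then show ?thesis using r(2)[OF that(2)] that(2) by (simp add: V_def)
  qed
  have Wd: "dist (y k) (w k) < 1/2" if "w \<in> W" "k < s + t" for w k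
  proof -
    have "w k \<in> V k" using PiE_mem[of w "{..<s + t}" V k] that unfolding W_def by simp
    then show ?thesis by (simp add: V_def split: if_splits)
  qed
  have "openin (OT_cover s t) W"
    unfolding OT_cover_eq W_def V_def by (subst openin_PiE) (auto intro: openin_open_Int)
  moreover have "y \<in> W"
    using y r(1) unfolding W_def V_def U_eq by (auto simp: PiE_iff)
  moreover have "g = \<one>\<^bsub>\<Gamma>\<^esub>" if g: "g \<in> carrier \<Gamma>" and w: "w \<in> W" and gw: "act g w \<in> W" for g w
  proof -
    obtain a c where ac: "g = (a, c)" "a \<in> A" "c \<in> \<O>" using g by (auto simp: carrier_\<Gamma>)
    have wU: "w \<in> U" using w WU by blast
    have "\<bar>lg a k\<bar> < \<epsilon>" if k: "k < s" for k
    proof -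
      have "ln (Im (act g w k)) = lg a k + ln (Im (w k))"
        using Im_act[OF wU k, of a c] A_pos[OF ac(2) k] U_Im[OF wU k] by (simp add: ac lg_def ln_mult)
      then show ?thesis using Wlg[OF w k] Wlg[OF gw k] by linarith
    qed
    then have a: "a = 1" using \<epsilon>(2)[OF ac(2)] by blast
    have "cmod (\<sigma> k c) < 1" if k: "k < s + t" for k
    proof -
      have "\<sigma> k c = act g w k - w k" using act_eq[OF wU, of a c] k a \<sigma>_1[OF k] by (simp add: ac)
      then have "cmod (\<sigma> k c) = dist (act g w k) (w k)" by (simp add: dist_norm)
      also have "\<dots> \<le> dist (y k) (act g w k) + dist (y k) (w k)" by (metis dist_triangle2 dist_commute)
      also have "\<dots> < 1" using Wd[OF w k] Wd[OF gw k] by simp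
      finally show ?thesis .
    qed
    then have "c = 0"
      using algebraic_int_embedding_ge_1[of c] ac(3) by (force simp: ring_of_integers_def)
    then show ?thesis using a ac by (simp add: one_\<Gamma>)
  qed
  ultimately show ?thesis by blast
qed

definition base :: "nat \<Rightarrow> complex" where "base = (\<lambda>i\<in>{..<s + t}. \<i>)"

lemma base: "base \<in> U"
  by (auto simp: U_eq S_def base_def)

lemma contractible_cover: "contractible_space (OT_cover s t)"
proof -
  have "contractible (S k)" for k
    unfolding S_def by (auto intro!: convex_imp_contractible convex_halfspace_Im_gt)
  then show ?thesis by (simp add: OT_cover_eq contractible_space_product_topology)
qed

end

section \<open>The action satisfies the criterion\<close>

context OT_basis
begin

text \<open>Logarithms of imaginary parts shift by \<open>lg a\<close> under \<open>a\<close> and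
  are fixed by translations; combining them with \<open>D\<close> turns the shift into the
  coordinate \<open>n i a\<close>.\<close>

definition L :: "nat \<Rightarrow> (nat \<Rightarrow> complex) \<Rightarrow> real" where "L i w = (\<Sum>j<s. D i j * ln (Im (w j)))"

lemma affine_cocycle_trivial:
  assumes cocycle: "\<And>g h l. g \<in> carrier \<Gamma> \<Longrightarrow> h \<in> carrier \<Gamma> \<Longrightarrow> l \<in> carrier \<Gamma> \<Longrightarrow>
      c h l + c g (h \<otimes>\<^bsub>\<Gamma>\<^esub> l) = c g h + c (g \<otimes>\<^bsub>\<Gamma>\<^esub> h) l"
    and left: "\<And>g. g \<in> carrier \<Gamma> \<Longrightarrow> c \<one>\<^bsub>\<Gamma>\<^esub> g = 0" and right: "\<And>g. g \<in> carrier \<Gamma> \<Longrightarrow> c g \<one>\<^bsub>\<Gamma>\<^esub> = 0"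
    and sym: "\<And>i j. i < s \<Longrightarrow> j < s \<Longrightarrow> c (e i, 0) (e j, 0) = c (e j, 0) (e i, 0)"
  shows "\<exists>\<gamma>. \<forall>g\<in>carrier \<Gamma>. \<forall>h\<in>carrier \<Gamma>. c g h = (\<gamma> (g \<otimes>\<^bsub>\<Gamma>\<^esub> h) - \<gamma> g - \<gamma> h :: real)"
proof -
  interpret affine_cocycle A \<O> c
  proof
    fix a b d x y z assume "a \<in> A" "b \<in> A" "d \<in> A" "x \<in> \<O>" "y \<in> \<O>" "z \<in> \<O>"
    then show "c (b, y) (d, z) + c (a, x) (b * d, b * z + y) = c (a, x) (b, y) + c (a * b, a * y + x) (d, z)"
      using cocycle[of "(a, x)" "(b, y)" "(d, z)"] by (simp add: carrier_\<Gamma> mult_\<Gamma>)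
  next
    fix a x assume "a \<in> A" "x \<in> \<O>"
    then show "c (1, 0) (a, x) = 0" "c (a, x) (1, 0) = 0"
      using left[of "(a, x)"] right[of "(a, x)"] by (simp_all add: carrier_\<Gamma> one_\<Gamma>)
  next
    fix a x assume "a \<in> A" "x \<in> \<O>"
    then show "a * x \<in> \<O>" using A_O O_closed(4) by blast
  qed (fact A_1 A_0 A_mult A_inverse O_closed)+
  \<comment> \<open>An element of \<open>A\<close> other than 1, as its coordinate
    \<open>n 0 u = 1\<close> shows; positivity under \<open>\<sigma> 0\<close> excludes -1.\<close>
  define u where "u = e 0"
  have u: "u \<in> A" using e_A s_pos by (simp add: u_def)
  have "n 0 u = 1" using n_e[of 0 0] s_pos by (simp add: u_def)
  then have u1: "u \<noteq> 1" using n_one by auto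
  have "\<sigma> 0 1 + \<sigma> 0 (-1) = 0" using \<sigma>_add[of 0 1 "-1"] \<sigma>_0[of 0] s_pos by simp
  then have "u \<noteq> -1" using A_pos[OF u, of 0] \<sigma>_1[of 0] s_pos by (auto simp: add_eq_0_iff)
  moreover have "u \<noteq> 0" using u A_0 by auto
  ultimately obtain p :: "int poly" where p: "poly (map_poly of_int p) u = 0"
      "poly (map_poly of_int p) (inverse u) \<noteq> 0" "poly p 1 \<noteq> 0"
    using annihilating_polynomial[OF odd_s _ u1] by blast
  have "algebraic_int (poly (map_poly of_int p) (inverse u))"
    using A_O[OF A_inverse[OF u]]
    by (intro algebraic_int_poly) (auto simp: coeff_map_poly ring_of_integers_def)
  then have div: "\<exists>m w. m \<noteq> 0 \<and> w \<in> \<O> \<and> of_int m * z = poly (map_poly of_int p) (inverse u) * w" if "z \<in> \<O>" for z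
    using algebraic_int_divides_integer_multiple[OF _ p(2), of z] that by (simp add: ring_of_integers_def)
  have n_floor: "\<lfloor>n i (a * b)\<rfloor> = \<lfloor>n i a\<rfloor> + \<lfloor>n i b\<rfloor>" if "i < s" "a \<in> A" "b \<in> A" for i a b
    using n_mult[OF that(2,3), of i] n_Ints[OF that(2,1)] n_Ints[OF that(3,1)] by (auto elim!: Ints_cases)
  obtain \<gamma> where "\<And>a b x y. a \<in> A \<Longrightarrow> b \<in> A \<Longrightarrow> x \<in> \<O> \<Longrightarrow> y \<in> \<O> \<Longrightarrow>
      c (a, x) (b, y) = \<gamma> (a * b, a * y + x) - \<gamma> (a, x) - \<gamma> (b, y)"
    using coboundary_if_symmetric_on_generators[of s e "\<lambda>i a. \<lfloor>n i a\<rfloor>" u p, OF e_A n_floor A_generated sym u p(1,3) div]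
    by blast
  then show ?thesis by (intro exI[of _ \<gamma>]) (auto simp: carrier_\<Gamma> mult_\<Gamma>)
qed

sublocale classifying_action \<Gamma> "OT_cover s t" act base s "\<lambda>i. (e i, 0)" L "\<lambda>i g. n i (fst g)"
proof (intro classifying_action.intro contractible_covering_action.intro covering_action.intro
    classifying_action_axioms.intro contractible_covering_action_axioms.intro covering_action_axioms.intro)
  show "group \<Gamma>" by (rule group_\<Gamma>)
  show "contractible_space (OT_cover s t)" by (rule contractible_cover)
  show "base \<in> U" by (rule base)
  show "continuous_map (OT_cover s t) (OT_cover s t) (act g)" if "g \<in> carrier \<Gamma>" for g
    using that act_continuous by (auto simp: carrier_\<Gamma>)
  show "act \<one>\<^bsub>\<Gamma>\<^esub> w = w" if "w \<in> U" for w
  proof -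
    have "act (1, 0) w = (\<lambda>i\<in>{..<s + t}. w i)"
      unfolding act_eq[OF that] by (rule restrict_ext) (simp add: \<sigma>_0 \<sigma>_1)
    also have "\<dots> = w" using that unfolding U_eq by (auto simp: PiE_iff extensional_restrict)
    finally show ?thesis by (simp add: one_\<Gamma>)
  qed
  show "act (g \<otimes>\<^bsub>\<Gamma>\<^esub> h) w = act g (act h w)" if gh: "g \<in> carrier \<Gamma>" "h \<in> carrier \<Gamma>" and w: "w \<in> U" for g h w
  proof -
    obtain a c b d where ab: "g = (a, c)" "h = (b, d)" "b \<in> A" using gh by (auto simp: carrier_\<Gamma>)
    have "act (a * b, a * d + c) w = act (a, c) (act (b, d) w)"
      unfolding act_eq[OF act_U[OF ab(3) w]] unfolding act_eq[OF w]
      by (rule restrict_ext) (simp add: \<sigma>_add \<sigma>_mult algebra_simps)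
    then show ?thesis by (simp add: ab mult_\<Gamma>)
  qed
  show "\<exists>W. openin (OT_cover s t) W \<and> y \<in> W \<and> (\<forall>g\<in>carrier \<Gamma>. \<forall>w\<in>W. act g w \<in> W \<longrightarrow> g = \<one>\<^bsub>\<Gamma>\<^esub>)"
    if "y \<in> U" for y
    using lg_discrete wandering_neighbourhood[OF that] by metis
  show "(e i, 0) \<in> carrier \<Gamma>" if "i < s" for i using e_A[OF that] O_closed by (simp add: carrier_\<Gamma>)
  show "(e i, 0) \<otimes>\<^bsub>\<Gamma>\<^esub> (e j, 0) = (e j, 0) \<otimes>\<^bsub>\<Gamma>\<^esub> (e i, 0)" for i j by (simp add: mult_\<Gamma> mult.commute)
  show "n i (fst (e j, 0 :: 'k)) = (if i = j then 1 else 0)" if "i < s" "j < s" for i j using n_e that by simp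
  show "L i (act g w) = L i w + n i (fst g)" if "i < s" and g: "g \<in> carrier \<Gamma>" and w: "w \<in> U" for i g w
  proof -
    obtain a c where ac: "g = (a, c)" "a \<in> A" using g by (auto simp: carrier_\<Gamma>)
    have "L i (act g w) = (\<Sum>j<s. D i j * (lg a j + ln (Im (w j))))"
      unfolding L_def
    proof (rule sum.cong)
      fix j assume "j \<in> {..<s}"
      then have j: "j < s" by simp
      show "D i j * ln (Im (act g w j)) = D i j * (lg a j + ln (Im (w j)))"
        using Im_act[OF w j, of a c] A_pos[OF ac(2) j] U_Im[OF w j] by (simp add: ac lg_def ln_mult)
    qed simp
    then show ?thesis by (simp add: L_def n_def ac distrib_left sum.distrib)
  qed
  show "\<exists>\<gamma>. \<forall>g\<in>carrier \<Gamma>. \<forall>h\<in>carrier \<Gamma>. c g h = (\<gamma> (g \<otimes>\<^bsub>\<Gamma>\<^esub> h) - \<gamma> g - \<gamma> h :: real)"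
    if "\<And>g h l. g \<in> carrier \<Gamma> \<Longrightarrow> h \<in> carrier \<Gamma> \<Longrightarrow> l \<in> carrier \<Gamma> \<Longrightarrow>
          c h l + c g (h \<otimes>\<^bsub>\<Gamma>\<^esub> l) = c g h + c (g \<otimes>\<^bsub>\<Gamma>\<^esub> h) l"
      "\<And>g. g \<in> carrier \<Gamma> \<Longrightarrow> c \<one>\<^bsub>\<Gamma>\<^esub> g = 0" "\<And>g. g \<in> carrier \<Gamma> \<Longrightarrow> c g \<one>\<^bsub>\<Gamma>\<^esub> = 0"
      "\<And>i j. i < s \<Longrightarrow> j < s \<Longrightarrow> c (e i, 0) (e j, 0) = c (e j, 0) (e i, 0)" for c
    by (rule affine_cocycle_trivial) (fact that)+
qed


end

theorem corollary3p10:
  fixes s t :: nat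
    and \<sigma> :: "nat \<Rightarrow> 'k::field_char_0 \<Rightarrow> complex"
    and A :: "'k set"
  assumes "number_field TYPE('k)"
    and "0 < s" and "0 < t"
    and "enumerates_embeddings s t \<sigma>"
    and "admissible s t \<sigma> A"
    and "odd s"
  shows "vectorspace.fin_dim class_ring (real_cohomology 2 (OT_manifold s t \<sigma> A)) \<and>
         vectorspace.dim class_ring (real_cohomology 2 (OT_manifold s t \<sigma> A)) = s choose 2"
proof -
  interpret OT s t \<sigma> A by unfold_locales (use assms in auto)
  show ?thesis
  proof (rule full_lattice_coordinates[OF full_lattice_lg])
    fix e D
    assume e: "\<And>j. j < s \<Longrightarrow> e j \<in> A"
      and D: "\<And>a i. a \<in> A \<Longrightarrow> i < s \<Longrightarrow> (\<Sum>j<s. D i j * lg a j) \<in> \<int>"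
        "\<And>i k. i < s \<Longrightarrow> k < s \<Longrightarrow> (\<Sum>j<s. D i j * lg (e k) j) = (if i = k then 1 else 0)"
        "\<And>x j. (\<And>i. i < s \<Longrightarrow> (\<Sum>j<s. D i j * x j) = 0) \<Longrightarrow> j < s \<Longrightarrow> x j = 0"
    interpret OT_basis s t \<sigma> A e D by unfold_locales (fact e D)+
    show ?thesis using cohomology_dim unfolding X_def OT_manifold_def .
  qed
qed

end
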